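(* Let $f:\mathbb{R}^{n}\to\mathbb{R}$ be a nonnegative strictly convex function. For a nonzero real number $\alpha$ with $\alpha\neq 1$, let $g$ be the function defined by $g(x,z)=z^{\alpha}-f(x)$, $x=(x_1,\dots,x_n)$. Suppose that the level hypersurfaces $M_k=g^{-1}(k)$ ($k\in S_g$) of $g$ in the $(n+1)$-dimensional Euclidean space $\mathbb{E}^{n+1}$ are strictly convex. Then the following are equivalent. 1) (Condition $(V^* )$) For $k\in S_g$ with $k+h\in I_k$, $V_p^*(k,h)$ with $p\in M_k$ is a nonnegative function $\phi_k(h)$ which depends only on $k$ and $h$ (not on $p$). 2) (Condition $(A^* )$) For $k\in S_g$ with $k+h\in I_k$, $A_p^*(k,h)/|\nabla g(p)|$ with $p\in M_k$ is a nonnegative function $\psi_k(h)$ which depends only on $k$ and $h$ (not on $p$). 3) For each $k\in S_g$, $K(p)|\nabla g(p)|^{n+2}=c(k)$ is constant on $M_k$, where $K(p)$ denotes the Gauss-Kronecker curvature of $M_k$ at $p\in M_k$ with respect to the unit normal pointing to the convex side. 4) The function $g$ is given by $$g(x,z)=z^2-(a_1^2x_1^2+\cdots+a_n^2x_n^2),$$ where $a_i>0$, $i=1,2,\dots,n$. In this case, $R_g=\mathbb{R}\setminus\{0\}$, $S_g=(0,\infty)$ and $I_k=(k,\infty)$ for $k\in S_g$.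
   Context: All objects are smooth and connected unless otherwise mentioned. A convex hypersurface of $\mathbb{R}^{n+1}$ is called strictly convex if it has positive normal curvatures with respect to the unit normal $N$ pointing to the convex side (in particular its Gauss-Kronecker curvature $K$ with respect to $N$ is positive). A convex function $f:\mathbb{R}^n\to\mathbb{R}$ is called strictly convex if its graph is strictly convex with respect to the upward unit normal. For a smooth function $g$ of $(x,z)\in\mathbb{R}^{n+1}$: $R_g$ is the set of regular values of $g$. It is assumed that there is an interval $S\subset R_g$ such that for every $k\in S$ the level hypersurface $M_k=g^{-1}(k)$ is a smooth strictly convex hypersurface in $\mathbb{E}^{n+1}$; $S_g$ denotes the maximal interval in $R_g$ with this property. For $k\in S_g$, $I_k\subset S_g$ is a maximal interval such that each $M_{k+h}$ with $k+h\in I_k$ lies in the convex side of $M_k$; it is of the form $(k,a)$ with $a>k$ or $(b,k)$ with $b<k$ according as the gradient $\nabla g$ points to the convex side of $M_k$ or not. For $k\in S_g$, $p\in M_k$ and sufficiently small $h$ with $k+h\in I_k$, let $\Psi$ be the tangent hyperplane of $M_k$ at $p$ and let $\Phi$ be the tangent hyperplane of $M_{k+h}$ at some point $v\in M_{k+h}$ which is parallel to $\Psi$. Then $A_p^*(k,h)$ is the $n$-dimensional area of the section in $\Phi$ enclosed by $\Phi\cap M_k$, and $V_p^*(k,h)$ is the $(n+1)$-dimensional volume of the region bounded by $M_k$ and the hyperplane $\Phi$.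
   Formalization: Condition 4) is proved up to a rigid motion of x-space and a constant: g = z²−Σa_i²x_i²−c, with R_g = ℝ∖{−c}, S_g = (−c,∞), I_k = (k,∞). As stated, 4) fails: f(x) = x²+1, α = 2 satisfies 1)–3) but is not of the given form. *)

theory Defs
  imports "HOL-Analysis.Analysis"
begin

text \<open>
  Euclidean space of dimension n + 1 is the product type \<open>(real^'n) \<times> real\<close> with n = CARD('n);
  a point is a pair (x, z), and distance, inner product and Lebesgue measure are the
  standard Euclidean ones.
\<close>

type_synonym 'n pt = "(real^'n) \<times> real"

subsection \<open>Smooth functions, gradients and regular values\<close>

primrec times_cont_diff :: "nat \<Rightarrow> ('a::euclidean_space \<Rightarrow> real) \<Rightarrow> bool" where
  "times_cont_diff 0 f \<longleftrightarrow> continuous_on UNIV f"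
| "times_cont_diff (Suc m) f \<longleftrightarrow>
     (\<forall>x. f differentiable (at x)) \<and> (\<forall>v. times_cont_diff m (\<lambda>x. frechet_derivative f (at x) v))"

definition smooth :: "('a::euclidean_space \<Rightarrow> real) \<Rightarrow> bool" where
  "smooth f \<longleftrightarrow> (\<forall>m. times_cont_diff m f)"

text \<open>
  The set D is the domain of the function G. Derivatives are taken within D, so they are
  the ordinary ones at interior points; at a boundary point of a closed half-space they are
  still unique.
\<close>

definition gradient :: "'a::euclidean_space set \<Rightarrow> ('a \<Rightarrow> real) \<Rightarrow> 'a \<Rightarrow> 'a" where
  "gradient D G p = (THE v. (G has_derivative (\<lambda>w. v \<bullet> w)) (at p within D))"

definition level_set :: "'a set \<Rightarrow> ('a \<Rightarrow> real) \<Rightarrow> real \<Rightarrow> 'a set" where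
  "level_set D G k = {p \<in> D. G p = k}"

definition regular_values :: "'a::euclidean_space set \<Rightarrow> ('a \<Rightarrow> real) \<Rightarrow> real set" where
  "regular_values D G =
     {k. \<forall>p\<in>level_set D G k. \<exists>v. v \<noteq> 0 \<and> (G has_derivative (\<lambda>w. v \<bullet> w)) (at p within D)}"

subsection \<open>Curvature of level hypersurfaces\<close>

definition unit_normal :: "'a::euclidean_space set \<Rightarrow> ('a \<Rightarrow> real) \<Rightarrow> 'a \<Rightarrow> 'a" where
  "unit_normal D G q = gradient D G q /\<^sub>R norm (gradient D G q)"

text \<open>
  Second fundamental form at p of the level hypersurface of G through p, with respect to the
  unit normal field N = s * grad G / |grad G|, where s is 1 or -1: for tangent vectors v, w it
  is <S v, w>, where S = - dN is the shape operator. For a unit tangent vector v the number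
  II (v, v) is the normal curvature in direction v.
\<close>

definition second_fundamental_form ::
    "'a::euclidean_space set \<Rightarrow> ('a \<Rightarrow> real) \<Rightarrow> real \<Rightarrow> 'a \<Rightarrow> 'a \<Rightarrow> 'a \<Rightarrow> real" where
  "second_fundamental_form D G s p v w =
     - (frechet_derivative (\<lambda>q. s *\<^sub>R unit_normal D G q) (at p within D) v \<bullet> w)"

definition positive_normal_curvatures ::
    "'a::euclidean_space set \<Rightarrow> ('a \<Rightarrow> real) \<Rightarrow> real \<Rightarrow> 'a \<Rightarrow> bool" where
  "positive_normal_curvatures D G s p \<longleftrightarrow>
     (\<forall>v. norm v = 1 \<and> v \<bullet> gradient D G p = 0 \<longrightarrow> 0 < second_fundamental_form D G s p v v)"

text \<open>
  Determinant of the shape operator, i.e. the determinant of the matrix of the second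
  fundamental form in an orthonormal basis of the tangent space (independent of the basis).
\<close>

definition orthonormal_tangent_basis ::
    "'n pt set \<Rightarrow> ('n pt \<Rightarrow> real) \<Rightarrow> 'n pt \<Rightarrow> ('n::finite \<Rightarrow> 'n pt) \<Rightarrow> bool" where
  "orthonormal_tangent_basis D G p b \<longleftrightarrow>
     (\<forall>i j. b i \<bullet> b j = (if i = j then 1 else 0)) \<and> (\<forall>i. b i \<bullet> gradient D G p = 0)"

definition gauss_kronecker_curvature ::
    "('n::finite) pt set \<Rightarrow> ('n pt \<Rightarrow> real) \<Rightarrow> real \<Rightarrow> 'n pt \<Rightarrow> real" where
  "gauss_kronecker_curvature D G s p =
     (let b = (SOME b. orthonormal_tangent_basis D G p b)
      in det (\<chi> i j. second_fundamental_form D G s p (b i) (b j)))"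

subsection \<open>Convex hypersurfaces\<close>

definition bounds_convex :: "'a::euclidean_space set \<Rightarrow> 'a set \<Rightarrow> bool" where
  "bounds_convex M C \<longleftrightarrow> closed C \<and> convex C \<and> interior C \<noteq> {} \<and> frontier C = M"

definition convex_hypersurface :: "'a::euclidean_space set \<Rightarrow> bool" where
  "convex_hypersurface M \<longleftrightarrow> M \<noteq> {} \<and> (\<exists>C. bounds_convex M C)"

text \<open>
  The convex side, taken as a closed set. It is unique unless M is a hyperplane, so in
  particular for the strictly convex hypersurfaces below.
\<close>

definition convex_side :: "'a::euclidean_space set \<Rightarrow> 'a set" where
  "convex_side M = (THE C. bounds_convex M C)"

text \<open>
  The sign for which the unit normal s * grad G / |grad G| at p points to the convex side of M.
\<close>

definition inward_sign ::
    "'a::euclidean_space set \<Rightarrow> ('a \<Rightarrow> real) \<Rightarrow> 'a set \<Rightarrow> 'a \<Rightarrow> real" where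
  "inward_sign D G M p =
     (if \<exists>e>0. \<forall>t. 0 < t \<and> t < e \<longrightarrow> p + t *\<^sub>R gradient D G p \<in> interior (convex_side M)
      then 1 else -1)"

text \<open>
  Positive curvature excludes slabs, so these hypersurfaces are automatically connected.
  Smoothness of the level set is provided by regularity of the value k.
\<close>

definition strictly_convex_level ::
    "'a::euclidean_space set \<Rightarrow> ('a \<Rightarrow> real) \<Rightarrow> real \<Rightarrow> bool" where
  "strictly_convex_level D G k \<longleftrightarrow>
     (let M = level_set D G k in
        convex_hypersurface M \<and>
        (\<forall>p\<in>M. positive_normal_curvatures D G (inward_sign D G M p) p))"

text \<open>
  The graph of f is the zero level of z - f x, whose gradient (- grad f, 1) points upward.
\<close>

definition strictly_convex_function :: "(real^'n \<Rightarrow> real) \<Rightarrow> bool" where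
  "strictly_convex_function f \<longleftrightarrow>
     convex_on UNIV f \<and>
     (\<forall>x. positive_normal_curvatures UNIV (\<lambda>(x, z). z - f x) 1 (x, f x))"

subsection \<open>Sections and caps cut off by hyperplanes\<close>

definition tangent_hyperplane ::
    "'a::euclidean_space set \<Rightarrow> ('a \<Rightarrow> real) \<Rightarrow> 'a \<Rightarrow> 'a set" where
  "tangent_hyperplane D G p = {q. (q - p) \<bullet> gradient D G p = 0}"

text \<open>
  n-dimensional Lebesgue measure of a subset B of the hyperplane P, transported from \<open>real^'n\<close>
  by an isometry onto P (independent of the isometry).
\<close>

definition hyperplane_area :: "('n::finite) pt set \<Rightarrow> 'n pt set \<Rightarrow> real" where
  "hyperplane_area P B =
     (let \<tau> = (SOME \<tau> :: real^'n \<Rightarrow> 'n pt. range \<tau> = P \<and> (\<forall>y y'. dist (\<tau> y) (\<tau> y') = dist y y'))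
      in measure lebesgue (\<tau> -` B))"

text \<open>The part of P enclosed by its intersection with M.\<close>

definition section_of :: "'a::euclidean_space set \<Rightarrow> 'a set \<Rightarrow> 'a set" where
  "section_of M P = convex_side M \<inter> P"

text \<open>
  The region bounded by M and the hyperplane P on the side of P containing the point p (p not in P):
  the points of the convex side of M that P does not strictly separate from p.
\<close>

definition cap_of :: "'a::euclidean_space set \<Rightarrow> 'a \<Rightarrow> 'a set \<Rightarrow> 'a set" where
  "cap_of M p P = {q \<in> convex_side M. open_segment p q \<inter> P = {}}"

subsection \<open>The function z^a - f x\<close>

text \<open>
  The natural domain of the real power z^a: z > 0 if a < 0, and z \<ge> 0 (with 0^a = 0) if a > 0.
  For a = 2 the level sets with positive value are then single sheets of hyperboloids, and the
  apex of the cone is still in the domain, which makes its value critical.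
\<close>

definition power_dom :: "real \<Rightarrow> 'n pt set" where
  "power_dom \<alpha> = {(x, z). if \<alpha> < 0 then 0 < z else 0 \<le> z}"

definition gfun :: "(real^'n \<Rightarrow> real) \<Rightarrow> real \<Rightarrow> 'n pt \<Rightarrow> real" where
  "gfun f \<alpha> = (\<lambda>(x, z). z powr \<alpha> - f x)"

abbreviation Mk :: "(real^'n \<Rightarrow> real) \<Rightarrow> real \<Rightarrow> real \<Rightarrow> 'n pt set" where
  "Mk f \<alpha> k \<equiv> level_set (power_dom \<alpha>) (gfun f \<alpha>) k"

abbreviation grad_g :: "(real^'n \<Rightarrow> real) \<Rightarrow> real \<Rightarrow> 'n pt \<Rightarrow> 'n pt" where
  "grad_g f \<alpha> \<equiv> gradient (power_dom \<alpha>) (gfun f \<alpha>)"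

abbreviation tangent_g :: "(real^'n \<Rightarrow> real) \<Rightarrow> real \<Rightarrow> 'n pt \<Rightarrow> 'n pt set" where
  "tangent_g f \<alpha> \<equiv> tangent_hyperplane (power_dom \<alpha>) (gfun f \<alpha>)"

abbreviation Rg :: "(real^'n \<Rightarrow> real) \<Rightarrow> real \<Rightarrow> real set" where
  "Rg f \<alpha> \<equiv> regular_values (power_dom \<alpha>) (gfun f \<alpha>)"

definition maximal_interval :: "(real \<Rightarrow> bool) \<Rightarrow> real set \<Rightarrow> bool" where
  "maximal_interval P J \<longleftrightarrow>
     is_interval J \<and> (\<forall>k\<in>J. P k) \<and>
     (\<forall>J'. is_interval J' \<and> (\<forall>k\<in>J'. P k) \<and> J \<subseteq> J' \<longrightarrow> J' = J)"

definition is_Sg :: "(real^'n \<Rightarrow> real) \<Rightarrow> real \<Rightarrow> real set \<Rightarrow> bool" where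
  "is_Sg f \<alpha> S \<longleftrightarrow>
     S \<noteq> {} \<and>
     maximal_interval
       (\<lambda>k. k \<in> Rg f \<alpha> \<and> strictly_convex_level (power_dom \<alpha>) (gfun f \<alpha>) k) S"

definition is_Ik :: "(real^'n \<Rightarrow> real) \<Rightarrow> real \<Rightarrow> real set \<Rightarrow> real \<Rightarrow> real set \<Rightarrow> bool" where
  "is_Ik f \<alpha> S k J \<longleftrightarrow>
     maximal_interval (\<lambda>j. j \<in> S \<and> Mk f \<alpha> j \<subseteq> interior (convex_side (Mk f \<alpha> k))) J"

text \<open>
  In the two conditions below, \<open>\<epsilon> k p\<close> is the (possibly infinite) bound that makes h sufficiently
  small. The point v is where the tangent hyperplane of the level k + h is parallel to
  the one of the level k at p; unbounded caps and sections, which are not enclosed by the level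
  hypersurface, are excluded.
\<close>

definition condition_V ::
    "(real^'n \<Rightarrow> real) \<Rightarrow> real \<Rightarrow> real set \<Rightarrow> (real \<Rightarrow> real set) \<Rightarrow> (real \<Rightarrow> 'n pt \<Rightarrow> ereal) \<Rightarrow> bool" where
  "condition_V f \<alpha> S I \<epsilon> \<longleftrightarrow>
     (\<forall>k\<in>S. \<exists>\<phi> :: real \<Rightarrow> real. \<forall>h. k + h \<in> I k \<longrightarrow>
        0 \<le> \<phi> h \<and>
        (\<forall>p\<in>Mk f \<alpha> k. \<forall>v\<in>Mk f \<alpha> (k + h).
           ereal \<bar>h\<bar> < \<epsilon> k p \<and>
           affine_parallel (tangent_g f \<alpha> p) (tangent_g f \<alpha> v) \<and>
           bounded (cap_of (Mk f \<alpha> k) p (tangent_g f \<alpha> v)) \<longrightarrow>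
           measure lebesgue (cap_of (Mk f \<alpha> k) p (tangent_g f \<alpha> v)) = \<phi> h))"

definition condition_A ::
    "(real^'n \<Rightarrow> real) \<Rightarrow> real \<Rightarrow> real set \<Rightarrow> (real \<Rightarrow> real set) \<Rightarrow> (real \<Rightarrow> 'n pt \<Rightarrow> ereal) \<Rightarrow> bool" where
  "condition_A f \<alpha> S I \<epsilon> \<longleftrightarrow>
     (\<forall>k\<in>S. \<exists>\<psi> :: real \<Rightarrow> real. \<forall>h. k + h \<in> I k \<longrightarrow>
        0 \<le> \<psi> h \<and>
        (\<forall>p\<in>Mk f \<alpha> k. \<forall>v\<in>Mk f \<alpha> (k + h).
           ereal \<bar>h\<bar> < \<epsilon> k p \<and>
           affine_parallel (tangent_g f \<alpha> p) (tangent_g f \<alpha> v) \<and>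
           bounded (section_of (Mk f \<alpha> k) (tangent_g f \<alpha> v)) \<longrightarrow>
           hyperplane_area (tangent_g f \<alpha> v) (section_of (Mk f \<alpha> k) (tangent_g f \<alpha> v))
             / norm (grad_g f \<alpha> p) = \<psi> h))"

definition condition_K :: "(real^'n \<Rightarrow> real) \<Rightarrow> real \<Rightarrow> real set \<Rightarrow> bool" where
  "condition_K f \<alpha> S \<longleftrightarrow>
     (\<forall>k\<in>S. \<exists>c. \<forall>p\<in>Mk f \<alpha> k.
        gauss_kronecker_curvature (power_dom \<alpha>) (gfun f \<alpha>)
          (inward_sign (power_dom \<alpha>) (gfun f \<alpha>) (Mk f \<alpha> k) p) p
        * norm (grad_g f \<alpha> p) ^ (CARD('n) + 2) = c)"

text \<open>
  g (x, z) = z^2 - (a_1^2 x_1^2 + ... + a_n^2 x_n^2) in suitable Euclidean coordinates of the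
  x-space (a rigid motion T) and up to the additive constant c = min f. Neither normalization can be
  dropped: conditions V, A and K are invariant under rigid motions of the x-space and under
  adding a nonnegative constant to f, which only relabels the levels.
\<close>

definition hyperboloid_form :: "(real^'n \<Rightarrow> real) \<Rightarrow> real \<Rightarrow> real \<Rightarrow> bool" where
  "hyperboloid_form f \<alpha> c \<longleftrightarrow>
     (\<exists>(a :: real^'n) T. (\<forall>i. 0 < a $ i) \<and> (\<forall>x y. dist (T x) (T y) = dist x y) \<and>
        (\<forall>x z. (x, z) \<in> power_dom \<alpha> \<longrightarrow>
           gfun f \<alpha> (T x, z) = z\<^sup>2 - (\<Sum>i\<in>UNIV. (a $ i)\<^sup>2 * (x $ i)\<^sup>2) - c))"

end

theory Submission
  imports Defs "HOL-Real_Asymp.Real_Asymp"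
begin

text \<open>
  Let \<open>k\<close> be a level, \<open>M\<^sub>k\<close> the graph of \<open>u = (k + f) powr (1 / \<alpha>)\<close> and \<open>p\<close> a point of \<open>M\<^sub>k\<close>. In the direction of the
  normal at \<open>p\<close>, the caps and sections of \<open>M\<^sub>k\<close> cut off by parallel hyperplanes at small height \<open>t\<close> are asymptotic to those of
  the osculating paraboloid, whose sections are ellipsoids of volume proportional to
  \<open>t powr (n / 2) / sqrt (det D\<^sup>2u)\<close>. Since \<open>t / h\<close> tends to the inverse of the \<open>z\<close>-derivative of \<open>g\<close>, comparison of
  the leading terms as \<open>h\<close> tends to 0 shows that each of (V*) and (A*) implies that \<open>K * norm (grad g) ^ (n + 2)\<close> is
  constant on \<open>M\<^sub>k\<close>.

  In terms of \<open>f\<close> this product is \<open>\<alpha>\<^sup>2 w powr (2\<beta>) det (D\<^sup>2f) (1 - \<beta> Q / w)\<close> up to sign, where \<open>w = k + f\<close>,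
  \<open>\<beta> = (\<alpha> - 1) / \<alpha>\<close> and \<open>Q\<close> is the square of the Newton decrement, \<open>grad f\<close> paired with \<open>X = (D\<^sup>2f)\<^sup>-\<^sup>1 grad f\<close>.
  The set of admissible levels is unbounded. For \<open>\<alpha> < 0\<close> the product degenerates as \<open>w\<close> tends to 0, which is
  impossible. For \<open>\<alpha> > 0\<close> the expansion as \<open>k\<close> tends to infinity shows that \<open>det (D\<^sup>2f)\<close> is constant and
  \<open>Q = 2 (f - m)\<close>, and then \<open>\<alpha> = 2\<close>. The identity \<open>Q = 2 (f - m)\<close> makes the integral curves
  of \<open>X\<close> straight lines that run into a common critical point, and \<open>f - m\<close> is homogeneous of degree 2 about it, hence
  quadratic. Conversely, for a hyperboloid all sections are ellipsoids, whose volumes are computed explicitly.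
\<close>

section \<open>Derivatives of smooth functions\<close>

text \<open>For either sign of \<alpha> the hypersurface is the graph of a convex
  \<open>u k\<close>, but the gradient of g points into the epigraph only for \<alpha> > 0, and
  \<open>u k\<close> rises with \<open>sgn \<alpha> * k\<close>. The factor
  \<open>sgn \<alpha>\<close> absorbs the two cases. Positive definiteness of
  \<open>sgn \<alpha> *\<^sub>R B k x\<close> survives every increase of
  \<open>sgn \<alpha> * k\<close>; therefore k may run to infinity for \<alpha> > 0 and down to
  \<open>- f x\<close> for \<alpha> < 0, and one equation between two points becomes a whole
  expansion in k.

  The delicate step is the straightness of the curves of X, because X is given only pointwise as the
  solution of a linear system. It is never differentiated. The squared distance of X from a fixed
  vector v, in the Hessian norm, is by completing the square an expression in f and its first two
  derivatives along v. Being nonnegative, it has a vanishing gradient where v = X, which kills the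
  third derivative of f in two directions X. Along a ray the third derivative in the ray direction
  is then at least quadratic in the error, so the error satisfies a Gronwall inequality and stays
  zero.\<close>

lemma smooth_times: "smooth f \<Longrightarrow> times_cont_diff m f"
  by (simp add: smooth_def)

lemma smooth_differentiable: "smooth f \<Longrightarrow> f differentiable (at x)"
  using smooth_times[of f 1] by simp

lemma smooth_frechet: "smooth f \<Longrightarrow> smooth (\<lambda>x. frechet_derivative f (at x) v)"
  unfolding smooth_def by (metis times_cont_diff.simps(2))

lemma smooth_continuous_on: "smooth f \<Longrightarrow> continuous_on A f"
  using smooth_times[of f 0] continuous_on_subset by auto

lemma smooth_isCont: "smooth f \<Longrightarrow> isCont f x"
  using smooth_times[of f 0] by (simp add: continuous_on_eq_continuous_at)

text \<open>The direction comes first so that \<open>dir v f\<close> is again a scalar function and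
  iterated derivatives are iterated \<open>dir\<close>.\<close>

definition dir :: "'a::euclidean_space \<Rightarrow> ('a \<Rightarrow> real) \<Rightarrow> 'a \<Rightarrow> real" where
  "dir v f x = frechet_derivative f (at x) v"

lemma smooth_dir: "smooth f \<Longrightarrow> smooth (dir v f)"
  unfolding dir_def by (rule smooth_frechet)

lemma dir_has_derivative: "smooth f \<Longrightarrow> (f has_derivative (\<lambda>v. dir v f x)) (at x)"
  unfolding dir_def using smooth_differentiable frechet_derivative_works by blast

lemma dir_linear: "smooth f \<Longrightarrow> linear (\<lambda>v. dir v f x)"
  using dir_has_derivative has_derivative_linear by blast

lemma dir_line:
  assumes "smooth f"
  shows "((\<lambda>s. f (x + s *\<^sub>R v)) has_real_derivative dir v f (x + s *\<^sub>R v)) (at s within A)"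
proof -
  have "((\<lambda>s. f (x + s *\<^sub>R v)) has_derivative (\<lambda>h. dir (h *\<^sub>R v) f (x + s *\<^sub>R v))) (at s within A)"
    by (rule has_derivative_compose[OF _ dir_has_derivative[OF assms]])
      (auto intro!: derivative_eq_intros)
  moreover have "dir (h *\<^sub>R v) f (x + s *\<^sub>R v) = h * dir v f (x + s *\<^sub>R v)" for h
    using linear_cmul[OF dir_linear[OF assms]] by auto
  moreover have "(\<lambda>h. h * dir v f (x + s *\<^sub>R v)) = (*) (dir v f (x + s *\<^sub>R v))"
    by (auto simp: mult.commute)
  ultimately show ?thesis
    by (simp add: has_field_derivative_def)
qed

text \<open>The second difference over the parallelogram spanned by h v and h w is the increment in
  direction v of the difference across h w. The mean value theorem in v and then in w turns it into
  a mixed derivative at some point of the parallelogram.\<close>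

lemma second_difference:
  assumes f: "smooth f" and h: "0 < (h::real)"
  shows "\<exists>s t. 0 < s \<and> s < h \<and> 0 < t \<and> t < h \<and>
     f (x + h *\<^sub>R v + h *\<^sub>R w) - f (x + h *\<^sub>R v) - f (x + h *\<^sub>R w) + f x
       = h\<^sup>2 * dir w (dir v f) (x + s *\<^sub>R v + t *\<^sub>R w)"
proof -
  define \<phi> where "\<phi> s = f ((x + h *\<^sub>R w) + s *\<^sub>R v) - f (x + s *\<^sub>R v)" for s
  have "\<exists>s. 0 < s \<and> s < h \<and> \<phi> h - \<phi> 0 =
      (h - 0) * (dir v f ((x + h *\<^sub>R w) + s *\<^sub>R v) - dir v f (x + s *\<^sub>R v))"
    unfolding \<phi>_def
    by (intro MVT2 DERIV_diff dir_line f h)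
  then obtain s where s: "0 < s" "s < h" and 1: "\<phi> h - \<phi> 0 =
      h * (dir v f ((x + s *\<^sub>R v) + h *\<^sub>R w) - dir v f (x + s *\<^sub>R v))"
    by (auto simp: algebra_simps)
  have "\<exists>t. 0 < t \<and> t < h \<and> dir v f ((x + s *\<^sub>R v) + h *\<^sub>R w) - dir v f ((x + s *\<^sub>R v) + 0 *\<^sub>R w)
      = (h - 0) * dir w (dir v f) ((x + s *\<^sub>R v) + t *\<^sub>R w)"
    by (intro MVT2 dir_line smooth_dir f h)
  then obtain t where t: "0 < t" "t < h" and 2: "dir v f ((x + s *\<^sub>R v) + h *\<^sub>R w) - dir v f (x + s *\<^sub>R v)
      = h * dir w (dir v f) ((x + s *\<^sub>R v) + t *\<^sub>R w)"
    by auto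
  show ?thesis
    using s t 1 2 unfolding \<phi>_def
    by (intro exI[of _ s] exI[of _ t]) (auto simp: algebra_simps power2_eq_square)
qed

text \<open>The second difference is symmetric in v and w, so the mixed derivative of one order at
  some point near x equals that of the other order at another such point; continuity closes the
  gap.\<close>

lemma dir_commute:
  assumes f: "smooth f"
  shows "dir w (dir v f) x = dir v (dir w f) x"
proof (rule ccontr)
  define A where "A = dir w (dir v f)"
  define B where "B = dir v (dir w f)"
  assume "dir w (dir v f) x \<noteq> dir v (dir w f) x"
  then have e: "0 < \<bar>A x - B x\<bar> / 2" by (simp add: A_def B_def)
  have cA: "isCont A x" "isCont B x"
    unfolding A_def B_def by (auto intro!: smooth_isCont smooth_dir f)
  obtain d1 where d1: "d1 > 0" "\<And>y. dist y x < d1 \<Longrightarrow> dist (A y) (A x) < \<bar>A x - B x\<bar> / 2"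
    using cA(1) e unfolding continuous_at_eps_delta by metis
  obtain d2 where d2: "d2 > 0" "\<And>y. dist y x < d2 \<Longrightarrow> dist (B y) (B x) < \<bar>A x - B x\<bar> / 2"
    using cA(2) e unfolding continuous_at_eps_delta by metis
  define d where "d = min d1 d2"
  \<comment> \<open>For this h the whole parallelogram lies within distance d of x; the summand 1
    covers v = w = 0.\<close>
  define h where "h = d / (2 * (norm v + norm w + 1))"
  have N: "0 < norm v + norm w + 1" by (simp add: add_nonneg_pos)
  have d: "0 < d" using d1(1) d2(1) by (simp add: d_def)
  have h: "0 < h" "h * (norm v + norm w + 1) < d"
  proof -
    have "h * (norm v + norm w + 1) = d / 2" using N by (simp add: h_def field_simps)
    then show "h * (norm v + norm w + 1) < d" using d by simp
  qed (use d N in \<open>simp add: h_def\<close>)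
  have near: "dist (x + s *\<^sub>R v + t *\<^sub>R w) x < d" if "0 < s" "s < h" "0 < t" "t < h" for s t
  proof -
    have "dist (x + s *\<^sub>R v + t *\<^sub>R w) x = norm (s *\<^sub>R v + t *\<^sub>R w)"
      by (simp add: dist_norm)
    also have "\<dots> \<le> s * norm v + t * norm w"
      using that by (intro norm_triangle_le) auto
    also have "\<dots> \<le> h * norm v + h * norm w"
      using that by (intro add_mono mult_right_mono) auto
    also have "\<dots> \<le> h * (norm v + norm w + 1)" using h by (simp add: algebra_simps)
    finally show ?thesis using h by simp
  qed
  obtain s t where st: "0 < s" "s < h" "0 < t" "t < h" and
    1: "f (x + h *\<^sub>R v + h *\<^sub>R w) - f (x + h *\<^sub>R v) - f (x + h *\<^sub>R w) + f x
       = h\<^sup>2 * A (x + s *\<^sub>R v + t *\<^sub>R w)"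
    using second_difference[OF f h(1), of x v w] unfolding A_def by blast
  obtain s' t' where st': "0 < s'" "s' < h" "0 < t'" "t' < h" and
    2: "f (x + h *\<^sub>R w + h *\<^sub>R v) - f (x + h *\<^sub>R w) - f (x + h *\<^sub>R v) + f x
       = h\<^sup>2 * B (x + s' *\<^sub>R w + t' *\<^sub>R v)"
    using second_difference[OF f h(1), of x w v] unfolding B_def by blast
  have "h\<^sup>2 * A (x + s *\<^sub>R v + t *\<^sub>R w) = h\<^sup>2 * B (x + s' *\<^sub>R w + t' *\<^sub>R v)"
    unfolding 1[symmetric] 2[symmetric] by (simp add: algebra_simps)
  then have eq: "A (x + s *\<^sub>R v + t *\<^sub>R w) = B (x + t' *\<^sub>R v + s' *\<^sub>R w)"
    using h(1) by (simp add: algebra_simps)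
  have "dist (A (x + s *\<^sub>R v + t *\<^sub>R w)) (A x) < \<bar>A x - B x\<bar> / 2"
    by (rule d1(2)) (use near[OF st] in \<open>simp add: d_def\<close>)
  moreover have "dist (B (x + t' *\<^sub>R v + s' *\<^sub>R w)) (B x) < \<bar>A x - B x\<bar> / 2"
    by (rule d2(2)) (use near[OF st'(3,4) st'(1,2)] in \<open>simp add: d_def\<close>)
  ultimately show False using eq by (auto simp: dist_real_def abs_if split: if_splits)
qed

definition grad :: "(real^'n \<Rightarrow> real) \<Rightarrow> real^'n \<Rightarrow> real^'n" where
  "grad f x = (\<chi> i. dir (axis i 1) f x)"

definition hess :: "(real^'n \<Rightarrow> real) \<Rightarrow> real^'n \<Rightarrow> real^'n^'n" where
  "hess f x = (\<chi> i j. dir (axis j 1) (dir (axis i 1) f) x)"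

lemma linear_axis_sum:
  fixes L :: "real^'n \<Rightarrow> real"
  assumes "linear L"
  shows "L v = (\<Sum>i\<in>UNIV. v $ i * L (axis i 1))"
proof -
  have "L v = L (\<Sum>i\<in>UNIV. v $ i *\<^sub>R (axis i 1 :: real^'n))"
    by (simp add: basis_expansion scalar_mult_eq_scaleR[symmetric])
  also have "\<dots> = (\<Sum>i\<in>UNIV. v $ i * L (axis i 1))"
    by (simp add: linear_sum[OF assms] linear_cmul[OF assms])
  finally show ?thesis .
qed

lemma dir_eq_grad: "smooth f \<Longrightarrow> dir v f x = grad f x \<bullet> v"
  by (subst linear_axis_sum[OF dir_linear]) (auto simp: grad_def inner_vec_def mult.commute)

lemma grad_has_derivative_real: "smooth f \<Longrightarrow> (f has_derivative (\<lambda>v. grad f x \<bullet> v)) (at x)"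
  using dir_has_derivative[of f x] by (simp add: dir_eq_grad)

lemma dir_dir_eq_hess:
  assumes "smooth f"
  shows "dir w (dir v f) x = v \<bullet> (hess f x *v w)"
proof -
  have "dir w (dir v f) x = dir v (dir w f) x" by (rule dir_commute[OF assms])
  also have "\<dots> = (\<Sum>i\<in>UNIV. v $ i * dir (axis i 1) (dir w f) x)"
    by (subst linear_axis_sum[OF dir_linear]) (auto intro: smooth_dir assms)
  also have "\<dots> = (\<Sum>i\<in>UNIV. v $ i * dir w (dir (axis i 1) f) x)"
    by (subst dir_commute[OF assms]) simp
  also have "\<dots> = (\<Sum>i\<in>UNIV. v $ i * (\<Sum>j\<in>UNIV. w $ j * hess f x $ i $ j))"
    by (subst linear_axis_sum[OF dir_linear]) (auto intro: smooth_dir assms simp: hess_def)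
  also have "\<dots> = v \<bullet> (hess f x *v w)"
    by (simp add: inner_vec_def matrix_vector_mult_def mult.commute)
  finally show ?thesis .
qed

lemma hess_sym: "smooth f \<Longrightarrow> transpose (hess f x) = hess f x"
  by (simp add: transpose_def hess_def vec_eq_iff dir_commute)

lemma grad_has_derivative:
  fixes f :: "real^'n \<Rightarrow> real"
  assumes "smooth f"
  shows "(grad f has_derivative (\<lambda>w. hess f x *v w)) (at x)"
proof (subst has_derivative_componentwise_within, intro ballI)
  fix i :: "real^'n" assume "i \<in> Basis"
  have "(dir i f has_derivative (\<lambda>w. dir w (dir i f) x)) (at x)"
    by (intro dir_has_derivative smooth_dir assms)
  moreover have "dir i f = (\<lambda>x. grad f x \<bullet> i)"
    by (simp add: fun_eq_iff dir_eq_grad[OF assms])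
  ultimately show "((\<lambda>x. grad f x \<bullet> i) has_derivative (\<lambda>w. (hess f x *v w) \<bullet> i)) (at x)"
    by (simp add: dir_dir_eq_hess[OF assms, symmetric] inner_commute[of _ i])
qed

lemma continuous_hess: "smooth f \<Longrightarrow> continuous_on A (hess f)"
  unfolding hess_def by (auto intro!: continuous_on_vec_lambda smooth_continuous_on smooth_dir)

lemma continuous_grad: "smooth f \<Longrightarrow> continuous_on A (grad f)"
  unfolding grad_def by (auto intro!: continuous_on_vec_lambda smooth_continuous_on smooth_dir)

section \<open>Positive definite matrices\<close>

definition pos_def :: "real^'n^'n \<Rightarrow> bool" where
  "pos_def A \<longleftrightarrow> transpose A = A \<and> (\<forall>x. x \<noteq> 0 \<longrightarrow> 0 < x \<bullet> (A *v x))"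

declare transpose_matrix_vector [simp del]

lemma sym_inner: "transpose A = A \<Longrightarrow> x \<bullet> (A *v y) = (A *v x) \<bullet> (y::real^'n)"
  by (metis dot_lmul_matrix inner_commute transpose_matrix_vector)

lemma inner_transpose_mult: "x \<bullet> (transpose A *v y) = (A *v x) \<bullet> (y::real^'n)"
  by (metis dot_lmul_matrix inner_commute transpose_matrix_vector transpose_transpose)

lemma inner_transpose_mult': "(transpose A *v y) \<bullet> x = (y::real^'n) \<bullet> (A *v x)"
  by (metis inner_transpose_mult inner_commute)

text \<open>A parabola through 0 that stays nonnegative has slope zero at 0. This is the first
  variation argument behind \<open>eigenvector_in_invariant_subspace\<close>.\<close>

lemma quadratic_minimum_zero:
  fixes b c :: real
  assumes "\<And>t. 0 \<le> t * b + t\<^sup>2 * c"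
  shows "b = 0"
proof (rule ccontr)
  assume b: "b \<noteq> 0"
  \<comment> \<open>At t = - b / C the linear term outweighs the quadratic one as soon as C exceeds
    the absolute value of c.\<close>
  define C where "C = 2 * (\<bar>c\<bar> + 1)"
  have C: "C > 0" "\<bar>c\<bar> < C" by (auto simp: C_def)
  have "0 \<le> (-b/C) * b + (-b/C)\<^sup>2 * c" by (rule assms)
  also have "\<dots> = (b\<^sup>2/C) * (c/C - 1)" using C by (simp add: field_simps power2_eq_square)
  finally have "0 \<le> c / C - 1" using b C by (simp add: zero_le_mult_iff zero_le_divide_iff)
  then show False using C by (simp add: field_simps)
qed

text \<open>The unit vector of S that minimizes the quadratic form of A is an eigenvector: its first
  variation in the direction w = A v - d v, which lies in S by invariance, is twice the squared norm
  of w.\<close>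

lemma eigenvector_in_invariant_subspace:
  fixes A :: "real^'n^'n"
  assumes A: "transpose A = A" and S: "subspace S" "S \<noteq> {0}" and inv: "\<And>x. x \<in> S \<Longrightarrow> A *v x \<in> S"
  shows "\<exists>v d. v \<in> S \<and> norm v = 1 \<and> A *v v = d *\<^sub>R v"
proof -
  define K where "K = S \<inter> sphere 0 1"
  have "compact K" unfolding K_def
    by (simp add: closed_Int_compact closed_subspace S(1))
  moreover have "K \<noteq> {}"
  proof -
    obtain x where x: "x \<in> S" "x \<noteq> 0" using S subspace_0 by blast
    then have "(1 / norm x) *\<^sub>R x \<in> K"
      using S(1) by (simp add: K_def subspace_scale)
    then show ?thesis by blast
  qed
  moreover have "continuous_on K (\<lambda>x. x \<bullet> (A *v x))"
    by (intro continuous_intros linear_continuous_on_compose matrix_vector_mul_linear)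
  ultimately obtain v where v: "v \<in> K" and min: "\<And>x. x \<in> K \<Longrightarrow> v \<bullet> (A *v v) \<le> x \<bullet> (A *v x)"
    using continuous_attains_inf by metis
  define d where "d = v \<bullet> (A *v v)"
  have vS: "v \<in> S" "norm v = 1" using v by (auto simp: K_def)
  have ge: "d * (x \<bullet> x) \<le> x \<bullet> (A *v x)" if "x \<in> S" for x
  proof (cases "x = 0")
    case False
    have "(1 / norm x) *\<^sub>R x \<in> K" using that False S(1) by (simp add: K_def subspace_scale)
    from min[OF this] have "d \<le> (x \<bullet> (A *v x)) / (norm x)\<^sup>2"
      by (simp add: d_def matrix_vector_mult_scaleR power2_eq_square)
    then show ?thesis using False by (simp add: dot_square_norm pos_le_divide_eq)
  qed auto
  have "A *v v = d *\<^sub>R v"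
  proof -
    define w where "w = A *v v - d *\<^sub>R v"
    have wS: "w \<in> S" unfolding w_def using S(1) inv vS by (intro subspace_diff subspace_scale) auto
    have vv: "v \<bullet> v = 1" using vS by (simp add: dot_square_norm)
    have "0 \<le> t * (2 * (w \<bullet> w)) + t\<^sup>2 * (w \<bullet> (A *v w) - d * (w \<bullet> w))" for t
    proof -
      have "v + t *\<^sub>R w \<in> S" using vS wS S(1) by (intro subspace_add subspace_scale) auto
      note ge1 = this[THEN ge]
      have e1: "(v + t *\<^sub>R w) \<bullet> (v + t *\<^sub>R w) = 1 + 2 * t * (v \<bullet> w) + t\<^sup>2 * (w \<bullet> w)"
        by (simp add: inner_add vv inner_commute[of w v] power2_eq_square algebra_simps)
      have e2: "(v + t *\<^sub>R w) \<bullet> (A *v (v + t *\<^sub>R w)) = d + 2 * t * (w \<bullet> (A *v v)) + t\<^sup>2 * (w \<bullet> (A *v w))"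
      proof -
        have "v \<bullet> (A *v w) = w \<bullet> (A *v v)" using sym_inner[OF A, of v w] by (simp add: inner_commute)
        then show ?thesis
          by (simp add: d_def matrix_vector_right_distrib matrix_vector_mult_scaleR inner_add power2_eq_square algebra_simps)
      qed
      have e3: "w \<bullet> (A *v v) = w \<bullet> w + d * (v \<bullet> w)"
      proof -
        have "w \<bullet> w = w \<bullet> (A *v v - d *\<^sub>R v)" by (simp only: w_def)
        then show ?thesis by (simp add: inner_diff_right inner_commute)
      qed
      from ge1 show ?thesis unfolding e1 e2 e3 by (simp add: algebra_simps)
    qed
    then have "2 * (w \<bullet> w) = 0" by (rule quadratic_minimum_zero)
    then show ?thesis by (simp add: w_def)
  qed
  then show ?thesis using vS by blast
qed

text \<open>The orthogonal complement of an eigenvector within S is again invariant because A is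
  symmetric, and its dimension is one less.\<close>

lemma orthonormal_eigenbasis_subspace:
  fixes A :: "real^'n^'n"
  assumes A: "transpose A = A" and "subspace S" and "\<And>x. x \<in> S \<Longrightarrow> A *v x \<in> S"
  shows "\<exists>B. B \<subseteq> S \<and> finite B \<and> card B = dim S \<and> pairwise orthogonal B \<and>
    (\<forall>b\<in>B. norm b = 1 \<and> (\<exists>d. A *v b = d *\<^sub>R b))"
  using assms(2,3)
proof (induction "dim S" arbitrary: S rule: less_induct)
  case less
  show ?case
  proof (cases "S = {0}")
    case True
    then show ?thesis by (intro exI[of _ "{}"]) auto
  next
    case False
    from eigenvector_in_invariant_subspace[OF A less.prems(1) False less.prems(2)]
    obtain v d where v: "v \<in> S" "norm v = 1" "A *v v = d *\<^sub>R v" by blast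
    define S' where "S' = S \<inter> {x. orthogonal v x}"
    have sub': "subspace S'" unfolding S'_def
      by (intro subspace_inter less.prems(1) subspace_orthogonal_to_vector)
    have inv': "A *v x \<in> S'" if "x \<in> S'" for x
      using that less.prems(2) sym_inner[OF A, of v x] v(3)
      by (auto simp: S'_def orthogonal_def)
    have dim: "dim S = dim S' + 1"
    proof -
      have "dim {y \<in> S. \<forall>x \<in> span {v}. orthogonal x y} + dim (span {v}) = dim S"
        using v(1) less.prems(1) by (intro dim_subspace_orthogonal_to_vectors) (auto simp: span_minimal)
      moreover have "{y \<in> S. \<forall>x \<in> span {v}. orthogonal x y} = S'"
        by (auto simp: S'_def span_singleton orthogonal_clauses dest: spec[of _ 1])
      moreover have "dim (span {v}) = 1" using v(2) by (auto simp: dim_span)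
      ultimately show ?thesis by simp
    qed
    then obtain B where B: "B \<subseteq> S'" "finite B" "card B = dim S'" "pairwise orthogonal B"
      "\<forall>b\<in>B. norm b = 1 \<and> (\<exists>d. A *v b = d *\<^sub>R b)"
      using less.hyps[OF _ sub' inv'] by auto
    have vB: "v \<notin> B" using B(1) v(2) by (auto simp: S'_def orthogonal_def)
    show ?thesis
    proof (intro exI[of _ "insert v B"] conjI)
      show "pairwise orthogonal (insert v B)"
        using B(1,4) by (auto simp: pairwise_insert S'_def orthogonal_commute)
    qed (use B v vB dim in \<open>auto simp: S'_def\<close>)
  qed
qed

definition diag :: "real^'n \<Rightarrow> real^'n^'n" where
  "diag d = (\<chi> i j. if i = j then d $ i else 0)"

lemma spectral_theorem:
  fixes A :: "real^'n^'n"
  assumes A: "transpose A = A"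
  obtains Q :: "real^'n^'n" and d :: "real^'n" where
    "orthogonal_matrix Q" "A = transpose Q ** diag d ** Q"
proof -
  obtain B where B: "finite B" "card B = CARD('n)" "pairwise orthogonal B"
    "\<forall>b\<in>B. norm b = 1 \<and> (\<exists>d. A *v b = d *\<^sub>R b)"
    using orthonormal_eigenbasis_subspace[OF A, of UNIV] by auto
  obtain b where b: "bij_betw b (UNIV :: 'n set) B"
    using finite_same_card_bij[of "UNIV :: 'n set" B] B by auto
  have bB: "b i \<in> B" for i using b by (auto simp: bij_betw_def)
  have "\<forall>i. \<exists>d. A *v b i = d *\<^sub>R b i" using B bB by blast
  then obtain d where d: "A *v b i = d i *\<^sub>R b i" for i by metis
  have on: "b i \<bullet> b j = (if i = j then 1 else 0)" for i j
  proof (cases "i = j")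
    case True then show ?thesis using B(4) bB[of j] by (simp add: dot_square_norm)
  next
    case False
    then have "b i \<noteq> b j" using b by (auto simp: bij_betw_def inj_on_def)
    then show ?thesis using False B(3) bB by (auto simp: pairwise_def orthogonal_def)
  qed
  \<comment> \<open>The eigenvectors are the rows of Q, so \<open>Q ** transpose Q\<close> is their
    Gram matrix.\<close>
  define Q where "Q = (\<chi> i. b i)"
  define D where "D = diag (\<chi> i. d i)"
  have QQ: "Q ** transpose Q = mat 1"
    by (simp add: Q_def matrix_matrix_mult_def transpose_def mat_def vec_eq_iff on[unfolded inner_vec_def, simplified])
  then have QQ': "transpose Q ** Q = mat 1" by (simp add: matrix_left_right_inverse)
  have o: "orthogonal_matrix Q" using QQ QQ' by (simp add: orthogonal_matrix_def)
  have "D $ i $ k * Q $ k $ j = (if k = i then d i * Q $ i $ j else 0)" for i j k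
    by (auto simp: D_def diag_def)
  then have 1: "(D ** Q) $ i $ j = d i * b i $ j" for i j
    by (simp add: matrix_matrix_mult_def Q_def)
  have 2: "(Q ** A) $ i $ j = d i * b i $ j" for i j
  proof -
    have "(Q ** A) $ i $ j = (\<Sum>k\<in>UNIV. b i $ k * A $ j $ k)"
      using A by (simp add: matrix_matrix_mult_def Q_def transpose_def vec_eq_iff)
    also have "\<dots> = (A *v b i) $ j" by (simp add: matrix_vector_mult_def mult.commute)
    finally show ?thesis by (simp add: d)
  qed
  have "Q ** A = D ** Q" using 1 2 by (simp add: vec_eq_iff)
  then have "transpose Q ** (Q ** A) = transpose Q ** (D ** Q)" by simp
  then have "A = transpose Q ** D ** Q" by (simp add: matrix_mul_assoc QQ')
  then show thesis using that[OF o] unfolding D_def by blast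
qed

lemma diag_mult_vec: "diag d *v x = (\<chi> i. d $ i * x $ i)"
proof -
  have "(if i = j then d $ i else 0) * x $ j = (if j = i then d $ i * x $ i else 0)" for i j by auto
  then show ?thesis by (simp add: diag_def matrix_vector_mult_def vec_eq_iff)
qed

lemma diag_mult: "diag a ** diag b = diag (\<chi> i. a $ i * b $ i)"
proof -
  have "(if i = k then a $ i else 0) * (if k = j then b $ k else 0) = (if k = i then (if i = j then a $ i * b $ i else 0) else 0)" for i j k by auto
  then show ?thesis by (simp add: diag_def matrix_matrix_mult_def vec_eq_iff)
qed

lemma transpose_diag [simp]: "transpose (diag d) = diag d"
  by (auto simp: diag_def transpose_def vec_eq_iff)

lemma det_diag [simp]: "det (diag d) = (\<Prod>i\<in>UNIV. d $ i)"
  by (subst det_diagonal) (auto simp: diag_def)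

text \<open>The eigenvalues appear as squares because the factor \<open>diag d ** Q\<close> and the
  volume factors need their roots.\<close>

lemma pos_def_decompose:
  fixes A :: "real^'n^'n"
  assumes A: "pos_def A"
  obtains Q and d :: "real^'n" where "orthogonal_matrix Q" "\<And>i. 0 < d $ i"
    "A = transpose Q ** diag (\<chi> i. (d $ i)\<^sup>2) ** Q"
proof -
  obtain Q e where Q: "orthogonal_matrix Q" and e: "A = transpose Q ** diag e ** Q"
    using A by (auto simp: pos_def_def intro: spectral_theorem)
  have QQ: "Q ** transpose Q = mat 1" using Q by (simp add: orthogonal_matrix_def)
  have pos: "0 < e $ i" for i
  proof -
    \<comment> \<open>This is the eigenvector for the i-th eigenvalue, on which the form takes the
      value \<open>e $ i\<close>.\<close>
    define x where "x = transpose Q *v axis i 1"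
    have Qx: "Q *v x = axis i 1" by (simp add: x_def matrix_vector_mul_assoc QQ del: transpose_matrix_vector)
    then have "x \<noteq> 0" by (auto simp: axis_eq_0_iff)
    then have "0 < x \<bullet> (A *v x)" using A by (simp add: pos_def_def)
    also have "\<dots> = x \<bullet> (transpose Q *v (diag e *v (Q *v x)))"
      by (simp add: e matrix_vector_mul_assoc matrix_mul_assoc)
    also have "\<dots> = (Q *v x) \<bullet> (diag e *v (Q *v x))"
      by (rule inner_transpose_mult)
    also have "\<dots> = e $ i" unfolding Qx by (simp add: diag_mult_vec inner_axis' )
    finally show ?thesis .
  qed
  have "e = (\<chi> i. ((\<chi> i. sqrt (e $ i)) $ i)\<^sup>2)"
    using pos by (simp add: vec_eq_iff less_imp_le)
  then show thesis using that[OF Q, of "\<chi> i. sqrt (e $ i)"] pos e by simp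
qed

lemma pos_def_factor:
  fixes A :: "real^'n^'n"
  assumes A: "pos_def A"
  obtains B C :: "real^'n^'n" where "A = transpose B ** B" "B ** C = mat 1" "C ** B = mat 1"
proof -
  obtain Q d where Q: "orthogonal_matrix Q" and d: "\<And>i. 0 < d $ i" and
    e: "A = transpose Q ** diag (\<chi> i. (d $ i)\<^sup>2) ** Q"
    using pos_def_decompose[OF A] by blast
  define B where "B = diag d ** Q"
  define C where "C = transpose Q ** diag (\<chi> i. 1 / d $ i)"
  have 1: "A = transpose B ** B"
    by (simp add: e B_def matrix_transpose_mul matrix_mul_assoc[symmetric])
      (simp add: matrix_mul_assoc diag_mult power2_eq_square)
  have "B ** C = diag d ** (Q ** transpose Q) ** diag (\<chi> i. 1 / d $ i)"
    by (simp add: B_def C_def matrix_mul_assoc)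
  also have "\<dots> = diag (\<chi> i. 1)"
    using Q d by (simp add: orthogonal_matrix_def diag_mult less_imp_neq[symmetric])
  also have "\<dots> = mat 1" by (simp add: diag_def mat_def vec_eq_iff)
  finally have "B ** C = mat 1" .
  then show thesis using that[OF 1] matrix_left_right_inverse[of B C] by blast
qed

lemma det_pos_def:
  fixes A :: "real^'n^'n"
  assumes "pos_def A" shows "0 < det A"
proof -
  obtain B C :: "real^'n^'n" where A: "A = transpose B ** B" and B: "B ** C = mat 1" "C ** B = mat 1"
    using pos_def_factor[OF assms] .
  have "det B * det C = 1" using B by (metis det_I det_mul)
  then have "det B \<noteq> 0" by auto
  then show ?thesis by (auto simp: A det_mul det_transpose zero_less_mult_iff)
qed

lemma pos_def_solve:
  fixes A :: "real^'n^'n"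
  assumes "pos_def A" obtains X where "A *v X = p"
proof -
  obtain B C :: "real^'n^'n" where A: "A = transpose B ** B" and B: "B ** C = mat 1" "C ** B = mat 1"
    using pos_def_factor[OF assms] .
  have "A ** (C ** transpose C) = transpose B ** (B ** C) ** transpose C"
    by (simp add: A matrix_mul_assoc)
  also have "\<dots> = transpose (C ** B)" by (simp add: B(1) matrix_transpose_mul)
  finally have "A ** (C ** transpose C) = mat 1" by (simp add: B(2))
  then have "A *v ((C ** transpose C) *v p) = p" by (simp only: matrix_vector_mul_assoc) simp
  then show thesis using that by blast
qed

lemma pos_def_coercive:
  fixes A :: "real^'n^'n"
  assumes A: "pos_def A"
  obtains l where "0 < l" "\<And>x. l * (x \<bullet> x) \<le> x \<bullet> (A *v x)"
proof -
  have c: "continuous_on (sphere 0 1) (\<lambda>x. x \<bullet> (A *v x))"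
    by (intro continuous_intros linear_continuous_on_compose matrix_vector_mul_linear)
  have ne: "sphere 0 1 \<noteq> ({} :: (real^'n) set)"
    using norm_axis_1 by (metis dist_0_norm empty_iff mem_sphere)
  obtain v where v: "v \<in> sphere 0 1" "\<And>x. x \<in> sphere 0 1 \<Longrightarrow> v \<bullet> (A *v v) \<le> x \<bullet> (A *v x)"
    using continuous_attains_inf[OF _ ne c] by auto
  show thesis
  proof (rule that)
    have "v \<noteq> 0" using v(1) by auto
    then show "0 < v \<bullet> (A *v v)" using A by (simp add: pos_def_def)
    fix x :: "real^'n"
    show "v \<bullet> (A *v v) * (x \<bullet> x) \<le> x \<bullet> (A *v x)"
    proof (cases "x = 0")
      case False
      from v(2)[of "(1 / norm x) *\<^sub>R x"] False have "v \<bullet> (A *v v) \<le> (x \<bullet> (A *v x)) / (norm x)\<^sup>2"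
        by (simp add: matrix_vector_mult_scaleR power2_eq_square)
      then show ?thesis using False by (simp add: dot_square_norm pos_le_divide_eq)
    qed auto
  qed
qed

section \<open>Rank-one perturbations of positive definite matrices\<close>

definition outer :: "real^'n \<Rightarrow> real^'n^'n" where
  "outer p = (\<chi> i j. p $ i * p $ j)"

lemma outer_mult_vec [simp]: "outer p *v x = (p \<bullet> x) *\<^sub>R p"
  by (simp add: outer_def matrix_vector_mult_def vec_eq_iff inner_vec_def sum_distrib_left sum_distrib_right mult_ac)

lemma transpose_outer [simp]: "transpose (outer p) = outer p"
  by (simp add: outer_def transpose_def vec_eq_iff mult.commute)

text \<open>After an orthogonal change of coordinates that carries q to a multiple of a basis
  vector, the matrix is diagonal and differs from the identity in at most one entry.\<close>

lemma det_rank_one_identity: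
  fixes q :: "real^'n"
  shows "det (mat 1 - g *\<^sub>R outer q) = 1 - g * (q \<bullet> q)"
proof -
  define k :: 'n where "k = undefined"
  have "norm q = norm (norm q *\<^sub>R axis k (1::real) :: real^'n)" by (simp add: norm_axis_1)
  from orthogonal_transformation_exists[OF this]
  obtain T :: "real^'n \<Rightarrow> real^'n" where T: "orthogonal_transformation T" "T q = norm q *\<^sub>R axis k 1"
    by blast
  define M where "M = matrix T"
  have M: "orthogonal_matrix M" "\<And>x. T x = M *v x"
    using T(1) by (auto simp: M_def orthogonal_transformation_matrix matrix_works)
  define d where "d = (\<chi> i. if i = k then 1 - g * (q \<bullet> q) else (1::real))"
  have "(mat 1 - g *\<^sub>R outer q) *v x = (transpose M ** diag d ** M) *v x" for x
  proof -
    have Tx: "(T x) $ k * norm q = q \<bullet> x"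
    proof -
      have "q \<bullet> x = T q \<bullet> T x" using T(1) by (simp add: orthogonal_transformation_def)
      then show ?thesis by (simp add: T(2) inner_axis')
    qed
    have "(transpose M ** diag d ** M) *v x = transpose M *v (diag d *v T x)"
      by (simp add: M(2) matrix_vector_mul_assoc matrix_mul_assoc)
    also have "diag d *v T x = T x - (g * (q \<bullet> x)) *\<^sub>R T q"
      by (auto simp: diag_mult_vec vec_eq_iff T(2) d_def axis_def Tx[symmetric] dot_square_norm power2_eq_square algebra_simps)
    also have "transpose M *v \<dots> = x - (g * (q \<bullet> x)) *\<^sub>R q"
      using M by (simp add: matrix_vector_mult_diff_distrib matrix_vector_mult_scaleR matrix_vector_mul_assoc orthogonal_matrix_def)
    finally show ?thesis by (simp add: matrix_vector_mult_diff_rdistrib scaleR_matrix_vector_assoc[symmetric])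
  qed
  then have "mat 1 - g *\<^sub>R outer q = transpose M ** diag d ** M" by (simp add: matrix_eq)
  moreover have "det M * det M = 1" using det_orthogonal_matrix[OF M(1)] by auto
  ultimately have "det (mat 1 - g *\<^sub>R outer q) = det (diag d)"
    by (simp add: det_mul det_transpose)
  also have "\<dots> = 1 - g * (q \<bullet> q)" by (simp add: d_def)
  finally show ?thesis .
qed

text \<open>Factoring \<open>A = transpose B ** B\<close> turns p into
  \<open>transpose B *v q\<close> and reduces the update to one of the identity. The vector X stands
  for the inverse of A applied to p.\<close>

lemma det_rank_one_update:
  fixes A :: "real^'n^'n"
  assumes A: "pos_def A" and X: "A *v X = p"
  shows "det (A - g *\<^sub>R outer p) = det A * (1 - g * (X \<bullet> p))"
proof -
  obtain B C :: "real^'n^'n" where AB: "A = transpose B ** B" and B: "B ** C = mat 1" "C ** B = mat 1"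
    using pos_def_factor[OF A] .
  define q where "q = B *v X"
  have p: "p = transpose B *v q" using X by (simp add: q_def AB matrix_vector_mul_assoc)
  have "A - g *\<^sub>R outer p = transpose B ** (mat 1 - g *\<^sub>R outer q) ** B"
  proof (subst matrix_eq, intro allI)
    fix x
    have "p \<bullet> x = q \<bullet> (B *v x)" by (simp add: p inner_transpose_mult')
    then show "(A - g *\<^sub>R outer p) *v x = (transpose B ** (mat 1 - g *\<^sub>R outer q) ** B) *v x"
      by (simp add: matrix_vector_mul_assoc[symmetric] AB p matrix_vector_mult_diff_rdistrib scaleR_matrix_vector_assoc[symmetric]
          matrix_vector_mult_diff_distrib matrix_vector_mult_scaleR)
  qed
  then have "det (A - g *\<^sub>R outer p) = det A * (1 - g * (q \<bullet> q))"
    by (simp add: det_mul det_rank_one_identity AB)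
  moreover have "q \<bullet> q = X \<bullet> p"
    by (simp add: q_def p inner_transpose_mult)
  ultimately show ?thesis by simp
qed

section \<open>Volumes of ellipsoids, plane sections and caps\<close>

text \<open>The library proves the invariance of Lebesgue measure under orthogonal maps of \<open>real^'n\<close> only for
  well-ordered index types, hence the well-ordered copy \<open>'n idx\<close> of the index type \<open>'n\<close>.\<close>

typedef ('n::finite) idx = "{..<CARD('n)}"
  by (rule exI[of _ 0]) simp

setup_lifting type_definition_idx

instantiation idx :: (finite) "{finite, wellorder}"
begin
lift_definition less_eq_idx :: "'a idx \<Rightarrow> 'a idx \<Rightarrow> bool" is "(\<le>)" .
lift_definition less_idx :: "'a idx \<Rightarrow> 'a idx \<Rightarrow> bool" is "(<)" .
instance
proof
  show "finite (UNIV :: 'a idx set)"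
    by (rule finite_imageD[of Rep_idx]) (auto simp: Rep_idx_inject inj_on_def intro: finite_subset[of _ "{..<CARD('a)}"] Rep_idx[simplified])
  fix P :: "'a idx \<Rightarrow> bool" and a
  assume *: "\<And>x. (\<And>y. y < x \<Longrightarrow> P y) \<Longrightarrow> P x"
  show "P a"
    by (rule measure_induct_rule[of Rep_idx]) (auto intro: * simp: less_idx.rep_eq)
qed (transfer; auto)+
end

lemma ex_idx_bij: "\<exists>\<pi> :: 'n::finite idx \<Rightarrow> 'n. bij \<pi>"
proof -
  have "CARD('n idx) = CARD('n)"
    using type_definition.card[OF type_definition_idx] by simp
  then show ?thesis
    using finite_same_card_bij[of "UNIV :: 'n idx set" "UNIV :: 'n set"] by auto
qed

lemma prod_Basis_cart: "(\<Prod>b\<in>(Basis :: (real^'n) set). g b) = (\<Prod>i\<in>UNIV. g (axis i 1))"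
proof -
  have B: "(Basis :: (real^'n) set) = range (\<lambda>i. axis i 1)" by (auto simp: Basis_vec_def)
  have "inj (\<lambda>i. axis i 1 :: real^'n)" by (auto simp: inj_on_def axis_eq_axis)
  then show ?thesis unfolding B by (subst prod.reindex) auto
qed

text \<open>Lebesgue measure is determined by its values on boxes, and a relabelling of the
  coordinates only permutes the side lengths.\<close>

lemma lborel_permute_coordinates:
  fixes \<pi> :: "'m::finite \<Rightarrow> 'n::finite"
  assumes \<pi>: "bij \<pi>"
  shows "distr lborel borel (\<lambda>x :: real^'n. \<chi> j. x $ \<pi> j) = (lborel :: (real^'m) measure)"
proof (rule lborel_eqI[symmetric])
  let ?\<phi> = "\<lambda>x :: real^'n. (\<chi> j. x $ \<pi> j) :: real^'m"
  have meas: "?\<phi> \<in> borel \<rightarrow>\<^sub>M borel"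
    by (intro borel_measurable_continuous_onI continuous_intros)
  fix l u :: "real^'m" assume lu: "\<And>b. b \<in> Basis \<Longrightarrow> l \<bullet> b \<le> u \<bullet> b"
  define l' u' :: "real^'n" where "l' = (\<chi> i. l $ inv \<pi> i)" and "u' = (\<chi> i. u $ inv \<pi> i)"
  have le: "l $ j \<le> u $ j" for j using lu[of "axis j 1"] by (simp add: cart_eq_inner_axis axis_in_Basis_iff)
  have "emeasure (distr lborel borel ?\<phi>) (box l u) = emeasure lborel (?\<phi> -` box l u)"
    using meas by (simp add: emeasure_distr)
  also have "?\<phi> -` box l u = box l' u'"
    using \<pi> by (auto simp: mem_box_cart l'_def u'_def) (metis bij_inv_eq_iff)+
  also have "emeasure lborel (box l' u') = ennreal (\<Prod>i\<in>UNIV. u' $ i - l' $ i)"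
  proof (subst emeasure_lborel_box)
    show "l' \<bullet> b \<le> u' \<bullet> b" if "b \<in> Basis" for b
      using that by (auto simp: Basis_vec_def cart_eq_inner_axis[symmetric] le l'_def u'_def)
  qed (simp add: prod_Basis_cart inner_diff_left cart_eq_inner_axis[symmetric])
  also have "(\<Prod>i\<in>UNIV. u' $ i - l' $ i) = (\<Prod>j\<in>UNIV. u $ j - l $ j)"
    using prod.reindex_bij_betw[OF \<pi>, of "\<lambda>i. u' $ i - l' $ i"] \<pi>
    by (simp add: l'_def u'_def bij_is_inj)
  finally show "emeasure (distr lborel borel ?\<phi>) (box l u) = (\<Prod>b\<in>Basis. (u - l) \<bullet> b)"
    by (simp add: prod_Basis_cart inner_diff_left cart_eq_inner_axis[symmetric])
qed simp

lemma measure_lebesgue_borel: "S \<in> sets borel \<Longrightarrow> measure lebesgue S = measure lborel S"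
  by (simp add: measure_completion)

lemma measure_permute_coordinates:
  fixes \<pi> :: "'m::finite \<Rightarrow> 'n::finite" and T :: "(real^'m) set"
  assumes "bij \<pi>" "T \<in> sets borel"
  shows "measure lebesgue ((\<lambda>x :: real^'n. \<chi> j. x $ \<pi> j) -` T) = measure lebesgue T"
proof -
  let ?\<phi> = "\<lambda>x :: real^'n. (\<chi> j. x $ \<pi> j) :: real^'m"
  have meas: "?\<phi> \<in> borel \<rightarrow>\<^sub>M borel"
    by (intro borel_measurable_continuous_onI continuous_intros)
  have "?\<phi> -` T \<in> sets borel" using measurable_sets[OF meas assms(2)] by simp
  then have "measure lebesgue (?\<phi> -` T) = measure lborel (?\<phi> -` T)" by (rule measure_lebesgue_borel)
  also have "\<dots> = measure (distr lborel borel ?\<phi>) T"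
    using meas assms(2) by (simp add: measure_distr)
  also have "\<dots> = measure lebesgue T"
    using assms(2) by (simp add: lborel_permute_coordinates[OF assms(1)] measure_lebesgue_borel)
  finally show ?thesis .
qed

text \<open>Conjugation by the relabelling maps transfers the problem to the well-ordered index
  type; relabelling preserves inner products and volumes. Compactness keeps every image Borel
  measurable.\<close>

lemma measure_orthogonal_image_compact:
  fixes f :: "real^'n \<Rightarrow> real^'n"
  assumes f: "orthogonal_transformation f" and S: "compact S"
  shows "measure lebesgue (f ` S) = measure lebesgue S"
proof -
  obtain \<pi> :: "'n idx \<Rightarrow> 'n" where \<pi>: "bij \<pi>" using ex_idx_bij by blast
  define \<phi> where "\<phi> = (\<lambda>x :: real^'n. (\<chi> j. x $ \<pi> j))"
  define \<psi> where "\<psi> = (\<lambda>y :: real^'n idx. (\<chi> i. y $ inv \<pi> i))"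
  have [simp]: "\<psi> (\<phi> x) = x" "\<phi> (\<psi> y) = y" for x y
    using \<pi> by (simp_all add: \<phi>_def \<psi>_def bij_is_inj bij_is_surj surj_f_inv_f)
  have im: "\<psi> -` A = \<phi> ` A" for A by (force simp: image_iff)
  have lin: "linear \<phi>" "linear \<psi>" by (auto simp: \<phi>_def \<psi>_def linear_iff vec_eq_iff)
  have inner: "\<psi> y \<bullet> \<psi> y' = y \<bullet> y'" for y y'
    using sum.reindex_bij_betw[OF bij_imp_bij_inv[OF \<pi>], of "\<lambda>i. y $ i * y' $ i"]
    by (simp add: inner_vec_def \<psi>_def)
  have inner': "\<phi> x \<bullet> \<phi> x' = x \<bullet> x'" for x x' using inner[of "\<phi> x" "\<phi> x'"] by simp
  define g where "g = \<phi> \<circ> f \<circ> \<psi>"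
  have g: "orthogonal_transformation g"
    using f lin by (auto simp: g_def orthogonal_transformation_def inner inner' intro!: linear_compose)
  have cS: "compact (\<phi> ` S)" using S lin by (intro compact_continuous_image linear_continuous_on) (auto simp: linear_conv_bounded_linear)
  have cfS: "compact (f ` S)" using S f by (intro compact_continuous_image linear_continuous_on) (auto simp: linear_conv_bounded_linear[symmetric] orthogonal_transformation_linear)
  have meas: "measure lebesgue (\<phi> ` A) = measure lebesgue A" if "compact A" for A
    using measure_permute_coordinates[OF bij_imp_bij_inv[OF \<pi>], of A] that
    by (simp add: im[symmetric] \<psi>_def borel_compact)
  have "\<phi> ` (f ` S) = g ` (\<phi> ` S)" by (simp add: g_def image_comp o_def)
  then have "measure lebesgue (f ` S) = measure lebesgue (g ` (\<phi> ` S))"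
    using meas[OF cfS] by simp
  also have "\<dots> = measure lebesgue (\<phi> ` S)"
    by (rule measure_orthogonal_image[OF g]) (simp add: cS lmeasurable_compact)
  also have "\<dots> = measure lebesgue S" by (rule meas[OF S])
  finally show ?thesis .
qed

lemma measure_diag_image:
  fixes S :: "(real^'n) set"
  assumes c: "\<And>i. 0 < c $ i" and S: "compact S"
  shows "measure lebesgue ((*v) (diag c) ` S) = (\<Prod>i\<in>UNIV. c $ i) * measure lebesgue S"
proof -
  define c' where "c' = (\<lambda>b :: real^'n. c \<bullet> b)"
  define T where "T = (\<lambda>x :: real^'n. 0 + (\<Sum>j\<in>Basis. (c' j * (x \<bullet> j)) *\<^sub>R j))"
  have "T x = diag c *v x" for x
  proof -
    have "T x $ i = (diag c *v x) $ i" for i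
    proof -
      have "T x $ i = T x \<bullet> axis i 1" by (simp add: cart_eq_inner_axis)
      also have "\<dots> = c' (axis i 1) * (x \<bullet> axis i 1)"
        by (simp add: T_def inner_sum_left_Basis axis_in_Basis_iff inner_sum_left inner_Basis if_distrib cong: if_cong)
      also have "\<dots> = (diag c *v x) $ i" by (simp add: c'_def cart_eq_inner_axis[symmetric] diag_mult_vec)
      finally show ?thesis .
    qed
    then show ?thesis by (simp add: vec_eq_iff)
  qed
  then have T: "T = (*v) (diag c)" by auto
  have c'pos: "c' j > 0" if "j \<in> Basis" for j
    using that c by (auto simp: Basis_vec_def c'_def cart_eq_inner_axis[symmetric])
  have prod: "(\<Prod>j\<in>Basis. \<bar>c' j\<bar>) = (\<Prod>i\<in>UNIV. c $ i)"
    by (simp add: prod_Basis_cart c'_def cart_eq_inner_axis[symmetric] less_imp_le[OF c])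
  have leb: "lborel = density (distr lborel borel T) (\<lambda>_. (\<Prod>j\<in>Basis. \<bar>c' j\<bar>))"
    unfolding T_def using c'pos by (intro lborel_affine_euclidean) force
  have cont: "continuous_on UNIV T" unfolding T by (intro linear_continuous_on matrix_vector_mul_bounded_linear)
  then have Tm[measurable]: "T \<in> borel \<rightarrow>\<^sub>M borel" by (rule borel_measurable_continuous_onI)
  have cTS: "compact (T ` S)" using S cont by (meson compact_continuous_image continuous_on_subset subset_UNIV)
  have inj: "T -` (T ` S) = S"
  proof -
    have "inj T" unfolding T inj_on_def using c by (force simp: diag_mult_vec vec_eq_iff less_imp_neq[symmetric])
    then show ?thesis by (simp add: inj_vimage_image_eq)
  qed
  have "emeasure lborel (T ` S) = ennreal (\<Prod>i\<in>UNIV. c $ i) * emeasure lborel S"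
    by (subst leb) (use cTS in \<open>simp add: emeasure_density_const emeasure_distr inj prod borel_compact\<close>)
  then have "measure lborel (T ` S) = (\<Prod>i\<in>UNIV. c $ i) * measure lborel S"
    by (simp add: measure_def enn2real_mult prod_nonneg less_imp_le[OF c])
  then show ?thesis using S cTS by (simp add: T measure_lebesgue_borel borel_compact)
qed

text \<open>The hypothesis says that \<open>diag d ** Q ** A\<close> is orthogonal when G has the
  eigenvalues \<open>(d $ i)\<^sup>2\<close>. So A is a product of two orthogonal maps and the
  diagonal map with entries 1 / d.\<close>

lemma measure_image_pos_def:
  fixes A G :: "real^'n^'n"
  assumes G: "pos_def G" and A: "transpose A ** G ** A = mat 1" and S: "compact S"
  shows "measure lebesgue ((*v) A ` S) = measure lebesgue S / sqrt (det G)"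
proof -
  obtain Q and d :: "real^'n" where Q: "orthogonal_matrix Q" and d: "\<And>i. 0 < d $ i"
    and Gd: "G = transpose Q ** diag (\<chi> i. (d $ i)\<^sup>2) ** Q"
    using pos_def_decompose[OF G] by blast
  define R where "R = diag d ** Q ** A"
  define e where "e = (\<chi> i. 1 / d $ i)"
  have G2: "G = transpose Q ** diag d ** diag d ** Q"
    by (simp add: Gd matrix_mul_assoc[symmetric]) (simp add: matrix_mul_assoc diag_mult power2_eq_square)
  have "transpose R ** R = mat 1"
    using A unfolding R_def G2 by (simp add: matrix_transpose_mul matrix_mul_assoc)
  then have R: "orthogonal_matrix R"
    by (simp add: orthogonal_matrix)
  have ed: "diag e ** diag d = mat 1"
    using d by (simp add: diag_mult e_def less_imp_neq[symmetric]) (simp add: diag_def mat_def vec_eq_iff)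
  have "transpose Q ** diag e ** R = transpose Q ** (diag e ** diag d) ** Q ** A"
    by (simp add: R_def matrix_mul_assoc)
  also have "\<dots> = A" using Q by (simp add: ed orthogonal_matrix_def)
  finally have A': "A = transpose Q ** diag e ** R" by simp
  have oQ: "orthogonal_transformation ((*v) (transpose Q))"
    using Q by (simp add: orthogonal_transformation_matrix orthogonal_matrix_transpose)
  have oR: "orthogonal_transformation ((*v) R)"
    using R by (simp add: orthogonal_transformation_matrix)
  have cont: "compact ((*v) M ` K)" if "compact K" for M :: "real^'n^'n" and K
    using that by (intro compact_continuous_image linear_continuous_on matrix_vector_mul_bounded_linear)
  have img: "(*v) A ` S = (*v) (transpose Q) ` ((*v) (diag e) ` ((*v) R ` S))"
    by (simp add: A' image_comp o_def matrix_vector_mul_assoc matrix_mul_assoc)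
  have epos: "0 < e $ i" for i using d by (simp add: e_def)
  have "measure lebesgue ((*v) A ` S) = (\<Prod>i\<in>UNIV. e $ i) * measure lebesgue S"
    unfolding img using S
    by (simp add: measure_orthogonal_image_compact oQ oR cont measure_diag_image epos)
  moreover have "sqrt (det G) = (\<Prod>i\<in>UNIV. d $ i)"
  proof -
    have "det Q * det Q = 1" using det_orthogonal_matrix[OF Q] by auto
    then have "det G = (\<Prod>i\<in>UNIV. d $ i)\<^sup>2"
      by (simp add: Gd det_mul det_transpose prod_power_distrib)
    then show ?thesis by (simp add: prod_nonneg less_imp_le[OF d])
  qed
  ultimately show ?thesis by (simp add: e_def prod_dividef)
qed

text \<open>The ellipsoid is a translate of the image of a ball under the inverse C of the factor B
  of G, and C satisfies the hypothesis of \<open>measure_image_pos_def\<close>.\<close>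

lemma measure_ellipsoid:
  fixes G :: "real^'n^'n"
  assumes G: "pos_def G" and r: "0 \<le> \<rho>"
  shows "compact {x. (x - a) \<bullet> (G *v (x - a)) \<le> \<rho>}"
    and "measure lebesgue {x. (x - a) \<bullet> (G *v (x - a)) \<le> \<rho>}
      = unit_ball_vol (CARD('n)) * sqrt \<rho> ^ CARD('n) / sqrt (det G)"
proof -
  obtain B C :: "real^'n^'n" where GB: "G = transpose B ** B" and B: "B ** C = mat 1" "C ** B = mat 1"
    using pos_def_factor[OF G] .
  have GC: "transpose C ** G ** C = mat 1"
  proof -
    have "transpose C ** G ** C = transpose (B ** C) ** (B ** C)"
      by (simp add: GB matrix_transpose_mul matrix_mul_assoc)
    then show ?thesis by (simp add: B)
  qed
  have Gn: "x \<bullet> (G *v x) = (norm (B *v x))\<^sup>2" for x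
    by (simp add: GB matrix_vector_mul_assoc[symmetric] inner_transpose_mult dot_square_norm)
  have CB: "C *v (B *v x) = x" "B *v (C *v x) = x" for x
    by (simp_all add: matrix_vector_mul_assoc B)
  have eq0: "{x. x \<bullet> (G *v x) \<le> \<rho>} = (*v) C ` cball 0 (sqrt \<rho>)"
  proof (intro equalityI subsetI)
    fix x assume "x \<in> {x. x \<bullet> (G *v x) \<le> \<rho>}"
    then have "norm (B *v x) \<le> sqrt \<rho>" by (simp add: Gn real_le_rsqrt)
    then show "x \<in> (*v) C ` cball 0 (sqrt \<rho>)"
      by (intro image_eqI[of _ _ "B *v x"]) (auto simp: CB)
  next
    fix x assume "x \<in> (*v) C ` cball 0 (sqrt \<rho>)"
    then obtain y where "x = C *v y" "norm y \<le> sqrt \<rho>" by auto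
    then show "x \<in> {x. x \<bullet> (G *v x) \<le> \<rho>}"
      using r power_mono[of "norm y" "sqrt \<rho>" 2] by (simp add: Gn CB)
  qed
  have eq: "{x. (x - a) \<bullet> (G *v (x - a)) \<le> \<rho>} = (+) a ` {x. x \<bullet> (G *v x) \<le> \<rho>}"
    by (force simp: image_iff intro: exI[of _ "_ - a"])
  have cm: "compact ((*v) C ` cball 0 (sqrt \<rho>))"
    by (intro compact_continuous_image linear_continuous_on matrix_vector_mul_bounded_linear compact_cball)
  then show "compact {x. (x - a) \<bullet> (G *v (x - a)) \<le> \<rho>}"
    unfolding eq eq0 by (rule compact_translation)
  have "measure lebesgue {x. (x - a) \<bullet> (G *v (x - a)) \<le> \<rho>} = measure lebesgue ((*v) C ` cball 0 (sqrt \<rho>))"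
    unfolding eq eq0 by (rule measure_translation)
  also have "\<dots> = measure lebesgue (cball (0::real^'n) (sqrt \<rho>)) / sqrt (det G)"
    by (rule measure_image_pos_def[OF G GC compact_cball])
  also have "measure lebesgue (cball (0::real^'n) (sqrt \<rho>)) = unit_ball_vol (CARD('n)) * sqrt \<rho> ^ CARD('n)"
    using r by (simp add: measure_lebesgue_borel content_cball)
  finally show "measure lebesgue {x. (x - a) \<bullet> (G *v (x - a)) \<le> \<rho>}
      = unit_ball_vol (CARD('n)) * sqrt \<rho> ^ CARD('n) / sqrt (det G)" .
qed

text \<open>An isometry that fixes the origin preserves norms, hence inner products by polarization,
  and then the defects of additivity and homogeneity have norm zero. The two spaces may differ, as
  for parametrizations of hyperplanes.\<close>

lemma isometry_linear_between:
  fixes f :: "'a::real_inner \<Rightarrow> 'b::real_inner"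
  assumes f0: "f 0 = 0" and d: "\<And>x y. dist (f x) (f y) = dist x y"
  shows "linear f" and "f x \<bullet> f y = x \<bullet> y"
proof -
  have n: "f x \<bullet> f x = x \<bullet> x" for x
    using d[of x 0] f0 by (simp add: dist_norm dot_square_norm)
  have i: "f x \<bullet> f y = x \<bullet> y" for x y
  proof -
    have "(f x - f y) \<bullet> (f x - f y) = (x - y) \<bullet> (x - y)"
      using d[of x y] by (simp add: dist_norm dot_square_norm)
    then show ?thesis by (simp add: inner_diff n inner_commute)
  qed
  show "f x \<bullet> f y = x \<bullet> y" by (rule i)
  show "linear f"
  proof (rule linearI)
    fix x y
    have "(f (x + y) - f x - f y) \<bullet> (f (x + y) - f x - f y) = 0"
      by (simp add: inner_diff i inner_add inner_commute)
    then have "f (x + y) - f x - f y = 0" by (simp only: inner_eq_zero_iff)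
    then show "f (x + y) = f x + f y" by (simp add: algebra_simps)
  next
    fix c x
    have "(f (c *\<^sub>R x) - c *\<^sub>R f x) \<bullet> (f (c *\<^sub>R x) - c *\<^sub>R f x) = 0"
      by (simp add: inner_diff i inner_commute)
    then show "f (c *\<^sub>R x) = c *\<^sub>R f x" by simp
  qed
qed

section \<open>Area of subsets of non-vertical hyperplanes\<close>

lemma pos_def_identity_plus_outer: "pos_def (mat 1 + outer \<xi>)"
  and det_identity_plus_outer: "det (mat 1 + outer \<xi>) = 1 + \<xi> \<bullet> \<xi>"
proof -
  have "transpose (mat 1 + outer \<xi>) = mat 1 + outer \<xi>"
    by (simp add: transpose_def outer_def vec_eq_iff mat_def mult.commute)
  moreover have "x \<noteq> 0 \<Longrightarrow> 0 < x \<bullet> ((mat 1 + outer \<xi>) *v x)" for x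
    by (simp add: matrix_vector_mult_add_rdistrib inner_add_right add_pos_nonneg inner_commute[of x \<xi>])
  ultimately show "pos_def (mat 1 + outer \<xi>)" by (simp add: pos_def_def)
  show "det (mat 1 + outer \<xi>) = 1 + \<xi> \<bullet> \<xi>"
    using det_rank_one_identity[of "-1" \<xi>] by simp
qed

lemma ex_hyperplane_isometry:
  fixes \<xi> :: "real^'n"
  shows "\<exists>\<tau> :: real^'n \<Rightarrow> 'n pt. linear \<tau> \<and> range \<tau> = {(x, z). z = \<xi> \<bullet> x} \<and> (\<forall>y y'. dist (\<tau> y) (\<tau> y') = dist y y')"
proof -
  let ?T = "{(x, z). z = \<xi> \<bullet> x} :: 'n pt set"
  let ?g = "\<lambda>x. (x, \<xi> \<bullet> x)"
  have T: "?T = range ?g" by auto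
  have lin: "linear ?g" by (auto simp: linear_iff inner_add_right)
  have sub: "subspace ?T" unfolding T using lin by (rule linear_subspace_image) simp
  have "dim (UNIV :: (real^'n) set) = dim ?T"
    unfolding T by (rule dim_image_eq[OF lin, symmetric]) (auto simp: inj_on_def)
  from isometries_subspaces[OF subspace_UNIV sub this]
  obtain \<tau> :: "real^'n \<Rightarrow> 'n pt" where \<tau>: "linear \<tau>" "range \<tau> = ?T" "\<And>x. norm (\<tau> x) = norm x"
    by (metis UNIV_I)
  have "dist (\<tau> y) (\<tau> y') = dist y y'" for y y'
    using \<tau>(3)[of "y - y'"] by (simp add: dist_norm linear_diff[OF \<tau>(1)])
  then show ?thesis using \<tau> by blast
qed

text \<open>Seen in the x-coordinates, the metric of the hyperplane is
  \<open>mat 1 + outer \<xi>\<close>, of determinant \<open>1 + \<xi> \<bullet> \<xi>\<close>. The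
  argument works for any isometry onto the hyperplane, so it covers the one selected by the choice
  operator.\<close>

lemma hyperplane_area_graph:
  fixes \<xi> :: "real^'n" and Z :: "(real^'n) set"
  assumes Z: "compact Z"
  shows "hyperplane_area {(x, z). z = \<xi> \<bullet> x + c} ((\<lambda>x. (x, \<xi> \<bullet> x + c)) ` Z)
    = sqrt (1 + \<xi> \<bullet> \<xi>) * measure lebesgue Z"
proof -
  let ?P = "{(x, z). z = \<xi> \<bullet> x + c} :: 'n pt set"
  define B where "B = (\<lambda>x. (x, \<xi> \<bullet> x + c)) ` Z"
  define good where "good = (\<lambda>\<tau> :: real^'n \<Rightarrow> 'n pt. range \<tau> = ?P \<and> (\<forall>y y'. dist (\<tau> y) (\<tau> y') = dist y y'))"
  obtain \<tau>0 :: "real^'n \<Rightarrow> 'n pt" where t0: "range \<tau>0 = {(x, z). z = \<xi> \<bullet> x}" "\<forall>y y'. dist (\<tau>0 y) (\<tau>0 y') = dist y y'"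
    using ex_hyperplane_isometry by blast
  have "good (\<lambda>y. \<tau>0 y + (0, c))"
  proof -
    have "range (\<lambda>y. \<tau>0 y + (0, c)) = (\<lambda>p. p + (0, c)) ` range \<tau>0" by (simp add: image_comp o_def)
    also have "\<dots> = ?P"
    proof -
      have "(x, z) \<in> (\<lambda>p. p + (0, c)) ` {(x, z). z = \<xi> \<bullet> x}" if "z = \<xi> \<bullet> x + c" for x z
        using that by (intro image_eqI[of _ _ "(x, \<xi> \<bullet> x)"]) auto
      then show ?thesis unfolding t0(1) by auto
    qed
    finally show ?thesis using t0(2) by (simp add: good_def)
  qed
  then have "good (SOME \<tau>. good \<tau>)" by (rule someI[of good])
  then obtain \<tau> where \<tau>: "\<tau> = (SOME \<tau>. good \<tau>)" "good \<tau>" by blast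
  have area: "hyperplane_area ?P B = measure lebesgue (\<tau> -` B)"
    by (simp add: hyperplane_area_def \<tau>(1) good_def Let_def)
  define L where "L = (\<lambda>y. \<tau> y - \<tau> 0)"
  have L: "L 0 = 0" "\<And>x y. dist (L x) (L y) = dist x y"
    using \<tau>(2) by (auto simp: L_def good_def dist_norm)
  note L_lin = isometry_linear_between(1)[OF L] and L_inner = isometry_linear_between(2)[OF L]
  have P\<tau>: "snd (\<tau> y) = \<xi> \<bullet> fst (\<tau> y) + c" for y
  proof -
    have "range \<tau> = ?P" using \<tau>(2) by (simp only: good_def)
    then have "\<tau> y \<in> ?P" using rangeI[of \<tau> y] by simp
    then show ?thesis by (cases "\<tau> y") simp
  qed
  have sndL: "snd (L y) = \<xi> \<bullet> fst (L y)" for y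
    by (simp add: L_def P\<tau> inner_diff_right)
  define A where "A = matrix (\<lambda>y. fst (L y))"
  have A: "fst (L y) = A *v y" for y
    unfolding A_def using linear_compose[OF L_lin linear_fst] by (simp add: matrix_works o_def)
  define G where "G = mat 1 + outer \<xi>"
  \<comment> \<open>The x-part A of the linear isometry pulls the metric of the hyperplane back to
    the Euclidean one.\<close>
  have AGA: "transpose A ** G ** A = mat 1"
  proof -
    have "x \<bullet> ((transpose A ** G ** A) *v y) = x \<bullet> y" for x y
    proof -
      have "x \<bullet> ((transpose A ** G ** A) *v y) = (A *v x) \<bullet> (G *v (A *v y))"
        by (simp add: matrix_vector_mul_assoc[symmetric] inner_transpose_mult)
      also have "\<dots> = L x \<bullet> L y"
        by (simp add: G_def inner_prod_def sndL A matrix_vector_mult_add_rdistrib inner_add_right inner_commute)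
      finally show ?thesis by (simp add: L_inner)
    qed
    then have "(transpose A ** G ** A) *v y = y" for y
      by (metis vector_eq_rdot inner_commute)
    then show ?thesis by (simp add: matrix_eq)
  qed
  define A' where "A' = transpose A ** G"
  have A': "A' *v (A *v y) = y" "A *v (A' *v y) = y" for y
  proof -
    have "A' ** A = mat 1" using AGA by (simp add: A'_def)
    then have "A ** A' = mat 1" by (simp add: matrix_left_right_inverse)
    with \<open>A' ** A = mat 1\<close> show "A' *v (A *v y) = y" "A *v (A' *v y) = y"
      by (simp_all add: matrix_vector_mul_assoc)
  qed
  define a where "a = fst (\<tau> 0)"
  have f\<tau>: "fst (\<tau> y) = A *v y + a" for y using A[of y] by (simp add: L_def a_def algebra_simps)
  have W: "\<tau> -` B = (*v) A' ` ((\<lambda>x. x - a) ` Z)"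
  proof (intro equalityI subsetI)
    fix y assume "y \<in> \<tau> -` B"
    then have "A *v y + a \<in> Z" using f\<tau>[of y] by (auto simp: B_def)
    then show "y \<in> (*v) A' ` ((\<lambda>x. x - a) ` Z)"
      by (intro image_eqI[of _ _ "A *v y"] image_eqI[of _ _ "A *v y + a"]) (auto simp: A')
  next
    fix y assume "y \<in> (*v) A' ` ((\<lambda>x. x - a) ` Z)"
    then obtain x where x: "x \<in> Z" "y = A' *v (x - a)" by auto
    then have "fst (\<tau> y) = x" by (simp add: f\<tau> A')
    then have "\<tau> y = (x, \<xi> \<bullet> x + c)" using P\<tau>[of y] by (simp add: prod_eq_iff)
    then show "y \<in> \<tau> -` B" using x by (simp add: B_def)
  qed
  have cW: "compact (\<tau> -` B)"
    unfolding W by (intro compact_continuous_image linear_continuous_on matrix_vector_mul_bounded_linear Z continuous_intros)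
  have "(\<lambda>x. x - a) ` Z = (*v) A ` (\<tau> -` B)"
    unfolding W by (simp add: image_comp o_def A')
  then have "measure lebesgue ((\<lambda>x. x - a) ` Z) = measure lebesgue (\<tau> -` B) / sqrt (det G)"
    using measure_image_pos_def[OF _ AGA cW] pos_def_identity_plus_outer[of \<xi>] by (simp add: G_def)
  moreover have "measure lebesgue ((\<lambda>x. x - a) ` Z) = measure lebesgue Z"
    using measure_translation[of "-a" Z] by simp
  moreover have "0 < 1 + \<xi> \<bullet> \<xi>" by (simp add: add_pos_nonneg)
  ultimately have "measure lebesgue (\<tau> -` B) = sqrt (1 + \<xi> \<bullet> \<xi>) * measure lebesgue Z"
    by (simp add: G_def det_identity_plus_outer field_simps)
  then show ?thesis using area by (simp add: B_def)
qed

text \<open>Cavalieri's principle. The shear that subtracts \<open>l x\<close> from z translates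
  each vertical fibre, so it preserves volume; afterwards the horizontal slices are sublevel sets of
  q.\<close>

lemma cap_measure_integral:
  fixes D :: "(real^'n) set" and q l :: "real^'n \<Rightarrow> real"
  assumes cl: "closed {(x, s). x \<in> D \<and> q x \<le> s}" and l: "continuous_on UNIV l"
    and bd: "bounded {x \<in> D. q x \<le> t}" and q: "\<And>x. x \<in> D \<Longrightarrow> 0 \<le> q x" and t: "0 \<le> t"
  shows "((\<lambda>s. measure lebesgue {x \<in> D. q x \<le> s}) has_integral
      measure lebesgue {(x, z). x \<in> D \<and> q x \<le> z - l x \<and> z - l x \<le> t}) {0..t}"
    and "\<And>s. s \<le> t \<Longrightarrow> compact {x \<in> D. q x \<le> s}"
proof -
  define E where "E = {(x, s). x \<in> D \<and> q x \<le> s}"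
  define K where "K = {(x, z). x \<in> D \<and> q x \<le> z - l x \<and> z - l x \<le> t}"
  define K' where "K' = {(x, s). x \<in> D \<and> q x \<le> s \<and> s \<le> t}"
  have clK': "closed K'"
  proof -
    have "K' = E \<inter> {p. snd p \<le> t}" by (auto simp: K'_def E_def)
    then show ?thesis using cl by (auto simp: E_def intro!: closed_Int closed_Collect_le continuous_intros)
  qed
  have clK: "closed K"
  proof -
    have "continuous_on UNIV (\<lambda>p. (fst p, snd p - l (fst p)))"
      by (intro continuous_intros continuous_on_compose2[OF l]) auto
    then have "closed ((\<lambda>p. (fst p, snd p - l (fst p))) -` K')"
      by (rule closed_vimage[OF clK'])
    moreover have "(\<lambda>p. (fst p, snd p - l (fst p))) -` K' = K" by (auto simp: K_def K'_def)
    ultimately show ?thesis by simp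
  qed
  have cs: "compact {x \<in> D. q x \<le> s}" if "s \<le> t" for s
  proof -
    have "closed ((\<lambda>x. (x, s)) -` K')"
      using clK' by (intro continuous_closed_vimage) (auto intro!: continuous_intros)
    moreover have "(\<lambda>x. (x, s)) -` K' = {x \<in> D. q x \<le> s}" using that by (auto simp: K'_def)
    moreover have "bounded {x \<in> D. q x \<le> s}" using that by (intro bounded_subset[OF bd]) auto
    ultimately show ?thesis by (simp add: compact_eq_bounded_closed)
  qed
  show "\<And>s. s \<le> t \<Longrightarrow> compact {x \<in> D. q x \<le> s}" by (rule cs)
  define m where "m s = measure lborel ((\<lambda>x. (x, s)) -` K')" for s
  \<comment> \<open>Slices below height 0 are empty since q is nonnegative, those above t by the
    bound in \<open>K'\<close>.\<close>
  have slice: "(\<lambda>x. (x, s)) -` K' = (if s \<in> {0..t} then {x \<in> D. q x \<le> s} else {})" for s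
  proof (cases "s \<in> {0..t}")
    case True then show ?thesis by (auto simp: K'_def)
  next
    case False
    then have "x \<in> D \<Longrightarrow> q x \<le> s \<Longrightarrow> s \<le> t \<Longrightarrow> False" for x using q[of x] by auto
    with False show ?thesis by (auto simp: K'_def)
  qed
  have cslice: "compact ((\<lambda>x. (x, s)) -` K')" for s
    using cs[of s] by (simp add: slice)
  have em: "emeasure lborel ((\<lambda>x. (x, s)) -` K') = ennreal (m s)" for s
    unfolding m_def using emeasure_compact_finite[OF cslice[of s]] by (simp add: emeasure_eq_ennreal_measure top.not_eq_extremum)
  have K'm: "K' \<in> sets (lborel \<Otimes>\<^sub>M lborel)" and Km: "K \<in> sets (lborel \<Otimes>\<^sub>M lborel)"
    using clK clK' by (simp_all only: lborel_prod sets_lborel borel_closed)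
  have "emeasure lborel K = emeasure (lborel \<Otimes>\<^sub>M lborel) K" by (simp add: lborel_prod)
  also have "\<dots> = (\<integral>\<^sup>+x. emeasure lborel (Pair x -` K) \<partial>lborel)"
    by (rule lborel.emeasure_pair_measure_alt[OF Km])
  also have "\<dots> = (\<integral>\<^sup>+x. emeasure lborel (Pair x -` K') \<partial>lborel)"
  proof (rule nn_integral_cong)
    fix x
    have "Pair x -` K = (if x \<in> D then {q x + l x..t + l x} else {})" by (auto simp: K_def)
    moreover have "Pair x -` K' = (if x \<in> D then {q x..t} else {})" by (auto simp: K'_def)
    moreover have "emeasure lborel {q x + l x..t + l x} = emeasure lborel {q x..t}"
      by (cases "q x \<le> t") auto
    ultimately show "emeasure lborel (Pair x -` K) = emeasure lborel (Pair x -` K')" by simp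
  qed
  also have "\<dots> = emeasure (lborel \<Otimes>\<^sub>M lborel) K'"
    by (rule lborel.emeasure_pair_measure_alt[OF K'm, symmetric])
  also have "\<dots> = (\<integral>\<^sup>+s. emeasure lborel ((\<lambda>x. (x, s)) -` K') \<partial>lborel)"
    by (rule lborel_pair.emeasure_pair_measure_alt2[OF K'm])
  finally have emK: "emeasure lborel K = (\<integral>\<^sup>+s. ennreal (m s) \<partial>lborel)" by (simp add: em)
  have bK': "bounded K'"
  proof -
    have "K' \<subseteq> {x \<in> D. q x \<le> t} \<times> {0..t}" using q by (force simp: K'_def)
    then show ?thesis by (rule bounded_subset[rotated]) (intro bounded_Times bd, simp)
  qed
  have bK: "emeasure lborel K < \<infinity>"
  proof -
    have "emeasure lborel K = emeasure (lborel \<Otimes>\<^sub>M lborel) K'"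
      using emK lborel_pair.emeasure_pair_measure_alt2[OF K'm] by (simp add: em)
    then show ?thesis using emeasure_bounded_finite[OF bK'] by (simp add: lborel_prod)
  qed
  have mm: "m \<in> borel_measurable borel"
  proof -
    have "(\<lambda>s. emeasure lborel ((\<lambda>x. (x, s)) -` K')) \<in> borel_measurable lborel"
      using lborel_pair.measurable_emeasure_Pair2[OF K'm] .
    then have "(\<lambda>s. enn2real (emeasure lborel ((\<lambda>x. (x, s)) -` K'))) \<in> borel_measurable lborel"
      by (rule measurable_compose) simp
    then show ?thesis by (simp add: m_def[abs_def] measure_def)
  qed
  have "(m has_integral measure lborel K) UNIV"
  proof (rule nn_integral_has_integral[OF mm])
    show "(\<integral>\<^sup>+s. ennreal (m s) \<partial>lborel) = ennreal (measure lborel K)"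
      unfolding emK[symmetric] using bK by (intro emeasure_eq_ennreal_measure) auto
  qed (auto simp: m_def)
  then have "((\<lambda>s. if s \<in> {0..t} then measure lebesgue {x \<in> D. q x \<le> s} else 0) has_integral measure lebesgue K) UNIV"
  proof -
    assume *: "(m has_integral measure lborel K) UNIV"
    have "m = (\<lambda>s. if s \<in> {0..t} then measure lebesgue {x \<in> D. q x \<le> s} else 0)"
      using cs by (auto simp: m_def slice fun_eq_iff measure_lebesgue_borel borel_compact)
    then show ?thesis using * clK by (simp add: measure_lebesgue_borel borel_closed)
  qed
  then show "((\<lambda>s. measure lebesgue {x \<in> D. q x \<le> s}) has_integral
      measure lebesgue {(x, z). x \<in> D \<and> q x \<le> z - l x \<and> z - l x \<le> t}) {0..t}"
    unfolding K_def[symmetric] has_integral_restrict_UNIV .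
qed

section \<open>Volume asymptotics of small sublevel sets\<close>

text \<open>The point at distance r from x0 on the segment to x divides the segment in the ratio
  that convexity converts into linear growth.\<close>

lemma convex_growth_outside_ball:
  fixes q :: "'a::euclidean_space \<Rightarrow> real"
  assumes cv: "convex_on D q" and x0: "x0 \<in> D" "q x0 = 0" and r: "0 < r" "cball x0 r \<subseteq> D"
    and m: "\<And>x. dist x x0 = r \<Longrightarrow> m \<le> q x" and x: "x \<in> D" "r \<le> dist x x0"
  shows "m * (dist x x0 / r) \<le> q x"
proof -
  define t where "t = r / dist x x0"
  have dx: "0 < dist x x0" using r(1) x(2) by linarith
  have t: "0 < t" "t \<le> 1" using r x dx by (auto simp: t_def)
  define y where "y = (1 - t) *\<^sub>R x0 + t *\<^sub>R x"
  have "y - x0 = t *\<^sub>R (x - x0)" by (simp add: y_def algebra_simps)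
  then have "dist y x0 = t * dist x x0" using t by (simp add: dist_norm)
  also have "\<dots> = r" using dx by (simp add: t_def)
  finally have "m \<le> q y" by (rule m)
  also have "\<dots> \<le> (1 - t) * q x0 + t * q x"
    unfolding y_def using t x0 x by (intro convex_onD[OF cv]) auto
  also have "\<dots> = t * q x" using x0 by simp
  finally have "m \<le> t * q x" .
  then have "m * (1/t) \<le> q x" using t by (simp add: field_simps)
  then show ?thesis by (simp add: t_def)
qed

lemma convex_on_sublevel:
  assumes "convex_on D q" shows "convex {x \<in> D. q x \<le> s}"
proof (rule convexI)
  fix x y and a b :: real assume *: "x \<in> {x \<in> D. q x \<le> s}" "y \<in> {x \<in> D. q x \<le> s}" "0 \<le> a" "0 \<le> b" "a + b = 1"
  have "q (a *\<^sub>R x + b *\<^sub>R y) \<le> a * q x + b * q y"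
    using assms * by (auto simp: convex_on_def)
  also have "\<dots> \<le> a * s + b * s" using * by (intro add_mono mult_left_mono) auto
  also have "\<dots> = s" using * by (simp add: distrib_right[symmetric])
  finally show "a *\<^sub>R x + b *\<^sub>R y \<in> {x \<in> D. q x \<le> s}"
    using * convexD[OF convex_on_imp_convex[OF assms]] by auto
qed

text \<open>Near x0 the function lies between two multiples of the quadratic form, so a small
  sublevel set lies between two ellipsoids. Convexity keeps it inside the ball where the
  approximation is valid.\<close>

lemma sublevel_measure_asymptotics:
  fixes q :: "real^'n \<Rightarrow> real" and G :: "real^'n^'n"
  assumes cv: "convex_on D q" and x0: "x0 \<in> D" "q x0 = 0" and G: "pos_def G"
    and approx: "\<And>e. 0 < e \<Longrightarrow> \<exists>r>0. cball x0 r \<subseteq> D \<and>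
        (\<forall>v. norm v \<le> r \<longrightarrow> \<bar>q (x0 + v) - (v \<bullet> (G *v v)) / 2\<bar> \<le> e * (v \<bullet> v))"
  shows "((\<lambda>s. measure lebesgue {x \<in> D. q x \<le> s} / sqrt s ^ CARD('n)) \<longlongrightarrow>
      unit_ball_vol (CARD('n)) * sqrt 2 ^ CARD('n) / sqrt (det G)) (at_right 0)"
    (is "(?f \<longlongrightarrow> ?L) _")
proof -
  define N where "N = CARD('n)"
  have L0: "0 \<le> ?L" using det_pos_def[OF G] by simp
  obtain l where l: "0 < l" "\<And>v. l * (v \<bullet> v) \<le> v \<bullet> (G *v v)"
    using pos_def_coercive[OF G] by metis
  have key: "\<forall>\<^sub>F s in at_right 0. ?L / sqrt (1 + \<epsilon>) ^ N \<le> ?f s \<and> ?f s \<le> ?L / sqrt (1 - \<epsilon>) ^ N"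
    if e: "0 < \<epsilon>" "\<epsilon> < 1" for \<epsilon>
  proof -
    \<comment> \<open>By coercivity of G this absolute tolerance amounts to a relative error
      \<epsilon> in the quadratic form.\<close>
    obtain r where r: "r > 0" "cball x0 r \<subseteq> D"
      "\<And>v. norm v \<le> r \<Longrightarrow> \<bar>q (x0 + v) - (v \<bullet> (G *v v)) / 2\<bar> \<le> (\<epsilon> * l / 2) * (v \<bullet> v)"
      using approx[of "\<epsilon> * l / 2"] e l by auto
    have sand: "(1 - \<epsilon>) * ((x - x0) \<bullet> (G *v (x - x0)) / 2) \<le> q x"
               "q x \<le> (1 + \<epsilon>) * ((x - x0) \<bullet> (G *v (x - x0)) / 2)" if "dist x x0 \<le> r" for x
    proof -
      define v where "v = x - x0"
      have "\<bar>q x - (v \<bullet> (G *v v)) / 2\<bar> \<le> (\<epsilon> * l / 2) * (v \<bullet> v)"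
        using r(3)[of v] that by (simp add: v_def dist_norm)
      also have "\<dots> \<le> \<epsilon> * (v \<bullet> (G *v v) / 2)"
        using mult_left_mono[OF l(2)[of v], of \<epsilon>] e by simp
      finally have "\<bar>q x - v \<bullet> (G *v v) / 2\<bar> \<le> \<epsilon> * (v \<bullet> (G *v v) / 2)" .
      then show "(1 - \<epsilon>) * ((x - x0) \<bullet> (G *v (x - x0)) / 2) \<le> q x"
               "q x \<le> (1 + \<epsilon>) * ((x - x0) \<bullet> (G *v (x - x0)) / 2)"
        unfolding v_def[symmetric] abs_le_iff left_diff_distrib distrib_right by linarith+
    qed
    \<comment> \<open>A lower bound for q on the sphere of radius r, hence outside the ball as well;
      sublevel sets of smaller levels stay inside the ball.\<close>
    define \<eta> where "\<eta> = (1 - \<epsilon>) * (l * r\<^sup>2 / 2)"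
    have \<eta>: "0 < \<eta>" using e l r by (simp add: \<eta>_def)
    have sph: "\<eta> \<le> q x" if "dist x x0 = r" for x
    proof -
      have "l * r\<^sup>2 \<le> (x - x0) \<bullet> (G *v (x - x0))"
        using l(2)[of "x - x0"] that by (simp add: dot_square_norm dist_norm)
      then have "\<eta> \<le> (1 - \<epsilon>) * ((x - x0) \<bullet> (G *v (x - x0)) / 2)"
        unfolding \<eta>_def using e by (intro mult_left_mono) auto
      then show ?thesis using sand(1)[of x] that by simp
    qed
    have out: "\<eta> \<le> q x" if "x \<in> D" "r \<le> dist x x0" for x
    proof -
      have "\<eta> * 1 \<le> \<eta> * (dist x x0 / r)" using that r \<eta> by (intro mult_left_mono) auto
      then show ?thesis using convex_growth_outside_ball[OF cv x0 r(1,2) sph that] by simp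
    qed
    have main: "?L / sqrt (1 + \<epsilon>) ^ N \<le> ?f s \<and> ?f s \<le> ?L / sqrt (1 - \<epsilon>) ^ N" if s: "0 < s" "s < \<eta>" for s
    proof -
      define Z where "Z = {x \<in> D. q x \<le> s}"
      define El where "El c = {x. (x - x0) \<bullet> (G *v (x - x0)) \<le> 2 * s / c}" for c
      have cEl: "compact (El c)" and mEl: "measure lebesgue (El c) = ?L * sqrt s ^ N / sqrt c ^ N" if "0 < c" for c
      proof -
        have "0 \<le> 2 * s / c" using that s by simp
        from measure_ellipsoid[OF G this, of x0] show "compact (El c)" "measure lebesgue (El c) = ?L * sqrt s ^ N / sqrt c ^ N"
          by (simp_all add: El_def N_def real_sqrt_mult real_sqrt_divide power_mult_distrib power_divide mult_ac)
      qed
      have Zball: "dist x x0 < r" if "x \<in> Z" for x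
        using out[of x] that s by (force simp: Z_def not_less[symmetric])
      have sub1: "Z \<subseteq> El (1 - \<epsilon>)"
      proof
        fix x assume x: "x \<in> Z"
        have "(1 - \<epsilon>) * ((x - x0) \<bullet> (G *v (x - x0)) / 2) \<le> s"
          using sand(1)[of x] Zball[OF x] x by (simp add: Z_def)
        then show "x \<in> El (1 - \<epsilon>)" using e by (simp add: El_def pos_le_divide_eq mult.commute)
      qed
      have sub2: "El (1 + \<epsilon>) \<subseteq> Z"
      proof
        fix x assume x: "x \<in> El (1 + \<epsilon>)"
        then have x1: "(x - x0) \<bullet> (G *v (x - x0)) * (1 + \<epsilon>) \<le> 2 * s" using e by (simp add: El_def field_simps)
        have nn: "0 \<le> (x - x0) \<bullet> (G *v (x - x0))" using l(2)[of "x - x0"] l(1)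
          by (meson inner_ge_zero mult_nonneg_nonneg less_imp_le order_trans)
        have "l * (dist x x0)\<^sup>2 \<le> (x - x0) \<bullet> (G *v (x - x0))"
          using l(2)[of "x - x0"] by (simp add: dot_square_norm dist_norm)
        also have "\<dots> \<le> (x - x0) \<bullet> (G *v (x - x0)) * (1 + \<epsilon>)"
          using mult_left_mono[OF _ nn, of 1 "1 + \<epsilon>"] e by simp
        also have "\<dots> \<le> 2 * s" by (rule x1)
        also have "\<dots> < 2 * \<eta>" using s by simp
        also have "\<dots> \<le> l * r\<^sup>2" using e l r by (simp add: \<eta>_def algebra_simps)
        finally have "(dist x x0)\<^sup>2 < r\<^sup>2" using l by simp
        then have dx: "dist x x0 < r" using r by (simp add: power_less_imp_less_base)
        then have "x \<in> D" using r(2) by (auto simp: dist_commute)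
        moreover have "q x \<le> s" using sand(2)[of x] dx x1 by (simp add: algebra_simps)
        ultimately show "x \<in> Z" by (simp add: Z_def)
      qed
      have Zm: "Z \<in> lmeasurable"
      proof (rule measurable_convex)
        show "convex Z" unfolding Z_def by (rule convex_on_sublevel[OF cv])
        show "bounded Z" using bounded_subset[OF compact_imp_bounded[OF cEl] sub1] e by simp
      qed
      have "measure lebesgue (El (1 + \<epsilon>)) \<le> measure lebesgue Z"
        using sub2 Zm cEl[of "1 + \<epsilon>"] e by (intro measure_mono_fmeasurable) (auto simp: borel_compact)
      moreover have "measure lebesgue Z \<le> measure lebesgue (El (1 - \<epsilon>))"
        using sub1 Zm cEl[of "1 - \<epsilon>"] e by (intro measure_mono_fmeasurable) (auto simp: lmeasurable_compact)
      moreover have "0 < sqrt s ^ N" using s by simp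
      ultimately show ?thesis using e mEl[of "1 + \<epsilon>"] mEl[of "1 - \<epsilon>"]
        unfolding Z_def[symmetric] N_def[symmetric] by (simp add: field_simps)
    qed
    show ?thesis
      using eventually_at_right_real[OF \<eta>] by eventually_elim (rule main; simp)
  qed
  show ?thesis
  proof (rule tendstoI)
    fix d :: real assume d: "0 < d"
    have t1: "((\<lambda>\<epsilon>. ?L / sqrt (1 + \<epsilon>) ^ N) \<longlongrightarrow> ?L / sqrt (1 + 0) ^ N) (at_right 0)"
      and t2: "((\<lambda>\<epsilon>. ?L / sqrt (1 - \<epsilon>) ^ N) \<longlongrightarrow> ?L / sqrt (1 - 0) ^ N) (at_right 0)"
      by (intro tendsto_intros; simp)+
    have "\<forall>\<^sub>F \<epsilon> in at_right 0. \<epsilon> < 1 \<and> 0 < (\<epsilon>::real)"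
      by (subst eventually_at_right[of _ 1]) (auto intro!: exI[of _ 1])
    moreover have "\<forall>\<^sub>F \<epsilon> in at_right 0. dist (?L / sqrt (1 + \<epsilon>) ^ N) ?L < d" using tendstoD[OF t1 d] by simp
    moreover have "\<forall>\<^sub>F \<epsilon> in at_right 0. dist (?L / sqrt (1 - \<epsilon>) ^ N) ?L < d" using tendstoD[OF t2 d] by simp
    ultimately have "\<forall>\<^sub>F \<epsilon> in at_right 0. \<epsilon> < 1 \<and> 0 < \<epsilon> \<and> dist (?L / sqrt (1 + \<epsilon>) ^ N) ?L < d \<and> dist (?L / sqrt (1 - \<epsilon>) ^ N) ?L < d"
      by eventually_elim auto
    then obtain \<epsilon> where \<epsilon>: "\<epsilon> < 1" "0 < \<epsilon>" "dist (?L / sqrt (1 + \<epsilon>) ^ N) ?L < d" "dist (?L / sqrt (1 - \<epsilon>) ^ N) ?L < d"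
      using eventually_happens'[OF trivial_limit_at_right_real] by blast
    show "\<forall>\<^sub>F s in at_right 0. dist (?f s) ?L < d"
      using key[OF \<epsilon>(2,1)] by eventually_elim (use \<epsilon> in \<open>auto simp: dist_real_def abs_less_iff\<close>)
  qed
qed

text \<open>The limit encloses m between multiples of \<open>sqrt s ^ N\<close>; integration raises
  the exponent from N / 2 to N / 2 + 1 and yields the denominator.\<close>

lemma integral_asymptotics:
  fixes m V :: "real \<Rightarrow> real"
  assumes m: "((\<lambda>s. m s / sqrt s ^ N) \<longlongrightarrow> L) (at_right 0)"
    and V: "\<forall>\<^sub>F t in at_right 0. (m has_integral V t) {0..t}"
  shows "((\<lambda>t. V t / (t * sqrt t ^ N)) \<longlongrightarrow> L / (N / 2 + 1)) (at_right 0)"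
proof (rule tendstoI)
  fix d :: real assume d: "0 < d"
  have W: "((\<lambda>s. c * sqrt s ^ N) has_integral c * (t * sqrt t ^ N / (N / 2 + 1))) {0..t}" if "0 < t" for c t
  proof -
    have eq: "sqrt s ^ N = s powr (N / 2)" if "0 < s" for s
      using that by (simp add: powr_half_sqrt[symmetric] powr_realpow[symmetric] powr_powr)
    have "((\<lambda>s. s powr (N / 2)) has_integral t powr (N / 2 + 1) / (N / 2 + 1)) {0..t}"
      using that by (intro has_integral_powr_from_0) auto
    then have "((\<lambda>s. sqrt s ^ N) has_integral t powr (N / 2 + 1) / (N / 2 + 1)) {0..t}"
      by (rule has_integral_spike[OF negligible_sing[of 0], rotated]) (use eq in auto)
    moreover have "t powr (N / 2 + 1) = t * sqrt t ^ N" using that by (simp add: powr_add eq)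
    ultimately show ?thesis using has_integral_mult_right[of "\<lambda>s. sqrt s ^ N" "t * sqrt t ^ N / (N / 2 + 1)" "{0..t}" c] by simp
  qed
  define e where "e = d / 2"
  have "\<forall>\<^sub>F s in at_right 0. dist (m s / sqrt s ^ N) L < e" using tendstoD[OF m, of e] d by (simp add: e_def)
  then obtain b where b: "0 < b" "\<And>s. 0 < s \<Longrightarrow> s < b \<Longrightarrow> dist (m s / sqrt s ^ N) L < e"
    by (auto simp: eventually_at_right[of 0 1])
  have ev: "\<forall>\<^sub>F t in at_right 0. 0 < t \<and> t < b"
    using b by (subst eventually_at_right[of _ 1]) auto
  show "\<forall>\<^sub>F t in at_right 0. dist (V t / (t * sqrt t ^ N)) (L / (N / 2 + 1)) < d"
    using V ev
  proof eventually_elim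
    case (elim t)
    define w where "w = t * sqrt t ^ N"
    have w: "0 < w" using elim by (simp add: w_def)
    have bnd: "(L - e) * sqrt s ^ N \<le> m s \<and> m s \<le> (L + e) * sqrt s ^ N" if "s \<in> {0..t} - {0}" for s
    proof -
      have s: "0 < s" "s < b" using that elim by auto
      then have "0 < sqrt s ^ N" by simp
      moreover have "L - e \<le> m s / sqrt s ^ N \<and> m s / sqrt s ^ N \<le> L + e"
        using b(2)[OF s] by (auto simp: dist_real_def)
      ultimately show ?thesis by (metis pos_le_divide_eq pos_divide_le_eq)
    qed
    \<comment> \<open>The limit says nothing about m at 0, so the integrand is replaced there by the
      bound; a single point does not affect the integral.\<close>
    have m': "((\<lambda>s. if s = 0 then (L - e) * sqrt s ^ N else m s) has_integral V t) {0..t}"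
      and m'': "((\<lambda>s. if s = 0 then (L + e) * sqrt s ^ N else m s) has_integral V t) {0..t}"
      by (rule has_integral_spike[OF negligible_sing[of 0] _ elim(1)]; auto)+
    have "(L - e) * (w / (N / 2 + 1)) \<le> V t"
      unfolding w_def using bnd by (intro has_integral_le[OF W m']) (use elim in auto)
    moreover have "V t \<le> (L + e) * (w / (N / 2 + 1))"
      unfolding w_def using bnd by (intro has_integral_le[OF m'' W]) (use elim in auto)
    moreover have "0 < real N / 2 + 1" by (simp add: add_nonneg_pos)
    ultimately have "(L - e) / (N / 2 + 1) \<le> V t / w" "V t / w \<le> (L + e) / (N / 2 + 1)"
      using w by (simp_all add: field_simps)
    then have "\<bar>V t / w - L / (N / 2 + 1)\<bar> \<le> e / (N / 2 + 1)"
      by (simp add: abs_le_iff diff_divide_distrib add_divide_distrib)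
    also have "\<dots> \<le> e / 1" using d by (intro divide_left_mono) (auto simp: e_def)
    also have "\<dots> < d" using d by (simp add: e_def)
    finally show ?case by (simp add: dist_real_def w_def)
  qed
qed

section \<open>Convex sets bounded by graphs\<close>

text \<open>The segments from b to ever more distant points of the ray contain points converging to
  \<open>b + t *\<^sub>R d\<close>.\<close>

lemma closed_convex_recession:
  fixes C :: "'a::real_normed_vector set"
  assumes C: "closed C" "convex C" and ray: "\<And>t. 0 \<le> t \<Longrightarrow> a + t *\<^sub>R d \<in> C" and b: "b \<in> C" and t: "0 \<le> t"
  shows "b + t *\<^sub>R d \<in> C"
proof (rule closed_sequentially[OF C(1)])
  let ?e = "\<lambda>m. 1 / real (Suc m)"
  show "(1 - ?e m) *\<^sub>R b + ?e m *\<^sub>R (a + (t * real (Suc m)) *\<^sub>R d) \<in> C" for m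
    by (rule convexD[OF C(2) b ray]) (use t in \<open>auto simp: field_simps\<close>)
  have eq: "(1 - ?e m) *\<^sub>R b + ?e m *\<^sub>R (a + (t * real (Suc m)) *\<^sub>R d) = b + t *\<^sub>R d + ?e m *\<^sub>R (a - b)" for m
    by (simp add: algebra_simps del: of_nat_Suc)
  have "?e \<longlonglongrightarrow> 0" using LIMSEQ_inverse_real_of_nat by (simp add: inverse_eq_divide)
  then have "(\<lambda>m. b + t *\<^sub>R d + ?e m *\<^sub>R (a - b)) \<longlonglongrightarrow> b + t *\<^sub>R d + 0 *\<^sub>R (a - b)"
    by (intro tendsto_intros)
  then show "(\<lambda>m. (1 - ?e m) *\<^sub>R b + ?e m *\<^sub>R (a + (t * real (Suc m)) *\<^sub>R d)) \<longlonglongrightarrow> b + t *\<^sub>R d"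
    unfolding eq by simp
qed

text \<open>A vertical line meets the frontier at most once, and a connected set that meets C but
  misses its frontier lies in C; so C contains whole vertical half-lines. If both an upward and a
  downward one occurred, both directions would be recession directions of C, and a graph point would
  lie midway between interior points. The set E is the projection of the interior.\<close>

lemma graph_bounding_convex_set:
  fixes u :: "'a::euclidean_space \<Rightarrow> real" and C :: "('a \<times> real) set"
  assumes C: "closed C" "convex C" "interior C \<noteq> {}"
    and fr: "frontier C = {(x, z). x \<in> E \<and> z = u x}" and E: "E \<noteq> {}"
  shows "open E" and "convex E"
    and "C = {(x, z). x \<in> E \<and> u x \<le> z} \<or> C = {(x, z). x \<in> E \<and> z \<le> u x}"
proof -
  have sub: "interior C \<subseteq> C" by (rule interior_subset)
  have CI: "p \<in> interior C" if "p \<in> C" "p \<notin> frontier C" for p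
    using that C(1) by (auto simp: frontier_def)
  have frC: "frontier C \<subseteq> C" using C(1) by (simp add: frontier_subset_closed)
  have conn: "L \<subseteq> C" if "connected L" "L \<inter> frontier C = {}" "L \<inter> C \<noteq> {}" for L
    using connected_Int_frontier[OF that(1,3)] that(2) by (metis Diff_eq_empty_iff)
  have ray_up: "\<And>x z t. (x, z) \<in> C \<Longrightarrow> 0 \<le> t \<Longrightarrow> (x, z + t) \<in> C"
    if *: "\<And>z. z0 < z \<Longrightarrow> (x0, z) \<in> C" for x0 z0
  proof -
    fix x z and t :: real assume xz: "(x, z) \<in> C" "0 \<le> t"
    have "(x0, z0 + 1) + s *\<^sub>R (0, 1) \<in> C" if "0 \<le> s" for s
      using *[of "z0 + 1 + s"] that by simp
    from closed_convex_recession[OF C(1,2) this xz] have "(x, z) + t *\<^sub>R (0, 1) \<in> C" .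
    then show "(x, z + t) \<in> C" by simp
  qed
  have ray_down: "\<And>x z t. (x, z) \<in> C \<Longrightarrow> 0 \<le> t \<Longrightarrow> (x, z - t) \<in> C"
    if *: "\<And>z. z < z0 \<Longrightarrow> (x0, z) \<in> C" for x0 z0
  proof -
    fix x z and t :: real assume xz: "(x, z) \<in> C" "0 \<le> t"
    have "(x0, z0 - 1) + s *\<^sub>R (0, -1) \<in> C" if "0 \<le> s" for s
      using *[of "z0 - 1 - s"] that by simp
    from closed_convex_recession[OF C(1,2) this xz] have "(x, z) + t *\<^sub>R (0, -1) \<in> C" .
    then show "(x, z - t) \<in> C" by simp
  qed
  have no_line: False if up: "\<And>z. z0 < z \<Longrightarrow> (x0, z) \<in> C" and dn: "\<And>z. z < z1 \<Longrightarrow> (x1, z) \<in> C" for x0 z0 x1 z1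
  proof -
    obtain x where x: "x \<in> E" using E by blast
    then have xC: "(x, u x) \<in> C" using fr frC by auto
    have "(x, u x + 1) \<in> C" "(x, u x - 1) \<in> C"
      using ray_up[OF up xC, where t=1] ray_down[OF dn xC, where t=1] by auto
    then have "(x, u x + 1) \<in> interior C" "(x, u x - 1) \<in> interior C"
      using fr by (auto intro!: CI)
    then have "(1/2) *\<^sub>R (x, u x + 1) + (1/2) *\<^sub>R (x, u x - 1) \<in> interior C"
      using convex_interior[OF C(2)] by (intro convexD) auto
    moreover have "(1/2) *\<^sub>R (x, u x + 1) + (1/2) *\<^sub>R (x, u x - 1) = (x, u x)"
      by (simp add: scaleR_left_distrib[symmetric] field_simps)
    ultimately have "(x, u x) \<in> interior C" by simp
    moreover have "(x, u x) \<in> frontier C" using fr x by auto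
    ultimately show False by (simp add: frontier_def)
  qed
  have notE: "(x, z) \<notin> C" if "x \<notin> E" for x z
  proof
    assume "(x, z) \<in> C"
    have "{x} \<times> UNIV \<subseteq> C"
      using that \<open>(x, z) \<in> C\<close> by (intro conn connected_Times) (auto simp: fr)
    then show False using no_line[of z x z x] by auto
  qed
  have upper: "\<And>z'. u x < z' \<Longrightarrow> (x, z') \<in> C" if "(x, z) \<in> C" "u x < z" for x z
  proof -
    have "{x} \<times> {u x<..} \<subseteq> C"
      using that by (intro conn connected_Times) (auto simp: fr)
    then show "\<And>z'. u x < z' \<Longrightarrow> (x, z') \<in> C" by auto
  qed
  have lower: "\<And>z'. z' < u x \<Longrightarrow> (x, z') \<in> C" if "(x, z) \<in> C" "z < u x" for x z
  proof -
    have "{x} \<times> {..<u x} \<subseteq> C"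
      using that by (intro conn connected_Times) (auto simp: fr)
    then show "\<And>z'. z' < u x \<Longrightarrow> (x, z') \<in> C" by auto
  qed
  obtain x0 z0 where p0: "(x0, z0) \<in> interior C" using C(3) by auto
  have p0C: "(x0, z0) \<in> C" and "x0 \<in> E" using p0 sub notE by blast+
  have "z0 \<noteq> u x0" using p0 fr \<open>x0 \<in> E\<close> by (auto simp: frontier_def)
  have graphC: "x \<in> E \<Longrightarrow> (x, u x) \<in> C" for x using fr frC by auto
  show main: "C = {(x, z). x \<in> E \<and> u x \<le> z} \<or> C = {(x, z). x \<in> E \<and> z \<le> u x}"
  proof (cases "u x0 < z0")
    case True
    note up = upper[OF p0C True]
    have "(x, z) \<in> C \<longleftrightarrow> x \<in> E \<and> u x \<le> z" for x z
      using no_line[OF up lower[of x z]] ray_up[OF up graphC[of x], where t="z - u x"] notE[of x z] by force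
    then show ?thesis by auto
  next
    case False
    then have "z0 < u x0" using \<open>z0 \<noteq> u x0\<close> by simp
    note dn = lower[OF p0C this]
    have "(x, z) \<in> C \<longleftrightarrow> x \<in> E \<and> z \<le> u x" for x z
      using no_line[OF upper[of x z] dn] ray_down[OF dn graphC[of x], where t="u x - z"] notE[of x z] by force
    then show ?thesis by auto
  qed
  have "E = fst ` interior C"
  proof
    show "fst ` interior C \<subseteq> E" using sub notE by force
    show "E \<subseteq> fst ` interior C"
    proof
      fix x assume x: "x \<in> E"
      have "(x, u x + 1) \<in> interior C \<or> (x, u x - 1) \<in> interior C"
        using main x fr CI[of "(x, u x + 1)"] CI[of "(x, u x - 1)"] by auto
      then show "x \<in> fst ` interior C" by force
    qed
  qed
  then show "open E" "convex E"
    using convex_interior[OF C(2)] by (auto intro: open_image_fst convex_linear_image linear_fst)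
qed

lemma interior_epigraph:
  fixes u :: "'a::euclidean_space \<Rightarrow> real"
  assumes D: "open D" and u: "continuous_on D u"
  shows "interior {(x, z). x \<in> D \<and> u x \<le> z} = {(x, z). x \<in> D \<and> u x < z}"
proof
  have "continuous_on (D \<times> UNIV) (\<lambda>p. snd p - u (fst p))"
    by (intro continuous_intros continuous_on_compose2[OF u]) auto
  then have "open ((D \<times> UNIV) \<inter> (\<lambda>p. snd p - u (fst p)) -` {0<..})"
    using D by (intro continuous_open_preimage open_Times) auto
  moreover have "(D \<times> UNIV) \<inter> (\<lambda>p. snd p - u (fst p)) -` {0<..} = {(x, z). x \<in> D \<and> u x < z}"
    by auto
  ultimately have "open {(x, z). x \<in> D \<and> u x < z}" by simp
  then show "{(x, z). x \<in> D \<and> u x < z} \<subseteq> interior {(x, z). x \<in> D \<and> u x \<le> z}"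
    by (intro interior_maximal) auto
  show "interior {(x, z). x \<in> D \<and> u x \<le> z} \<subseteq> {(x, z). x \<in> D \<and> u x < z}"
  proof clarify
    fix x z assume "(x, z) \<in> interior {(x, z). x \<in> D \<and> u x \<le> z}"
    then obtain e where e: "e > 0" "cball (x, z) e \<subseteq> {(x, z). x \<in> D \<and> u x \<le> z}"
      by (auto simp: mem_interior_cball)
    have "(x, z - e) \<in> cball (x, z) e" using e by (simp add: dist_Pair_Pair dist_real_def)
    then have "x \<in> D" "u x \<le> z - e" using e by auto
    then show "x \<in> D \<and> u x < z" using e by auto
  qed
qed

section \<open>Curvature of level hypersurfaces\<close>

lemma det_scaleR: "det (c *\<^sub>R A) = c ^ CARD('n) * det (A :: real^'n^'n)"
proof -
  have "c *\<^sub>R A = (\<chi> i. c *s A $ i)" by (simp add: vec_eq_iff)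
  then show ?thesis by (simp add: det_rows_mul)
qed

lemma gradient_eqI:
  assumes "p \<in> interior D" "(G has_derivative (\<lambda>w. v \<bullet> w)) (at p)"
  shows "gradient D G p = v"
proof -
  have at: "at p within D = at p" by (rule at_within_interior[OF assms(1)])
  have "v' = v" if "(G has_derivative (\<lambda>w. v' \<bullet> w)) (at p)" for v'
    using has_derivative_unique[OF that assms(2)] by (metis vector_eq_rdot)
  then show ?thesis unfolding gradient_def at using assms(2) by (intro the_equality)
qed

text \<open>Both the graph of \<open>f\<close> (with \<open>\<zeta> = id\<close>) and the hypersurfaces \<open>M\<^sub>k\<close>
  (with \<open>\<zeta> z = z powr \<alpha>\<close>) are level sets of this form.\<close>

locale split_hypersurface =
  fixes f :: "real^'n \<Rightarrow> real" and \<zeta> \<zeta>' \<zeta>'' :: "real \<Rightarrow> real" and U :: "real set" and D :: "'n pt set"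
    and G :: "'n pt \<Rightarrow> real"
  assumes f: "smooth f" and U: "open U" and UD: "UNIV \<times> U \<subseteq> D"
    and \<zeta>: "\<And>z. z \<in> U \<Longrightarrow> (\<zeta> has_real_derivative \<zeta>' z) (at z)"
    and \<zeta>': "\<And>z. z \<in> U \<Longrightarrow> (\<zeta>' has_real_derivative \<zeta>'' z) (at z)"
    and \<zeta>'0: "\<And>z. z \<in> U \<Longrightarrow> \<zeta>' z \<noteq> 0"
    and G: "\<And>x z. G (x, z) = \<zeta> z - f x"
begin

lemma in_interior: "z \<in> U \<Longrightarrow> (x, z) \<in> interior D"
  using interior_maximal[OF UD] U by (auto simp: open_Times)

lemma G_has_derivative:
  assumes "z \<in> U" shows "(G has_derivative (\<lambda>w. (- grad f x, \<zeta>' z) \<bullet> w)) (at (x, z))"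
proof -
  have 1: "((\<lambda>q. \<zeta> (snd q)) has_derivative (\<lambda>w. \<zeta>' z * snd w)) (at (x, z))"
    by (rule has_derivative_compose[where f = snd, OF has_derivative_snd[OF has_derivative_ident]])
       (use \<zeta>[OF assms] in \<open>simp add: has_field_derivative_def\<close>)
  have 2: "((\<lambda>q. f (fst q)) has_derivative (\<lambda>w. grad f x \<bullet> fst w)) (at (x, z))"
    by (rule has_derivative_compose[where f = fst, OF has_derivative_fst[OF has_derivative_ident]])
       (simp add: grad_has_derivative_real[OF f])
  have "((\<lambda>q. \<zeta> (snd q) - f (fst q)) has_derivative (\<lambda>w. \<zeta>' z * snd w - grad f x \<bullet> fst w)) (at (x, z))"
    by (intro has_derivative_diff 1 2)
  moreover have "(\<lambda>q. \<zeta> (snd q) - f (fst q)) = G" using G by force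
  moreover have "(\<lambda>w. \<zeta>' z * snd w - grad f x \<bullet> fst w) = (\<lambda>w. (- grad f x, \<zeta>' z) \<bullet> w)"
    by (auto simp: inner_prod_def)
  ultimately show ?thesis by simp
qed

lemma gradient_split: "z \<in> U \<Longrightarrow> gradient D G (x, z) = (- grad f x, \<zeta>' z)"
  by (intro gradient_eqI in_interior G_has_derivative)

lemma gradient_nz: "z \<in> U \<Longrightarrow> gradient D G (x, z) \<noteq> 0"
  using \<zeta>'0[of z] by (simp add: gradient_split zero_prod_def)

lemma norm_gradient_split:
  assumes "z \<in> U"
  shows "norm (gradient D G (x, z)) = \<bar>\<zeta>' z\<bar> * sqrt (1 + (grad f x /\<^sub>R \<zeta>' z) \<bullet> (grad f x /\<^sub>R \<zeta>' z))"
proof -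
  have "(norm (gradient D G (x, z)))\<^sup>2 = (\<zeta>' z)\<^sup>2 + grad f x \<bullet> grad f x"
    unfolding power2_norm_eq_inner by (simp add: gradient_split[OF assms] inner_prod_def power2_eq_square)
  also have "\<dots> = (\<bar>\<zeta>' z\<bar> * sqrt (1 + (grad f x /\<^sub>R \<zeta>' z) \<bullet> (grad f x /\<^sub>R \<zeta>' z)))\<^sup>2"
    using \<zeta>'0[OF assms] by (simp add: power_mult_distrib add_nonneg_nonneg) (simp add: field_simps power2_eq_square)
  finally show ?thesis
    by (rule power2_eq_imp_eq) (auto simp del: inner_scaleR_left inner_scaleR_right intro!: mult_nonneg_nonneg add_nonneg_nonneg)
qed

lemma gradient_has_derivative:
  assumes "z \<in> U"
  shows "((\<lambda>q. (- grad f (fst q), \<zeta>' (snd q))) has_derivative (\<lambda>v. (- (hess f x *v fst v), \<zeta>'' z * snd v))) (at (x, z))"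
proof (intro has_derivative_Pair has_derivative_minus)
  show "((\<lambda>q. grad f (fst q)) has_derivative (\<lambda>v. hess f x *v fst v)) (at (x, z))"
    by (rule has_derivative_compose[where f = fst, OF has_derivative_fst[OF has_derivative_ident]])
       (simp add: grad_has_derivative[OF f])
  show "((\<lambda>q. \<zeta>' (snd q)) has_derivative (\<lambda>v. \<zeta>'' z * snd v)) (at (x, z))"
    by (rule has_derivative_compose[where f = snd, OF has_derivative_snd[OF has_derivative_ident]])
       (use \<zeta>'[OF assms] in \<open>simp add: has_field_derivative_def\<close>)
qed

text \<open>The derivative of the normalizing factor multiplies the gradient itself and drops out
  against a tangent vector w, so only its existence is established.\<close>

lemma second_fundamental_form_split:
  assumes z: "z \<in> U" and w: "w \<bullet> gradient D G (x, z) = 0"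
  shows "second_fundamental_form D G s (x, z) v w =
     s / norm (gradient D G (x, z)) * (fst w \<bullet> (hess f x *v fst v) - \<zeta>'' z * snd v * snd w)"
proof -
  define g where "g = (\<lambda>q. (- grad f (fst q), \<zeta>' (snd q)))"
  define g' where "g' = (\<lambda>v. (- (hess f x *v fst v), \<zeta>'' z * snd v))"
  let ?p = "(x, z)"
  have gd: "(g has_derivative g') (at ?p)"
    unfolding g_def g'_def by (rule gradient_has_derivative[OF z])
  have g0: "g ?p \<noteq> 0" and gg: "gradient D G ?p = g ?p"
    using gradient_nz[OF z] gradient_split[OF z] by (auto simp: g_def)
  have "(\<lambda>q. inverse (norm (g q))) differentiable (at ?p)"
    using g0 gd by (intro differentiable_inverse differentiable_compose[of norm g] differentiable_norm_at) (auto simp: differentiable_def)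
  then obtain L where L: "((\<lambda>q. inverse (norm (g q))) has_derivative L) (at ?p)"
    by (auto simp: differentiable_def)
  have "((\<lambda>q. s *\<^sub>R (inverse (norm (g q)) *\<^sub>R g q)) has_derivative
     (\<lambda>v. s *\<^sub>R (inverse (norm (g ?p)) *\<^sub>R g' v + L v *\<^sub>R g ?p))) (at ?p)"
    by (intro has_derivative_scaleR_right has_derivative_scaleR L gd)
  then have "((\<lambda>q. s *\<^sub>R unit_normal D G q) has_derivative
     (\<lambda>v. s *\<^sub>R (inverse (norm (g ?p)) *\<^sub>R g' v + L v *\<^sub>R g ?p))) (at ?p)"
  proof (rule has_derivative_transform_within_open)
    show "open (UNIV \<times> U)" "?p \<in> UNIV \<times> U" using U z by (auto intro: open_Times)
    show "s *\<^sub>R (inverse (norm (g q)) *\<^sub>R g q) = s *\<^sub>R unit_normal D G q" if "q \<in> UNIV \<times> U" for q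
      using that by (cases q) (auto simp: unit_normal_def gradient_split g_def)
  qed
  then have fd: "frechet_derivative (\<lambda>q. s *\<^sub>R unit_normal D G q) (at ?p) =
     (\<lambda>v. s *\<^sub>R (inverse (norm (g ?p)) *\<^sub>R g' v + L v *\<^sub>R g ?p))"
    by (rule frechet_derivative_at[symmetric])
  have at: "at ?p within D = at ?p" by (rule at_within_interior[OF in_interior[OF z]])
  have "g ?p \<bullet> w = 0" using w gg by (simp add: inner_commute)
  then have "second_fundamental_form D G s ?p v w = - (s * inverse (norm (g ?p)) * (g' v \<bullet> w))"
    unfolding second_fundamental_form_def at fd by (simp add: inner_add_left)
  also have "g' v \<bullet> w = \<zeta>'' z * snd v * snd w - fst w \<bullet> (hess f x *v fst v)"
    by (simp add: g'_def inner_prod_def inner_commute)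
  finally show ?thesis by (simp add: gg divide_inverse algebra_simps)
qed

lemma tangent_iff:
  assumes "z \<in> U"
  shows "w \<bullet> gradient D G (x, z) = 0 \<longleftrightarrow> snd w = (grad f x /\<^sub>R \<zeta>' z) \<bullet> fst w"
  using \<zeta>'0[OF assms] by (auto simp: gradient_split[OF assms] inner_prod_def inner_commute field_simps)

text \<open>Up to the factor \<open>s / norm (gradient D G (x, z))\<close>, this is the second
  fundamental form in terms of the x-components of tangent vectors, the z-components being
  eliminated by \<open>tangent_iff\<close>.\<close>

definition shape_mat where
  "shape_mat x z = hess f x - (\<zeta>'' z / (\<zeta>' z)\<^sup>2) *\<^sub>R outer (grad f x)"

lemma second_fundamental_form_tangent:
  assumes z: "z \<in> U" and v: "v \<bullet> gradient D G (x, z) = 0" and w: "w \<bullet> gradient D G (x, z) = 0"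
  shows "second_fundamental_form D G s (x, z) v w =
     s / norm (gradient D G (x, z)) * (fst w \<bullet> (shape_mat x z *v fst v))"
  unfolding second_fundamental_form_split[OF z w]
  using v w \<zeta>'0[OF z] unfolding tangent_iff[OF z] shape_mat_def
  by (simp add: matrix_vector_mult_diff_rdistrib scaleR_matrix_vector_assoc[symmetric] inner_diff_right inner_commute[of "fst w" "grad f x"] power2_eq_square divide_inverse)

lemma shape_mat_sym: "transpose (shape_mat x z) = shape_mat x z"
  using hess_sym[OF f, of x] by (simp add: shape_mat_def transpose_def vec_eq_iff outer_def mult.commute)

text \<open>A tangent vector is determined by its x-component, and rescaling to unit length only
  multiplies the form by a positive number.\<close>

lemma positive_normal_curvatures_iff:
  assumes z: "z \<in> U"
  shows "positive_normal_curvatures D G s (x, z) \<longleftrightarrow> pos_def (s *\<^sub>R shape_mat x z)"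
proof
  let ?g = "gradient D G (x, z)"
  have gpos: "0 < norm ?g" using gradient_nz[OF z] by simp
  have sym: "transpose (s *\<^sub>R shape_mat x z) = s *\<^sub>R shape_mat x z"
    using shape_mat_sym[of x z] by (simp add: transpose_def vec_eq_iff)
  {
    assume pos: "positive_normal_curvatures D G s (x, z)"
    have "0 < X \<bullet> ((s *\<^sub>R shape_mat x z) *v X)" if X: "X \<noteq> 0" for X
    proof -
      define v0 where "v0 = (X, (grad f x /\<^sub>R \<zeta>' z) \<bullet> X)"
      have v0: "v0 \<noteq> 0" using X by (auto simp: v0_def zero_prod_def)
      define c where "c = inverse (norm v0)"
      have c: "0 < c" using v0 by (simp add: c_def)
      have t0: "v0 \<bullet> ?g = 0" unfolding tangent_iff[OF z] by (simp add: v0_def)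
      have "norm (c *\<^sub>R v0) = 1" using v0 by (simp add: c_def)
      moreover have t: "(c *\<^sub>R v0) \<bullet> ?g = 0" using t0 by simp
      ultimately have "0 < second_fundamental_form D G s (x, z) (c *\<^sub>R v0) (c *\<^sub>R v0)"
        using pos unfolding positive_normal_curvatures_def by blast
      also have "\<dots> = (c * c / norm ?g) * (X \<bullet> ((s *\<^sub>R shape_mat x z) *v X))"
        unfolding second_fundamental_form_tangent[OF z t t]
        by (simp add: v0_def matrix_vector_mult_scaleR scaleR_matrix_vector_assoc[symmetric])
      finally show ?thesis using c gpos by (simp add: zero_less_mult_iff zero_less_divide_iff)
    qed
    then show "pos_def (s *\<^sub>R shape_mat x z)" using sym by (simp add: pos_def_def)
  next
    assume pd: "pos_def (s *\<^sub>R shape_mat x z)"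
    show "positive_normal_curvatures D G s (x, z)"
      unfolding positive_normal_curvatures_def
    proof (intro allI impI)
      fix v assume v: "norm v = 1 \<and> v \<bullet> ?g = 0"
      then have "fst v \<noteq> 0" using tangent_iff[OF z, of v x] by (cases v) auto
      then have "0 < fst v \<bullet> ((s *\<^sub>R shape_mat x z) *v fst v)" using pd by (simp add: pos_def_def)
      then have "0 < (fst v \<bullet> ((s *\<^sub>R shape_mat x z) *v fst v)) / norm ?g" using gpos by simp
      then show "0 < second_fundamental_form D G s (x, z) v v"
        using v by (simp add: second_fundamental_form_tangent[OF z] scaleR_matrix_vector_assoc[symmetric])
    qed
  }
qed

lemma ex_orthonormal_tangent_basis:
  assumes z: "z \<in> U"
  shows "\<exists>b. orthonormal_tangent_basis D G (x, z) b"
proof -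
  define \<xi> where "\<xi> = grad f x /\<^sub>R \<zeta>' z"
  obtain \<tau> :: "real^'n \<Rightarrow> 'n pt" where t: "linear \<tau>" "range \<tau> = {(x, z). z = \<xi> \<bullet> x}" "\<forall>y y'. dist (\<tau> y) (\<tau> y') = dist y y'"
    using ex_hyperplane_isometry by blast
  have "\<tau> y \<bullet> \<tau> y' = y \<bullet> y'" for y y'
    using t linear_0[OF t(1)] by (intro isometry_linear_between(2)) auto
  then have "\<tau> (axis i 1) \<bullet> \<tau> (axis j 1) = (if i = j then 1 else 0)" for i j
    by (simp add: inner_axis_axis)
  moreover have "\<tau> y \<bullet> gradient D G (x, z) = 0" for y
  proof -
    have "\<tau> y \<in> {(x, z). z = \<xi> \<bullet> x}" using t(2) rangeI[of \<tau> y] by simp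
    then show ?thesis unfolding tangent_iff[OF z] by (cases "\<tau> y") (simp add: \<xi>_def)
  qed
  ultimately show ?thesis
    by (intro exI[of _ "\<lambda>i. \<tau> (axis i 1)"]) (simp add: orthonormal_tangent_basis_def)
qed

text \<open>The rows of A are the x-components of an orthonormal tangent basis. Orthonormality reads
  \<open>A ** (mat 1 + outer \<xi>) ** transpose A = mat 1\<close> and fixes the square of det A. Of
  the exponent n + 2, the part n cancels the normalization of the n rows of the form, and the part 2
  cancels the square of det A up to the square of \<open>\<zeta>' z\<close>.\<close>

lemma gauss_kronecker_split:
  assumes z: "z \<in> U"
  shows "gauss_kronecker_curvature D G s (x, z) * norm (gradient D G (x, z)) ^ (CARD('n) + 2)
     = s ^ CARD('n) * (\<zeta>' z)\<^sup>2 * det (shape_mat x z)"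
proof -
  let ?g = "gradient D G (x, z)"
  have gpos: "0 < norm ?g" using gradient_nz[OF z] by simp
  define b where "b = (SOME b. orthonormal_tangent_basis D G (x, z) b)"
  have b: "orthonormal_tangent_basis D G (x, z) b"
    unfolding b_def using ex_orthonormal_tangent_basis[OF z] by (rule someI_ex)
  define \<xi> where "\<xi> = grad f x /\<^sub>R \<zeta>' z"
  have bt: "b i \<bullet> ?g = 0" for i using b by (simp add: orthonormal_tangent_basis_def)
  then have sb: "snd (b i) = \<xi> \<bullet> fst (b i)" for i using tangent_iff[OF z] by (simp add: \<xi>_def)
  define A where "A = (\<chi> i. fst (b i))"
  have entry: "(A ** M ** transpose A) $ i $ j = fst (b i) \<bullet> (M *v fst (b j))" for M i j
  proof -
    have "(A ** M ** transpose A) $ i $ j = ((A ** M ** transpose A) *v axis j 1) $ i"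
      by (simp add: matrix_vector_mul_component inner_axis)
    also have "\<dots> = (A *v (M *v (transpose A *v axis j 1))) $ i"
      by (simp add: matrix_vector_mul_assoc matrix_mul_assoc)
    also have "transpose A *v axis j 1 = fst (b j)"
      by (simp add: A_def transpose_def matrix_vector_mult_basis column_def vec_eq_iff)
    also have "(A *v (M *v fst (b j))) $ i = fst (b i) \<bullet> (M *v fst (b j))"
      by (simp add: matrix_vector_mul_component A_def)
    finally show ?thesis .
  qed
  have AGA: "A ** (mat 1 + outer \<xi>) ** transpose A = mat 1"
  proof -
    have "(A ** (mat 1 + outer \<xi>) ** transpose A) $ i $ j = b i \<bullet> b j" for i j
      unfolding entry by (simp add: inner_prod_def sb matrix_vector_mult_add_rdistrib inner_add_right inner_commute)
    then show ?thesis using b by (simp add: orthonormal_tangent_basis_def vec_eq_iff mat_def)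
  qed
  have detA: "(det A)\<^sup>2 * (1 + \<xi> \<bullet> \<xi>) = 1"
  proof -
    have "det (A ** (mat 1 + outer \<xi>) ** transpose A) = 1" by (simp add: AGA)
    then show ?thesis by (simp add: det_mul det_transpose det_identity_plus_outer power2_eq_square mult_ac)
  qed
  define c where "c = s / norm ?g"
  have "gauss_kronecker_curvature D G s (x, z) =
      det (\<chi> i j. second_fundamental_form D G s (x, z) (b i) (b j))"
    by (simp add: gauss_kronecker_curvature_def b_def[symmetric])
  also have "(\<chi> i j. second_fundamental_form D G s (x, z) (b i) (b j)) = c *\<^sub>R (A ** shape_mat x z ** transpose A)"
  proof -
    have "second_fundamental_form D G s (x, z) (b i) (b j) = c * (fst (b i) \<bullet> (shape_mat x z *v fst (b j)))" for i j
      unfolding second_fundamental_form_tangent[OF z bt bt] c_def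
      using sym_inner[OF shape_mat_sym[of x z], of "fst (b j)" "fst (b i)"] by (simp add: inner_commute)
    then show ?thesis by (simp add: vec_eq_iff entry)
  qed
  also have "det \<dots> = c ^ CARD('n) * ((det A)\<^sup>2 * det (shape_mat x z))"
    by (simp add: det_scaleR det_mul det_transpose power2_eq_square)
  finally have K: "gauss_kronecker_curvature D G s (x, z) = c ^ CARD('n) * ((det A)\<^sup>2 * det (shape_mat x z))" .
  have g2: "(norm ?g)\<^sup>2 = (\<zeta>' z)\<^sup>2 * (1 + \<xi> \<bullet> \<xi>)"
    unfolding norm_gradient_split[OF z] \<xi>_def[symmetric] by (simp add: power_mult_distrib add_nonneg_nonneg)
  have "c ^ CARD('n) * norm ?g ^ CARD('n) = s ^ CARD('n)"
    using gpos by (simp add: c_def power_mult_distrib[symmetric])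
  moreover have "(det A)\<^sup>2 * (norm ?g)\<^sup>2 = (\<zeta>' z)\<^sup>2"
    using arg_cong[OF detA, of "\<lambda>t. (\<zeta>' z)\<^sup>2 * t"] by (simp add: g2 mult_ac)
  moreover have "gauss_kronecker_curvature D G s (x, z) * norm ?g ^ (CARD('n) + 2) =
      (c ^ CARD('n) * norm ?g ^ CARD('n)) * ((det A)\<^sup>2 * (norm ?g)\<^sup>2) * det (shape_mat x z)"
    unfolding K by (simp add: power_add power2_eq_square mult_ac)
  ultimately show ?thesis by simp
qed

end

text \<open>The graph of f is the case \<zeta> = id, where the rank-one correction in
  \<open>shape_mat\<close> vanishes.\<close>

lemma hess_pos_def:
  assumes f: "smooth f" and sc: "strictly_convex_function f"
  shows "pos_def (hess f x)"
proof -
  interpret split_hypersurface f "\<lambda>z. z" "\<lambda>_. 1" "\<lambda>_. 0" UNIV UNIV "\<lambda>(x, z). z - f x"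
    by unfold_locales (auto intro!: derivative_eq_intros f)
  have "pos_def (1 *\<^sub>R shape_mat x (f x))"
    using sc positive_normal_curvatures_iff[of "f x" 1 x] by (simp add: strictly_convex_function_def)
  then show ?thesis by (simp add: shape_mat_def)
qed

section \<open>The strictly convex levels of \<open>z powr \<alpha> - f x\<close>\<close>

locale power_graph =
  fixes f :: "real^'n \<Rightarrow> real" and \<alpha> :: real
  assumes f: "smooth f" and f0: "\<And>x. 0 \<le> f x" and Hpd: "\<And>x. pos_def (hess f x)"
    and a0: "\<alpha> \<noteq> 0" and a1: "\<alpha> \<noteq> 1"
begin

sublocale sh: split_hypersurface f "\<lambda>z. z powr \<alpha>" "\<lambda>z. \<alpha> * z powr (\<alpha> - 1)" "\<lambda>z. \<alpha> * ((\<alpha> - 1) * z powr (\<alpha> - 2))"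
  "{0<..}" "power_dom \<alpha>" "gfun f \<alpha>"
proof
  show "((\<lambda>z. \<alpha> * z powr (\<alpha> - 1)) has_real_derivative \<alpha> * ((\<alpha> - 1) * z powr (\<alpha> - 2))) (at z)" if "z \<in> {0<..}" for z
  proof -
    have "((\<lambda>z. z powr (\<alpha> - 1)) has_real_derivative (\<alpha> - 1) * z powr (\<alpha> - 1 - 1)) (at z)"
      using that by (intro has_real_derivative_powr) auto
    then show ?thesis by (intro DERIV_cmult) simp
  qed
qed (use a0 in \<open>auto simp: power_dom_def gfun_def f intro!: has_real_derivative_powr\<close>)

text \<open>Over a point x of \<open>pdom k\<close>, \<open>\<delta> k x\<close> is the z-derivative
  of g at the point of \<open>M\<^sub>k\<close>, and \<beta> is its exponent in k + f. The vector
  \<open>\<xi> k x\<close> is the gradient of \<open>u k\<close>, \<open>Hu k x\<close> is its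
  Hessian, and \<open>B k x\<close> is the shape matrix
  \<open>sh.shape_mat x (u k x)\<close>.\<close>

definition "\<beta> = (\<alpha> - 1) / \<alpha>"
definition "pdom k = {x. 0 < k + f x}"
definition "u k x = (k + f x) powr (1 / \<alpha>)"
definition "\<delta> k x = \<alpha> * (k + f x) powr \<beta>"
definition "\<xi> k x = grad f x /\<^sub>R \<delta> k x"
definition "B k x = hess f x - (\<beta> / (k + f x)) *\<^sub>R outer (grad f x)"
definition "Hu k x = (1 / \<delta> k x) *\<^sub>R B k x"
definition "epi k = {(x, z). x \<in> pdom k \<and> u k x \<le> z}"

lemma f_cont: "continuous_on A f"
  by (rule smooth_continuous_on[OF f])

lemma open_dom: "open (pdom k)"
  unfolding pdom_def by (intro open_Collect_less continuous_intros f_cont)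

lemma u_pos: "x \<in> pdom k \<Longrightarrow> 0 < u k x"
  by (simp add: pdom_def u_def)

lemma u_powr: "x \<in> pdom k \<Longrightarrow> u k x powr \<alpha> = k + f x"
  using a0 by (simp add: pdom_def u_def powr_powr)

lemma delta_nz: "x \<in> pdom k \<Longrightarrow> \<delta> k x \<noteq> 0"
  using a0 by (simp add: pdom_def \<delta>_def)

lemma sgn_delta: "x \<in> pdom k \<Longrightarrow> sgn (\<delta> k x) = sgn \<alpha>"
  by (simp add: pdom_def \<delta>_def sgn_mult)

lemma delta_eq: "x \<in> pdom k \<Longrightarrow> \<alpha> * u k x powr (\<alpha> - 1) = \<delta> k x"
  by (simp add: pdom_def u_def \<delta>_def powr_powr \<beta>_def)

lemma shape_mat_eq:
  assumes "x \<in> pdom k" shows "sh.shape_mat x (u k x) = B k x"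
proof -
  have w: "0 < k + f x" using assms by (simp add: pdom_def)
  have "\<alpha> * ((\<alpha> - 1) * u k x powr (\<alpha> - 2)) / (\<alpha> * u k x powr (\<alpha> - 1))\<^sup>2 = \<beta> * (u k x powr (\<alpha> - 2) / (u k x powr (\<alpha> - 1))\<^sup>2)"
    using a0 by (cases "u k x powr (\<alpha> - 1) = 0") (auto simp: \<beta>_def power2_eq_square field_simps)
  also have "u k x powr (\<alpha> - 2) / (u k x powr (\<alpha> - 1))\<^sup>2 = u k x powr (- \<alpha>)"
    using u_pos[OF assms] by (simp add: power2_eq_square powr_add[symmetric] powr_diff[symmetric])
  also have "\<dots> = 1 / (k + f x)" using u_powr[OF assms] by (simp add: powr_minus divide_inverse)
  finally show ?thesis by (simp add: sh.shape_mat_def B_def)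
qed

lemma in_Mk: "x \<in> pdom k \<Longrightarrow> (x, u k x) \<in> Mk f \<alpha> k"
  using u_pos[of x k] by (simp add: level_set_def power_dom_def gfun_def u_powr)

text \<open>The projection of \<open>M\<^sub>k\<close> to the x-space. For \<alpha> > 0 it contains
  the zeros of k + f, where the point at height 0 still belongs to \<open>power_dom\<close>.\<close>

definition "E k = (if \<alpha> < 0 then pdom k else {x. 0 \<le> k + f x})"

lemma dom_subset_E: "pdom k \<subseteq> E k" by (auto simp: E_def pdom_def)

lemma Mk_graph: "Mk f \<alpha> k = {(x, z). x \<in> E k \<and> z = u k x}"
proof -
  have "(x, z) \<in> Mk f \<alpha> k \<longleftrightarrow> x \<in> E k \<and> z = u k x" for x z
  proof
    assume *: "(x, z) \<in> Mk f \<alpha> k"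
    then have eq: "z powr \<alpha> = k + f x" and z: "if \<alpha> < 0 then 0 < z else 0 \<le> z"
      by (auto simp: level_set_def power_dom_def gfun_def)
    have "0 \<le> z" using z by (auto split: if_splits)
    have "u k x = (z powr \<alpha>) powr (1 / \<alpha>)" by (simp add: u_def eq)
    also have "\<dots> = z" using a0 \<open>0 \<le> z\<close> by (simp add: powr_powr)
    finally show "x \<in> E k \<and> z = u k x"
      using z eq powr_ge_zero[of z \<alpha>] by (auto simp: E_def pdom_def split: if_splits)
        (metis powr_gt_zero less_imp_neq)
  next
    assume *: "x \<in> E k \<and> z = u k x"
    show "(x, z) \<in> Mk f \<alpha> k"
    proof (cases "x \<in> pdom k")
      case True then show ?thesis using in_Mk * by simp
    next
      case False
      then have "\<not> \<alpha> < 0" "k + f x = 0" using * by (auto simp: E_def pdom_def split: if_splits)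
      then show ?thesis using * by (simp add: level_set_def power_dom_def gfun_def u_def)
    qed
  qed
  then show ?thesis by auto
qed

text \<open>On an open set of constancy the gradient and hence the Hessian would vanish, against
  positive definiteness.\<close>

lemma f_not_constant:
  assumes "open A" "A \<noteq> {}" shows "\<exists>x\<in>A. f x \<noteq> c"
proof (rule ccontr)
  assume "\<not> ?thesis"
  then have fc: "\<And>x. x \<in> A \<Longrightarrow> c = f x" by auto
  obtain x where x: "x \<in> A" using assms by blast
  have g: "grad f y = 0" if "y \<in> A" for y
  proof -
    have "(f has_derivative (\<lambda>_. 0)) (at y)"
      by (rule has_derivative_transform_within_open[OF has_derivative_const assms(1) that fc])
    from has_derivative_unique[OF this grad_has_derivative_real[OF f]]
    have "grad f y \<bullet> v = 0" for v by metis
    then show ?thesis by (metis inner_eq_zero_iff)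
  qed
  have "(grad f has_derivative (\<lambda>_. 0)) (at x)"
    by (rule has_derivative_transform_within_open[OF has_derivative_const assms(1) x, of 0]) (simp add: g)
  from has_derivative_unique[OF this grad_has_derivative[OF f]]
  have 1: "hess f x *v v = 0" for v by metis
  have "axis undefined 1 \<noteq> (0::real^'n)" by simp
  then show False using Hpd[of x] 1 unfolding pos_def_def by force
qed

text \<open>A nonnegative concave function on the whole space is constant.\<close>

lemma hypograph_not_closed_convex:
  assumes C: "closed C" "convex C" and hyp: "C = {(x, z). x \<in> E k \<and> z \<le> u k x}" and o: "open (E k)" and ne: "E k \<noteq> {}"
  shows False
proof -
  have u0: "0 \<le> u k x" for x by (simp add: u_def)
  \<comment> \<open>The slice of C at height 0 is all of \<open>E k\<close>, which is therefore
    closed as well as open.\<close>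
  have "E k = (\<lambda>x. (x, 0)) -` C" using u0 by (auto simp: hyp)
  then have "closed (E k)"
    using C(1) by (simp add: continuous_closed_vimage)
  then have EU: "E k = UNIV" using o ne clopen[of "E k"] by simp
  have le: "u k x \<le> u k y" for x y
  proof (rule ccontr)
    assume "\<not> u k x \<le> u k y"
    then have lt: "u k y < u k x" by simp
    have ux: "0 < u k x" using lt u0[of y] by linarith
    obtain t where t: "u k y / u k x < t" "t < 1"
      using dense[of "u k y / u k x" 1] lt ux by auto
    have t0: "0 < t" using t(1) u0[of y] ux by (metis divide_nonneg_pos le_less_trans)
    \<comment> \<open>Chosen so that y = t x + (1 - t) w. Since \<open>(w, 0)\<close> lies below the
      graph, concavity forces \<open>t * u k x \<le> u k y\<close>.\<close>
    define w where "w = (1 / (1 - t)) *\<^sub>R (y - t *\<^sub>R x)"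
    have "t *\<^sub>R (x, u k x) + (1 - t) *\<^sub>R (w, 0) \<in> C"
      using u0 t t0 by (intro convexD[OF C(2)]) (auto simp: hyp EU)
    moreover have "t *\<^sub>R (x, u k x) + (1 - t) *\<^sub>R (w, 0) = (y, t * u k x)"
      using t by (simp add: w_def)
    ultimately have "t * u k x \<le> u k y" by (simp add: hyp)
    then show False using t(1) ux by (simp add: field_simps)
  qed
  then have eq: "u k x = u k y" for x y by (simp add: antisym)
  have "k + f x = k + f y" for x y
  proof -
    have nn: "0 \<le> k + f x" "0 \<le> k + f y" using EU unfolding E_def pdom_def by (auto split: if_splits simp: set_eq_iff less_imp_le)
    have "((k + f x) powr (1 / \<alpha>)) powr \<alpha> = ((k + f y) powr (1 / \<alpha>)) powr \<alpha>"
      using eq[of x y] unfolding u_def by (rule arg_cong[where f = "\<lambda>t. t powr \<alpha>"])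
    then show ?thesis using nn a0 by (simp add: powr_powr)
  qed
  then have "\<And>x. f x = f 0" by simp
  then show False using f_not_constant[of UNIV "f 0"] by auto
qed

lemma DERIV_unique_ray:
  fixes g :: "real \<Rightarrow> real"
  assumes "(g has_real_derivative a) (at 0 within {0..})" "(g has_real_derivative b) (at 0 within {0..})"
  shows "a = b"
proof -
  have "at_right (0::real) \<le> at 0 within {0..}" by (rule at_le) auto
  then have "at (0::real) within {0..} \<noteq> bot"
    using trivial_limit_at_right_real[of "0::real"] by (metis bot.extremum_uniqueI)
  then show ?thesis by (rule has_field_derivative_unique[OF assms])
qed

text \<open>At height 0 only one-sided vertical paths stay in the domain. Horizontal rays identify
  the x-part of v with - grad f x = 0. On the vertical ray the difference quotient is
  \<open>s powr (\<alpha> - 1)\<close>, which tends to 0 for \<alpha> > 1 and diverges for \<alpha>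
  < 1.\<close>

lemma critical_at_zero:
  assumes a: "0 < \<alpha>" and g: "grad f x = 0"
    and d: "(gfun f \<alpha> has_derivative (\<lambda>w. v \<bullet> w)) (at (x, 0) within power_dom \<alpha>)"
  shows "v = 0"
proof -
  have path: "((\<lambda>s. gfun f \<alpha> ((x, 0) + s *\<^sub>R w)) has_derivative (\<lambda>s. v \<bullet> (s *\<^sub>R w))) (at 0 within {0..})"
    if w: "0 \<le> snd w" for w :: "'n pt"
  proof -
    have "(\<lambda>s. (x, 0) + s *\<^sub>R w) ` {0..} \<subseteq> power_dom \<alpha>"
      using a w by (cases w) (auto simp: power_dom_def)
    then show ?thesis
      by (intro has_derivative_in_compose[of "\<lambda>s. (x, 0) + s *\<^sub>R w" "\<lambda>s. s *\<^sub>R w" 0 "{0..}" "gfun f \<alpha>"])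
        (auto intro!: derivative_eq_intros has_derivative_subset[OF d])
  qed
  have path': "((\<lambda>s. gfun f \<alpha> ((x, 0) + s *\<^sub>R w)) has_real_derivative v \<bullet> w) (at 0 within {0..})"
    if w: "0 \<le> snd w" for w :: "'n pt"
  proof -
    have "(\<lambda>s. v \<bullet> (s *\<^sub>R w)) = (*) (v \<bullet> w)" by (auto simp: mult.commute)
    then show ?thesis using path[OF w] by (simp only: has_field_derivative_def)
  qed
  have "fst v = 0"
  proof -
    have "fst v \<bullet> e = 0" for e
    proof -
      have "((\<lambda>s. gfun f \<alpha> ((x, 0) + s *\<^sub>R (e, 0))) has_real_derivative v \<bullet> (e, 0)) (at 0 within {0..})"
        by (rule path') simp
      then have "((\<lambda>s. - f (x + s *\<^sub>R e)) has_real_derivative fst v \<bullet> e) (at 0 within {0..})"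
        using a by (simp add: gfun_def inner_prod_def)
      moreover have "((\<lambda>s. - f (x + s *\<^sub>R e)) has_real_derivative - dir e f (x + 0 *\<^sub>R e)) (at 0 within {0..})"
        by (intro DERIV_minus dir_line f)
      ultimately have "fst v \<bullet> e = - dir e f (x + 0 *\<^sub>R e)"
        using DERIV_unique_ray by blast
      then show ?thesis by (simp add: dir_eq_grad[OF f] g)
    qed
    then show ?thesis by (metis inner_eq_zero_iff)
  qed
  moreover have "snd v = 0"
  proof -
    have "((\<lambda>s. gfun f \<alpha> ((x, 0) + s *\<^sub>R (0, 1))) has_real_derivative v \<bullet> (0, 1)) (at 0 within {0..})"
      by (rule path') simp
    then have "((\<lambda>s. s powr \<alpha> - f x) has_real_derivative snd v) (at 0 within {0..})"
      by (simp add: gfun_def inner_prod_def)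
    then have "((\<lambda>s. s powr \<alpha> / s) \<longlongrightarrow> snd v) (at 0 within {0..})"
      using a by (simp add: has_field_derivative_iff)
    then have "((\<lambda>s. s powr \<alpha> / s) \<longlongrightarrow> snd v) (at_right 0)"
      by (rule tendsto_within_subset) auto
    then have lim: "((\<lambda>s. s powr (\<alpha> - 1)) \<longlongrightarrow> snd v) (at_right 0)"
      by (rule Lim_transform_eventually) (auto simp: eventually_at_filter powr_diff)
    show ?thesis
    proof (cases "\<alpha> < 1")
      case True
      have "filterlim (\<lambda>s::real. s powr (\<alpha> - 1)) at_infinity (at_right 0)"
        using True by (intro filterlim_at_top_imp_at_infinity) real_asymp
      then show ?thesis using lim not_tendsto_and_filterlim_at_infinity[OF _ lim] by simp
    next
      case False
      have "((\<lambda>s::real. s powr (\<alpha> - 1)) \<longlongrightarrow> 0) (at_right 0)"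
        using False a1 by real_asymp
      then show ?thesis using tendsto_unique[OF _ lim] by simp
    qed
  qed
  ultimately show "v = 0" by (simp add: prod_eq_iff)
qed

text \<open>A zero of the nonnegative function k + f is a minimum of f, and the point of the level
  over it, at height 0, would be critical.\<close>

lemma regular_imp_pos:
  assumes k: "k \<in> Rg f \<alpha>" and E: "E k = UNIV" shows "pdom k = UNIV"
proof (rule ccontr)
  assume "pdom k \<noteq> UNIV"
  then have a: "0 < \<alpha>" using E a0 by (auto simp: E_def split: if_splits)
  have nn: "0 \<le> k + f x" for x using E a by (auto simp: E_def)
  obtain x where "\<not> 0 < k + f x" using \<open>pdom k \<noteq> UNIV\<close> by (auto simp: pdom_def)
  then have x: "k + f x = 0" using nn[of x] by linarith
  have min: "f x \<le> f y" for y using nn[of y] x by simp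
  have "grad f x = 0"
  proof -
    have "(\<lambda>w. grad f x \<bullet> w) = (\<lambda>w. 0)"
      using min by (intro has_derivative_local_min[OF grad_has_derivative_real[OF f]]) auto
    then show ?thesis by (metis inner_eq_zero_iff)
  qed
  moreover have "(x, 0) \<in> Mk f \<alpha> k"
    using x a by (simp add: level_set_def power_dom_def gfun_def)
  then obtain v where "v \<noteq> 0" "(gfun f \<alpha> has_derivative (\<lambda>w. v \<bullet> w)) (at (x, 0) within power_dom \<alpha>)"
    using k by (auto simp: regular_values_def)
  ultimately show False using critical_at_zero[OF a] by blast
qed

text \<open>The hypograph is excluded by \<open>hypograph_not_closed_convex\<close>. For \<alpha> >
  0 the set \<open>E k\<close> is closed by its definition and open by
  \<open>graph_bounding_convex_set\<close>, hence the whole space, and regularity removes the zeros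
  of k + f.\<close>

lemma bounds_convex_imp_epi:
  assumes k: "k \<in> Rg f \<alpha>" and M: "Mk f \<alpha> k \<noteq> {}" and C: "bounds_convex (Mk f \<alpha> k) C"
  shows "C = epi k" "convex (pdom k)" "pdom k \<noteq> {}" "0 < \<alpha> \<Longrightarrow> pdom k = UNIV"
proof -
  have C': "closed C" "convex C" "interior C \<noteq> {}" "frontier C = {(x, z). x \<in> E k \<and> z = u k x}"
    using C by (auto simp: bounds_convex_def Mk_graph)
  have ne: "E k \<noteq> {}" using M by (auto simp: Mk_graph)
  note g = graph_bounding_convex_set[OF C' ne]
  have Cepi: "C = {(x, z). x \<in> E k \<and> u k x \<le> z}"
    using g(3) hypograph_not_closed_convex[OF C'(1,2) _ g(1) ne] by blast
  have dE: "pdom k = E k \<and> (0 < \<alpha> \<longrightarrow> pdom k = UNIV)"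
  proof (cases "\<alpha> < 0")
    case False
    have "closed {x. 0 \<le> k + f x}" by (intro closed_Collect_le continuous_intros f_cont)
    then have "closed (E k)" using False by (simp add: E_def)
    then have "E k = UNIV" using g(1) ne clopen[of "E k"] by simp
    then show ?thesis using regular_imp_pos[OF k] by simp
  qed (simp add: E_def)
  show "C = epi k" "convex (pdom k)" "pdom k \<noteq> {}" "0 < \<alpha> \<Longrightarrow> pdom k = UNIV"
    using Cepi dE g(2) ne by (auto simp: epi_def)
qed

lemma u_line:
  assumes "x + s *\<^sub>R v \<in> pdom k"
  shows "((\<lambda>s. u k (x + s *\<^sub>R v)) has_real_derivative \<xi> k (x + s *\<^sub>R v) \<bullet> v) (at s)"
proof -
  let ?y = "x + s *\<^sub>R v"
  have w: "0 < k + f ?y" using assms by (simp add: pdom_def)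
  have "((\<lambda>s. (k + f (x + s *\<^sub>R v)) powr (1 / \<alpha>)) has_real_derivative
     (1 / \<alpha>) * (k + f ?y) powr (1 / \<alpha> - 1) * (0 + dir v f ?y)) (at s)"
    using DERIV_fun_powr[OF DERIV_add[OF DERIV_const dir_line[OF f]] w, of "1 / \<alpha>"] by simp
  moreover have "(1 / \<alpha>) * (k + f ?y) powr (1 / \<alpha> - 1) * (0 + dir v f ?y) = \<xi> k ?y \<bullet> v"
  proof -
    have "1 / \<alpha> - 1 = - \<beta>" using a0 by (simp add: \<beta>_def field_simps)
    then show ?thesis by (simp add: \<xi>_def \<delta>_def dir_eq_grad[OF f] powr_minus divide_inverse mult_ac)
  qed
  ultimately show ?thesis by (simp add: u_def)
qed

lemma slope_line:
  assumes "x + s *\<^sub>R v \<in> pdom k"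
  shows "((\<lambda>s. \<xi> k (x + s *\<^sub>R v) \<bullet> v) has_real_derivative v \<bullet> (Hu k (x + s *\<^sub>R v) *v v)) (at s)"
proof -
  let ?y = "x + s *\<^sub>R v"
  have w: "0 < k + f ?y" using assms by (simp add: pdom_def)
  have eq: "\<xi> k y \<bullet> v = (1 / \<alpha>) * ((k + f y) powr (- \<beta>) * dir v f y)" for y
    by (simp add: \<xi>_def \<delta>_def dir_eq_grad[OF f] powr_minus divide_inverse mult_ac)
  have 1: "((\<lambda>s. (k + f (x + s *\<^sub>R v)) powr (- \<beta>)) has_real_derivative
     - \<beta> * (k + f ?y) powr (- \<beta> - 1) * (0 + dir v f ?y)) (at s)"
    using DERIV_fun_powr[OF DERIV_add[OF DERIV_const dir_line[OF f]] w, of "- \<beta>"] by simp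
  have "((\<lambda>s. (1 / \<alpha>) * ((k + f (x + s *\<^sub>R v)) powr (- \<beta>) * dir v f (x + s *\<^sub>R v))) has_real_derivative
     (1 / \<alpha>) * ((- \<beta> * (k + f ?y) powr (- \<beta> - 1) * (0 + dir v f ?y)) * dir v f ?y + dir v (dir v f) ?y * (k + f ?y) powr (- \<beta>))) (at s)"
    by (intro DERIV_cmult DERIV_mult 1 dir_line smooth_dir f)
  moreover have "(1 / \<alpha>) * ((- \<beta> * (k + f ?y) powr (- \<beta> - 1) * (0 + dir v f ?y)) * dir v f ?y + dir v (dir v f) ?y * (k + f ?y) powr (- \<beta>))
     = v \<bullet> (Hu k ?y *v v)"
  proof -
    have p: "(k + f ?y) powr (- \<beta> - 1) = (k + f ?y) powr (- \<beta>) / (k + f ?y)"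
      using w by (simp add: powr_diff)
    have "v \<bullet> (Hu k ?y *v v) = (1 / \<alpha>) * (k + f ?y) powr (- \<beta>) * (dir v (dir v f) ?y - \<beta> / (k + f ?y) * (dir v f ?y * dir v f ?y))"
      by (simp add: Hu_def \<delta>_def B_def scaleR_matrix_vector_assoc[symmetric] matrix_vector_mult_diff_rdistrib inner_diff_right
         dir_dir_eq_hess[OF f] dir_eq_grad[OF f] powr_minus divide_inverse mult_ac inner_commute[of v "grad f _"])
    then show ?thesis unfolding p by (simp add: algebra_simps)
  qed
  ultimately show ?thesis unfolding eq by simp
qed

end

text \<open>Maximal intervals are not unique in general; they are when the whole set is an interval,
  which is how \<open>S\<close> and \<open>I k\<close> get determined.\<close>

lemma maximal_interval_Collect:
  "maximal_interval P J \<Longrightarrow> is_interval {k. P k} \<Longrightarrow> J = {k. P k}"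
  unfolding maximal_interval_def by blast

section \<open>Convex sides and inward normals of the levels\<close>

context power_graph
begin

lemma u_cont: "continuous_on (pdom k) (u k)"
  unfolding u_def by (intro continuous_intros f_cont) (auto simp: pdom_def)

lemma B_form: "v \<bullet> (B k x *v v) = v \<bullet> (hess f x *v v) - \<beta> / (k + f x) * (grad f x \<bullet> v)\<^sup>2"
  by (simp add: B_def matrix_vector_mult_diff_rdistrib scaleR_matrix_vector_assoc[symmetric] inner_diff_right
      power2_eq_square inner_commute[of v "grad f x"])

lemma B_sym: "transpose (B k x) = B k x"
  using hess_sym[OF f, of x] by (simp add: B_def transpose_def vec_eq_iff outer_def mult.commute)

lemma pos_def_sgn_iff: "pos_def (s *\<^sub>R B k x) \<longleftrightarrow> (\<forall>v. v \<noteq> 0 \<longrightarrow> 0 < s * (v \<bullet> (B k x *v v)))"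
proof -
  have "transpose (s *\<^sub>R B k x) = s *\<^sub>R B k x"
    using B_sym[of k x] by (simp add: transpose_def vec_eq_iff)
  then show ?thesis by (simp add: pos_def_def scaleR_matrix_vector_assoc[symmetric])
qed

lemma Hu_pos_def:
  assumes x: "x \<in> pdom k" and pd: "pos_def (sgn \<alpha> *\<^sub>R B k x)"
  shows "pos_def (Hu k x)"
proof -
  have "0 < (1 / \<delta> k x) * (v \<bullet> (B k x *v v))" if "v \<noteq> 0" for v
  proof -
    have "0 < sgn \<alpha> * (v \<bullet> (B k x *v v))" using pd that by (simp add: pos_def_sgn_iff)
    then have "0 < \<bar>1 / \<delta> k x\<bar> * (sgn \<alpha> * (v \<bullet> (B k x *v v)))" using delta_nz[OF x] by simp
    moreover have "\<bar>1 / \<delta> k x\<bar> * sgn \<alpha> = 1 / \<delta> k x"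
      using sgn_delta[OF x, symmetric] by (simp add: sgn_if)
    ultimately show ?thesis by (simp only: mult.assoc[symmetric])
  qed
  then show ?thesis unfolding Hu_def pos_def_sgn_iff by blast
qed

lemma convex_on_u:
  assumes c: "convex (pdom k)" and pd: "\<And>x. x \<in> pdom k \<Longrightarrow> pos_def (sgn \<alpha> *\<^sub>R B k x)"
  shows "convex_on (pdom k) (u k)"
proof (rule convex_onI[OF _ c])
  fix t :: real and x y :: "real^'n" assume t: "0 < t" "t < 1" and xy: "x \<in> pdom k" "y \<in> pdom k"
  have seg: "x + s *\<^sub>R (y - x) \<in> pdom k" if "s \<in> {0..1}" for s
  proof -
    have "(1 - s) *\<^sub>R x + s *\<^sub>R y \<in> pdom k" using that xy by (intro convexD[OF c]) auto
    then show ?thesis by (simp add: algebra_simps)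
  qed
  have "convex_on {0..1} (\<lambda>s. u k (x + s *\<^sub>R (y - x)))"
  proof (rule f''_ge0_imp_convex)
    fix s :: real assume s: "s \<in> {0..1}"
    note u_line[OF seg[OF s]] slope_line[OF seg[OF s]]
    then show "((\<lambda>s. u k (x + s *\<^sub>R (y - x))) has_real_derivative \<xi> k (x + s *\<^sub>R (y - x)) \<bullet> (y - x)) (at s)"
      "((\<lambda>s. \<xi> k (x + s *\<^sub>R (y - x)) \<bullet> (y - x)) has_real_derivative (y - x) \<bullet> (Hu k (x + s *\<^sub>R (y - x)) *v (y - x))) (at s)"
      by auto
    show "0 \<le> (y - x) \<bullet> (Hu k (x + s *\<^sub>R (y - x)) *v (y - x))"
      using Hu_pos_def[OF seg[OF s] pd[OF seg[OF s]]] unfolding pos_def_def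
      by (cases "y - x = 0") (auto intro: less_imp_le)
  qed simp
  from convex_onD[OF this, of t 0 1] t
  have "u k (x + t *\<^sub>R (y - x)) \<le> (1 - t) * u k x + t * u k y" by simp
  then show "u k ((1 - t) *\<^sub>R x + t *\<^sub>R y) \<le> (1 - t) * u k x + t * u k y" by (simp add: algebra_simps)
qed

text \<open>For \<alpha> < 0 the domain of \<open>u k\<close> may have a boundary, but u tends to
  infinity there, so no sequence in the epigraph converges to a point above it.\<close>

lemma closed_epi:
  assumes U: "0 < \<alpha> \<longrightarrow> pdom k = UNIV"
  shows "closed (epi k)"
proof (cases "0 < \<alpha>")
  case True
  have "closed {p. u k (fst p) \<le> snd p}"
    by (intro closed_Collect_le continuous_intros continuous_on_compose2[OF u_cont[of k]]) (use U True in auto)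
  moreover have "epi k = {p. u k (fst p) \<le> snd p}" using U True by (auto simp: epi_def)
  ultimately show ?thesis by simp
next
  case False
  then have a: "\<alpha> < 0" using a0 by simp
  show ?thesis unfolding closed_sequential_limits
  proof (intro allI impI)
    fix p l assume *: "(\<forall>n. p n \<in> epi k) \<and> p \<longlonglongrightarrow> l"
    define x where "x = fst l" define z where "z = snd l"
    have px: "(\<lambda>n. fst (p n)) \<longlonglongrightarrow> x" and pz: "(\<lambda>n. snd (p n)) \<longlonglongrightarrow> z"
      using * by (auto simp: x_def z_def intro: tendsto_intros)
    have fx: "(\<lambda>n. k + f (fst (p n))) \<longlonglongrightarrow> k + f x"
      by (intro tendsto_add tendsto_const isCont_tendsto_compose[OF smooth_isCont[OF f] px])
    have pn: "0 < k + f (fst (p n))" "(k + f (fst (p n))) powr (1 / \<alpha>) \<le> snd (p n)" for n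
      using * by (auto simp: epi_def pdom_def u_def case_prod_beta)
    have "0 \<le> k + f x" using LIMSEQ_le_const[OF fx] pn(1) by (meson less_imp_le)
    \<comment> \<open>The values of k + f are eventually below this bound. That keeps the heights of
      the sequence away from 0 and allows passing to the limit in
      \<open>z powr \<alpha>\<close>.\<close>
    then have M: "0 < k + f x + 1" by simp
    have "\<forall>\<^sub>F n in sequentially. k + f (fst (p n)) < k + f x + 1"
      using order_tendstoD(2)[OF fx, of "k + f x + 1"] by simp
    then have "\<forall>\<^sub>F n in sequentially. (k + f x + 1) powr (1 / \<alpha>) \<le> snd (p n)"
    proof eventually_elim
      case (elim n)
      have "(k + f x + 1) powr (1 / \<alpha>) \<le> (k + f (fst (p n))) powr (1 / \<alpha>)"
        using a elim pn(1)[of n] by (intro powr_mono2') auto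
      then show ?case using pn(2)[of n] by linarith
    qed
    then have "(k + f x + 1) powr (1 / \<alpha>) \<le> z"
      by (rule tendsto_lowerbound[OF pz]) simp
    moreover have "0 < (k + f x + 1) powr (1 / \<alpha>)" using M by simp
    ultimately have z: "0 < z" by linarith
    have "snd (p n) powr \<alpha> \<le> k + f (fst (p n))" for n
    proof -
      have "snd (p n) powr \<alpha> \<le> ((k + f (fst (p n))) powr (1 / \<alpha>)) powr \<alpha>"
        using a pn[of n] by (intro powr_mono2') auto
      then show ?thesis using pn(1)[of n] a0 by (simp add: powr_powr)
    qed
    moreover have "(\<lambda>n. snd (p n) powr \<alpha>) \<longlonglongrightarrow> z powr \<alpha>"
      using z by (intro tendsto_intros pz) auto
    ultimately have le: "z powr \<alpha> \<le> k + f x" using LIMSEQ_le[OF _ fx] by blast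
    then have w: "0 < k + f x" using z by (metis less_le_trans powr_gt_zero less_irrefl)
    have "(k + f x) powr (1 / \<alpha>) \<le> (z powr \<alpha>) powr (1 / \<alpha>)"
      using a le z by (intro powr_mono2') auto
    also have "\<dots> = z" using z a0 by (simp add: powr_powr)
    finally show "l \<in> epi k" using w by (simp add: epi_def pdom_def u_def x_def z_def case_prod_beta)
  qed
qed

lemma interior_epi: "interior (epi k) = {(x, z). x \<in> pdom k \<and> u k x < z}"
  unfolding epi_def by (rule interior_epigraph[OF open_dom u_cont])

lemma E_eq: "(0 < \<alpha> \<longrightarrow> pdom k = UNIV) \<Longrightarrow> E k = pdom k"
  using dom_subset_E[of k] a0 by (auto simp: E_def)

lemma bounds_convex_epi:
  assumes c: "convex (pdom k)" and ne: "pdom k \<noteq> {}" and U: "0 < \<alpha> \<longrightarrow> pdom k = UNIV"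
    and pd: "\<And>x. x \<in> pdom k \<Longrightarrow> pos_def (sgn \<alpha> *\<^sub>R B k x)"
  shows "bounds_convex (Mk f \<alpha> k) (epi k)"
proof -
  note cu = convex_on_u[OF c pd]
  have "convex (epi k)"
  proof (rule convexI)
    fix p q and a b :: real assume *: "p \<in> epi k" "q \<in> epi k" "0 \<le> a" "0 \<le> b" "a + b = 1"
    obtain x z y w where pq: "p = (x, z)" "q = (y, w)" by fastforce
    have xy: "x \<in> pdom k" "y \<in> pdom k" "u k x \<le> z" "u k y \<le> w" using * pq by (auto simp: epi_def)
    have "u k (a *\<^sub>R x + b *\<^sub>R y) \<le> a * u k x + b * u k y"
      using cu * xy by (auto simp: convex_on_def)
    also have "\<dots> \<le> a * z + b * w" using * xy by (intro add_mono mult_left_mono) auto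
    finally show "a *\<^sub>R p + b *\<^sub>R q \<in> epi k" using convexD[OF c xy(1,2) *(3,4,5)] by (simp add: pq epi_def)
  qed
  moreover have "interior (epi k) \<noteq> {}"
  proof -
    obtain x where "x \<in> pdom k" using ne by blast
    then have "(x, u k x + 1) \<in> interior (epi k)" by (simp add: interior_epi)
    then show ?thesis by blast
  qed
  moreover have "frontier (epi k) = Mk f \<alpha> k"
    unfolding frontier_def closure_closed[OF closed_epi[OF U]] interior_epi Mk_graph E_eq[OF U]
    by (auto simp: epi_def)
  ultimately show ?thesis using closed_epi[OF U] by (simp add: bounds_convex_def)
qed

lemma convex_side_eq_epi:
  assumes k: "k \<in> Rg f \<alpha>" and c: "convex_hypersurface (Mk f \<alpha> k)"
  shows "convex_side (Mk f \<alpha> k) = epi k" "bounds_convex (Mk f \<alpha> k) (epi k)"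
proof -
  have M: "Mk f \<alpha> k \<noteq> {}" using c by (simp add: convex_hypersurface_def)
  obtain C where C: "bounds_convex (Mk f \<alpha> k) C" using c by (auto simp: convex_hypersurface_def)
  note e = bounds_convex_imp_epi(1)[OF k M]
  show b: "bounds_convex (Mk f \<alpha> k) (epi k)" using e[OF C] C by simp
  show "convex_side (Mk f \<alpha> k) = epi k" unfolding convex_side_def
    using b e by (intro the_equality)
qed

text \<open>The value of g increases along its gradient. At positive height z,
  \<open>k + f y < z powr \<alpha>\<close> means lying above the graph for \<alpha> > 0; for
  \<alpha> < 0 it means lying below the graph or outside its domain.\<close>

lemma inward_sign_eq:
  assumes C: "convex_side (Mk f \<alpha> k) = epi k" and U: "0 < \<alpha> \<longrightarrow> pdom k = UNIV" and x: "x \<in> pdom k"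
  shows "inward_sign (power_dom \<alpha>) (gfun f \<alpha>) (Mk f \<alpha> k) (x, u k x) = sgn \<alpha>"
proof -
  define p where "p = (x, u k x)"
  define g where "g = grad_g f \<alpha> p"
  have ux: "0 < u k x" by (rule u_pos[OF x])
  have g0: "0 < g \<bullet> g" using sh.gradient_nz[of "u k x" x] ux by (simp add: g_def p_def)
  have gx: "gfun f \<alpha> (p + 0 *\<^sub>R g) = k" using u_powr[OF x] by (simp add: p_def gfun_def)
  have "((\<lambda>t. gfun f \<alpha> (p + t *\<^sub>R g)) has_derivative (\<lambda>t. g \<bullet> (t *\<^sub>R g))) (at 0)"
  proof (rule has_derivative_compose[where f = "\<lambda>t. p + t *\<^sub>R g" and g = "gfun f \<alpha>"])
    show "(gfun f \<alpha> has_derivative (\<bullet>) g) (at (p + 0 *\<^sub>R g))"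
      using sh.G_has_derivative[of "u k x" x] sh.gradient_split[of "u k x" x] ux by (simp add: g_def p_def)
  qed (auto intro!: derivative_eq_intros)
  moreover have "(\<lambda>t. g \<bullet> (t *\<^sub>R g)) = (*) (g \<bullet> g)" by (auto simp: mult.commute)
  ultimately have "((\<lambda>t. gfun f \<alpha> (p + t *\<^sub>R g)) has_real_derivative g \<bullet> g) (at 0)"
    by (simp only: has_field_derivative_def)
  from DERIV_pos_inc_right[OF this g0] obtain d1 where d1: "d1 > 0" "\<And>t. 0 < t \<Longrightarrow> t < d1 \<Longrightarrow> k < gfun f \<alpha> (p + t *\<^sub>R g)"
    unfolding gx by auto
  have "((\<lambda>t. snd (p + t *\<^sub>R g)) \<longlongrightarrow> snd (p + 0 *\<^sub>R g)) (at_right 0)"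
    by (intro tendsto_intros)
  then have "\<forall>\<^sub>F t in at_right 0. 0 < snd (p + t *\<^sub>R g)"
    by (rule order_tendstoD) (simp add: p_def ux)
  then obtain d2 where d2: "d2 > 0" "\<And>t. 0 < t \<Longrightarrow> t < d2 \<Longrightarrow> 0 < snd (p + t *\<^sub>R g)"
    by (auto simp: eventually_at_right[of 0 1])
  define d where "d = min d1 d2"
  have d: "d > 0" using d1 d2 by (simp add: d_def)
  have int: "p + t *\<^sub>R g \<in> interior (epi k) \<longleftrightarrow> 0 < \<alpha>" if t: "0 < t" "t < d" for t
  proof -
    obtain y z where yz: "p + t *\<^sub>R g = (y, z)" by fastforce
    have z: "0 < z" "k + f y < z powr \<alpha>" using d1(2)[of t] d2(2)[of t] t yz by (auto simp: d_def gfun_def)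
    show ?thesis
    proof (cases "0 < \<alpha>")
      case True
      then have y: "y \<in> pdom k" using U by simp
      then have "u k y < (z powr \<alpha>) powr (1 / \<alpha>)" unfolding u_def
        using z True by (intro powr_less_mono2) (auto simp: pdom_def)
      then show ?thesis using True y z a0 yz by (simp add: interior_epi powr_powr)
    next
      case False
      have "\<not> (y \<in> pdom k \<and> u k y < z)"
      proof
        assume *: "y \<in> pdom k \<and> u k y < z"
        then have "z powr \<alpha> < u k y powr \<alpha>"
          using False a0 u_pos[of y k] by (intro powr_less_mono2_neg) auto
        then show False using * z u_powr[of y k] by simp
      qed
      then show ?thesis using False yz by (simp add: interior_epi)
    qed
  qed
  show ?thesis
  proof (cases "0 < \<alpha>")
    case True
    then have "\<exists>e>0. \<forall>t. 0 < t \<and> t < e \<longrightarrow> p + t *\<^sub>R g \<in> interior (epi k)" using int d by blast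
    then show ?thesis using True by (simp add: inward_sign_def C p_def g_def)
  next
    case False
    have "\<not> (\<exists>e>0. \<forall>t. 0 < t \<and> t < e \<longrightarrow> p + t *\<^sub>R g \<in> interior (epi k))"
    proof
      assume "\<exists>e>0. \<forall>t. 0 < t \<and> t < e \<longrightarrow> p + t *\<^sub>R g \<in> interior (epi k)"
      then obtain e where e: "e > 0" "\<forall>t. 0 < t \<and> t < e \<longrightarrow> p + t *\<^sub>R g \<in> interior (epi k)" by blast
      have "0 < min d e / 2" "min d e / 2 < d" "min d e / 2 < e" using d e(1) by auto
      then show False using int e(2) False by blast
    qed
    then show ?thesis using False a0 by (simp add: inward_sign_def C p_def g_def)
  qed
qed

definition "good k \<longleftrightarrow> k \<in> Rg f \<alpha> \<and> strictly_convex_level (power_dom \<alpha>) (gfun f \<alpha>) k"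

lemma goodD:
  assumes "good k"
  shows "convex_side (Mk f \<alpha> k) = epi k" "bounds_convex (Mk f \<alpha> k) (epi k)"
    "convex (pdom k)" "pdom k \<noteq> {}" "0 < \<alpha> \<longrightarrow> pdom k = UNIV"
    "\<And>x. x \<in> pdom k \<Longrightarrow> inward_sign (power_dom \<alpha>) (gfun f \<alpha>) (Mk f \<alpha> k) (x, u k x) = sgn \<alpha>"
    "\<And>x. x \<in> pdom k \<Longrightarrow> pos_def (sgn \<alpha> *\<^sub>R B k x)"
    "Mk f \<alpha> k = {(x, z). x \<in> pdom k \<and> z = u k x}"
proof -
  have k: "k \<in> Rg f \<alpha>" and ch: "convex_hypersurface (Mk f \<alpha> k)"
    and pc: "\<And>p. p \<in> Mk f \<alpha> k \<Longrightarrow> positive_normal_curvatures (power_dom \<alpha>) (gfun f \<alpha>) (inward_sign (power_dom \<alpha>) (gfun f \<alpha>) (Mk f \<alpha> k) p) p"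
    using assms by (auto simp: good_def strictly_convex_level_def Let_def)
  have M: "Mk f \<alpha> k \<noteq> {}" using ch by (simp add: convex_hypersurface_def)
  note cs = convex_side_eq_epi[OF k ch]
  show C: "convex_side (Mk f \<alpha> k) = epi k" by (rule cs)
  show b: "bounds_convex (Mk f \<alpha> k) (epi k)" by (rule cs)
  show "convex (pdom k)" "pdom k \<noteq> {}" using bounds_convex_imp_epi[OF k M b] by auto
  show U: "0 < \<alpha> \<longrightarrow> pdom k = UNIV" using bounds_convex_imp_epi[OF k M b] by auto
  show inw: "inward_sign (power_dom \<alpha>) (gfun f \<alpha>) (Mk f \<alpha> k) (x, u k x) = sgn \<alpha>" if "x \<in> pdom k" for x
    using C U that by (rule inward_sign_eq)
  show "pos_def (sgn \<alpha> *\<^sub>R B k x)" if x: "x \<in> pdom k" for x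
    using pc[OF in_Mk[OF x]] sh.positive_normal_curvatures_iff[of "u k x" "sgn \<alpha>" x] u_pos[OF x]
    by (simp add: inw[OF x] shape_mat_eq[OF x])
  show "Mk f \<alpha> k = {(x, z). x \<in> pdom k \<and> z = u k x}" by (simp add: Mk_graph E_eq[OF U])
qed

lemma goodI:
  assumes c: "convex (pdom k)" and ne: "pdom k \<noteq> {}" and U: "0 < \<alpha> \<longrightarrow> pdom k = UNIV"
    and pd: "\<And>x. x \<in> pdom k \<Longrightarrow> pos_def (sgn \<alpha> *\<^sub>R B k x)"
  shows "good k"
proof -
  have M: "Mk f \<alpha> k = {(x, z). x \<in> pdom k \<and> z = u k x}" by (simp add: Mk_graph E_eq[OF U])
  have k: "k \<in> Rg f \<alpha>"
  proof -
    have "\<exists>v. v \<noteq> 0 \<and> (gfun f \<alpha> has_derivative (\<lambda>w. v \<bullet> w)) (at (x, u k x) within power_dom \<alpha>)" if x: "x \<in> pdom k" for x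
      using sh.gradient_nz[of "u k x" x] sh.G_has_derivative[of "u k x" x] u_pos[OF x]
      by (intro exI[of _ "grad_g f \<alpha> (x, u k x)"]) (auto simp: sh.gradient_split intro: has_derivative_at_withinI)
    then show ?thesis by (auto simp: regular_values_def M)
  qed
  have b: "bounds_convex (Mk f \<alpha> k) (epi k)" by (rule bounds_convex_epi[OF assms])
  have ch: "convex_hypersurface (Mk f \<alpha> k)"
    using b ne by (auto simp: convex_hypersurface_def M)
  note C = convex_side_eq_epi(1)[OF k ch]
  have "positive_normal_curvatures (power_dom \<alpha>) (gfun f \<alpha>) (inward_sign (power_dom \<alpha>) (gfun f \<alpha>) (Mk f \<alpha> k) p) p"
    if "p \<in> Mk f \<alpha> k" for p
  proof -
    obtain x where x: "p = (x, u k x)" "x \<in> pdom k" using \<open>p \<in> Mk f \<alpha> k\<close> by (auto simp: M)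
    show ?thesis unfolding x(1) inward_sign_eq[OF C U x(2)]
      using sh.positive_normal_curvatures_iff[of "u k x" "sgn \<alpha>" x] u_pos[OF x(2)] pd[OF x(2)]
      by (simp add: shape_mat_eq[OF x(2)])
  qed
  then show ?thesis using k ch by (simp add: good_def strictly_convex_level_def Let_def)
qed

end

section \<open>The admissible levels and their nesting\<close>

context power_graph
begin

lemma f_above_tangent: "f x + grad f x \<bullet> (y - x) \<le> f y"
proof -
  let ?v = "y - x"
  have "dir ?v f (x + 0 *\<^sub>R ?v) * (1 - 0) \<le> f (x + 1 *\<^sub>R ?v) - f (x + 0 *\<^sub>R ?v)"
  proof (rule f''_imp_f'[of "UNIV" _ _ "\<lambda>s. dir ?v (dir ?v f) (x + s *\<^sub>R ?v)"])
    show "0 \<le> dir ?v (dir ?v f) (x + s *\<^sub>R ?v)" for s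
      using Hpd[of "x + s *\<^sub>R ?v"] unfolding dir_dir_eq_hess[OF f] pos_def_def
      by (cases "?v = 0") (auto intro: less_imp_le)
  qed (auto intro: dir_line smooth_dir f)
  then show ?thesis by (simp add: dir_eq_grad[OF f])
qed

lemma ex_grad_nz: "\<exists>x. grad f x \<noteq> 0"
proof (rule ccontr)
  assume "\<not> ?thesis"
  then have "f x \<le> f y" for x y using f_above_tangent[of x y] by simp
  then have "f x = f 0" for x by (simp add: antisym)
  then show False using f_not_constant[of UNIV "f 0"] by auto
qed

text \<open>A supporting hyperplane at a noncritical point is already unbounded above.\<close>

lemma f_unbounded: "\<exists>x. M < f x"
proof -
  obtain x0 where g: "grad f x0 \<noteq> 0" using ex_grad_nz by blast
  define s where "s = (\<bar>M\<bar> + 1) / (grad f x0 \<bullet> grad f x0)"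
  have "f x0 + grad f x0 \<bullet> (s *\<^sub>R grad f x0) \<le> f (x0 + s *\<^sub>R grad f x0)"
    using f_above_tangent[of x0 "x0 + s *\<^sub>R grad f x0"] by simp
  moreover have "grad f x0 \<bullet> (s *\<^sub>R grad f x0) = \<bar>M\<bar> + 1" using g by (simp add: s_def)
  ultimately show ?thesis using f0[of x0] by (intro exI[of _ "x0 + s *\<^sub>R grad f x0"]) linarith
qed

lemma beta_pos: "\<alpha> < 0 \<Longrightarrow> 0 < \<beta>"
  by (simp add: \<beta>_def divide_simps)

text \<open>Raising k shrinks the rank-one correction in \<open>B_form\<close> when \<beta> > 0; for
  \<beta> \<le> 0 the correction only adds to the positive Hessian form.\<close>

lemma good_mono_pos:
  assumes a: "0 < \<alpha>" and g: "good k" and k: "k \<le> k'"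
  shows "good k'"
proof (rule goodI)
  have U: "pdom k = UNIV" using goodD(5)[OF g] a by simp
  have "0 < k' + f x" for x
  proof -
    have "x \<in> pdom k" using U by simp
    then show ?thesis using k by (simp add: pdom_def)
  qed
  then have U': "pdom k' = UNIV" by (simp add: pdom_def)
  then show "convex (pdom k')" "pdom k' \<noteq> {}" "0 < \<alpha> \<longrightarrow> pdom k' = UNIV" by auto
  fix x
  have w: "0 < k + f x" using U by (auto simp: pdom_def)
  have "0 < v \<bullet> (B k' x *v v)" if v: "v \<noteq> 0" for v
  proof (cases "\<beta> \<le> 0")
    case True
    have "0 < v \<bullet> (hess f x *v v)" using Hpd v by (simp add: pos_def_def)
    moreover have "\<beta> / (k' + f x) * (grad f x \<bullet> v)\<^sup>2 \<le> 0"
      using True w k by (intro mult_nonpos_nonneg divide_nonpos_pos) auto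
    ultimately show ?thesis by (simp add: B_form)
  next
    case False
    have "0 < v \<bullet> (B k x *v v)" using goodD(7)[OF g, of x, unfolded pos_def_sgn_iff] U v a by simp
    moreover have "\<beta> / (k' + f x) * (grad f x \<bullet> v)\<^sup>2 \<le> \<beta> / (k + f x) * (grad f x \<bullet> v)\<^sup>2"
      using False w k by (intro mult_right_mono divide_left_mono) auto
    ultimately show ?thesis by (simp add: B_form)
  qed
  then show "pos_def (sgn \<alpha> *\<^sub>R B k' x)" unfolding pos_def_sgn_iff using a by simp
qed

text \<open>Lowering k enlarges the correction, so the negative form stays negative. If the smaller
  domain were not convex, f would have a minimum inside some segment, at a point of the larger
  convex domain; there the correction vanishes along the segment and the form is the positive
  Hessian form.\<close>

lemma good_mono_neg:
  assumes a: "\<alpha> < 0" and g: "good k" and k: "k' \<le> k"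
  shows "good k'"
proof (rule goodI)
  have sub: "pdom k' \<subseteq> pdom k" using k by (auto simp: pdom_def)
  have neg: "v \<bullet> (B k x *v v) < 0" if "x \<in> pdom k" "v \<noteq> 0" for x v
    using goodD(7)[OF g that(1), unfolded pos_def_sgn_iff] that(2) a by simp
  show "pdom k' \<noteq> {}"
  proof -
    obtain x where "- k' < f x" using f_unbounded by blast
    then have "x \<in> pdom k'" by (simp add: pdom_def)
    then show ?thesis by blast
  qed
  show "0 < \<alpha> \<longrightarrow> pdom k' = UNIV" using a by simp
  show "pos_def (sgn \<alpha> *\<^sub>R B k' x)" if x: "x \<in> pdom k'" for x
  proof -
    have w: "0 < k' + f x" using x by (simp add: pdom_def)
    have "v \<bullet> (B k' x *v v) < 0" if v: "v \<noteq> 0" for v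
    proof -
      have "v \<bullet> (B k x *v v) < 0" using neg x sub v by auto
      moreover have "\<beta> / (k + f x) * (grad f x \<bullet> v)\<^sup>2 \<le> \<beta> / (k' + f x) * (grad f x \<bullet> v)\<^sup>2"
        using beta_pos[OF a] w k by (intro mult_right_mono divide_left_mono) auto
      ultimately show ?thesis by (simp add: B_form)
    qed
    then show ?thesis unfolding pos_def_sgn_iff using a by simp
  qed
  show "convex (pdom k')"
  proof (rule ccontr)
    assume "\<not> convex (pdom k')"
    then obtain x y t where xy: "x \<in> pdom k'" "y \<in> pdom k'" and t: "0 \<le> t" "t \<le> 1"
      and out: "(1 - t) *\<^sub>R x + t *\<^sub>R y \<notin> pdom k'"
      by (auto simp: convex_alt)
    define v where "v = y - x"
    define \<phi> where "\<phi> s = f (x + s *\<^sub>R v)" for s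
    have pt: "x + s *\<^sub>R v = (1 - s) *\<^sub>R x + s *\<^sub>R y" for s by (simp add: v_def algebra_simps)
    have der: "(\<phi> has_real_derivative dir v f (x + s *\<^sub>R v)) (at s)" for s
      unfolding \<phi>_def by (rule dir_line[OF f])
    have "continuous_on {0..1} \<phi>"
      using der by (meson DERIV_continuous continuous_at_imp_continuous_on)
    then obtain s where s: "s \<in> {0..1}" and min: "\<And>r. r \<in> {0..1} \<Longrightarrow> \<phi> s \<le> \<phi> r"
      using continuous_attains_inf[of "{0..1::real}" \<phi>] by auto
    have "\<phi> s \<le> \<phi> t" using min t by simp
    also have "\<phi> t \<le> - k'" using out by (simp add: \<phi>_def pt pdom_def)
    finally have sk: "\<phi> s \<le> - k'" .
    have "- k' < \<phi> 0" "- k' < \<phi> 1" using xy by (auto simp: \<phi>_def v_def pdom_def)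
    then have s01: "0 < s" "s < 1" using s sk by (auto simp: less_le)
    have "dir v f (x + s *\<^sub>R v) = 0"
    proof (rule DERIV_local_min[OF der])
      show "0 < min s (1 - s)" using s01 by simp
      show "\<forall>r. \<bar>s - r\<bar> < min s (1 - s) \<longrightarrow> \<phi> s \<le> \<phi> r" using s01 by (auto intro!: min simp: abs_if split: if_splits)
    qed
    then have g0: "grad f (x + s *\<^sub>R v) \<bullet> v = 0" by (simp add: dir_eq_grad[OF f])
    have "x + s *\<^sub>R v \<in> pdom k" unfolding pt using xy sub s
      by (intro convexD[OF goodD(3)[OF g]]) auto
    moreover have v0: "v \<noteq> 0" using xy out by (auto simp: v_def algebra_simps)
    ultimately have "v \<bullet> (B k (x + s *\<^sub>R v) *v v) < 0" using neg by blast
    moreover have "0 < v \<bullet> (hess f (x + s *\<^sub>R v) *v v)" using Hpd v0 by (simp add: pos_def_def)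
    ultimately show False by (simp add: B_form g0)
  qed
qed

lemma S_eq:
  assumes "is_Sg f \<alpha> S" shows "S = {k. good k}"
proof -
  have "is_interval {k. good k}"
  proof (cases "0 < \<alpha>")
    case True then show ?thesis unfolding is_interval_1 using good_mono_pos by blast
  next
    case False then have "\<alpha> < 0" using a0 by simp
    then show ?thesis unfolding is_interval_1 using good_mono_neg by blast
  qed
  then show ?thesis using assms maximal_interval_Collect[of good S]
    by (simp add: is_Sg_def good_def[abs_def])
qed

lemma u_mono:
  assumes "x \<in> pdom k" "sgn \<alpha> * k < sgn \<alpha> * j" "x \<in> pdom j"
  shows "u k x < u j x"
proof (cases "0 < \<alpha>")
  case True
  then show ?thesis using assms unfolding u_def pdom_def by (intro powr_less_mono2) auto
next
  case False
  then have "\<alpha> < 0" using a0 by simp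
  then show ?thesis using assms unfolding u_def pdom_def by (intro powr_less_mono2_neg) auto
qed

lemma pdom_mono:
  assumes "good k" "sgn \<alpha> * k < sgn \<alpha> * j" shows "pdom j \<subseteq> pdom k"
proof (cases "0 < \<alpha>")
  case True then show ?thesis using goodD(5)[OF assms(1)] by simp
next
  case False
  then have "\<alpha> < 0" using a0 by simp
  then show ?thesis using assms(2) by (auto simp: pdom_def)
qed

lemma Mk_inside_iff:
  assumes k: "good k" and j: "good j"
  shows "Mk f \<alpha> j \<subseteq> interior (convex_side (Mk f \<alpha> k)) \<longleftrightarrow> sgn \<alpha> * k < sgn \<alpha> * j"
proof
  assume lt: "sgn \<alpha> * k < sgn \<alpha> * j"
  show "Mk f \<alpha> j \<subseteq> interior (convex_side (Mk f \<alpha> k))"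
    unfolding goodD(1)[OF k] goodD(8)[OF j] interior_epi
    using pdom_mono[OF k lt] u_mono[OF _ lt] by auto
next
  assume sub: "Mk f \<alpha> j \<subseteq> interior (convex_side (Mk f \<alpha> k))"
  show "sgn \<alpha> * k < sgn \<alpha> * j"
  proof (rule ccontr)
    assume not: "\<not> sgn \<alpha> * k < sgn \<alpha> * j"
    have in_j: "u k x < u j x" if "x \<in> pdom j" for x
      using sub that unfolding goodD(1)[OF k] goodD(8)[OF j] interior_epi by auto
    show False
    proof (cases "k = j")
      case True then show False using in_j goodD(4)[OF j] by auto
    next
      case False
      then have lt: "sgn \<alpha> * j < sgn \<alpha> * k" using not a0 by (auto simp: sgn_if)
      obtain x where x: "x \<in> pdom k" using goodD(4)[OF k] by blast
      then have "x \<in> pdom j" using pdom_mono[OF j lt] by auto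
      then show False using in_j[of x] u_mono[OF _ lt x] by force
    qed
  qed
qed

lemma I_eq:
  assumes S: "is_Sg f \<alpha> S" and k: "k \<in> S" and I: "is_Ik f \<alpha> S k J"
  shows "J = {j. good j \<and> sgn \<alpha> * k < sgn \<alpha> * j}"
proof -
  have gk: "good k" using S_eq[OF S] k by simp
  have eq: "j \<in> S \<and> Mk f \<alpha> j \<subseteq> interior (convex_side (Mk f \<alpha> k)) \<longleftrightarrow> good j \<and> sgn \<alpha> * k < sgn \<alpha> * j" for j
    using Mk_inside_iff[OF gk] S_eq[OF S] by auto
  have "is_interval {j. good j \<and> sgn \<alpha> * k < sgn \<alpha> * j}"
  proof (cases "0 < \<alpha>")
    case True then show ?thesis unfolding is_interval_1 using good_mono_pos by auto
  next
    case False then have "\<alpha> < 0" using a0 by simp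
    then show ?thesis unfolding is_interval_1 using good_mono_neg by auto
  qed
  then show ?thesis using I maximal_interval_Collect unfolding is_Ik_def eq by blast
qed

lemma good_shift:
  assumes "good k" "0 \<le> sgn \<alpha> * h" shows "good (k + h)"
proof (cases "0 < \<alpha>")
  case True then show ?thesis using assms good_mono_pos[OF _ assms(1), of "k + h"] by simp
next
  case False then have "\<alpha> < 0" using a0 by simp
  then show ?thesis using assms good_mono_neg[OF _ assms(1), of "k + h"] by simp
qed

lemma condition_K_iff:
  assumes S: "is_Sg f \<alpha> S"
  shows "condition_K f \<alpha> S \<longleftrightarrow> (\<forall>k. good k \<longrightarrow> (\<exists>c. \<forall>x\<in>pdom k. (\<delta> k x)\<^sup>2 * det (sgn \<alpha> *\<^sub>R B k x) = c))"
proof -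
  have "gauss_kronecker_curvature (power_dom \<alpha>) (gfun f \<alpha>)
          (inward_sign (power_dom \<alpha>) (gfun f \<alpha>) (Mk f \<alpha> k) (x, u k x)) (x, u k x)
        * norm (grad_g f \<alpha> (x, u k x)) ^ (CARD('n) + 2) = (\<delta> k x)\<^sup>2 * det (sgn \<alpha> *\<^sub>R B k x)"
    if k: "good k" and x: "x \<in> pdom k" for k x
    unfolding goodD(6)[OF k x]
    using sh.gauss_kronecker_split[of "u k x" "sgn \<alpha>" x] u_pos[OF x]
    by (simp add: delta_eq[OF x] shape_mat_eq[OF x] det_scaleR)
  then show ?thesis
    unfolding condition_K_def S_eq[OF S] by (simp add: goodD(8) cong: conj_cong) (auto simp: goodD(8))
qed

end

section \<open>A characterization of quadratic functions\<close>

definition third :: "(real^'n \<Rightarrow> real) \<Rightarrow> real^'n \<Rightarrow> real^'n \<Rightarrow> real^'n \<Rightarrow> real^'n \<Rightarrow> real" where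
  "third f x a b c = dir c (dir b (dir a f)) x"

lemma third_commute:
  assumes "smooth f"
  shows "third f x a b c = third f x b a c" "third f x a b c = third f x a c b"
proof -
  have "dir b (dir a f) = dir a (dir b f)" by (rule ext, rule dir_commute[OF assms])
  then show "third f x a b c = third f x b a c" by (simp add: third_def)
  show "third f x a b c = third f x a c b"
    unfolding third_def by (rule dir_commute[OF smooth_dir[OF assms]])
qed

lemma third_linear3: "smooth f \<Longrightarrow> linear (third f x a b)"
  unfolding third_def by (intro dir_linear smooth_dir)

lemma third_add:
  assumes f: "smooth f"
  shows "third f x a b (c + c') = third f x a b c + third f x a b c'"
    "third f x a (b + b') c = third f x a b c + third f x a b' c"
    "third f x (a + a') b c = third f x a b c + third f x a' b c"
proof -
  note l = linear_add[OF third_linear3[OF f]]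
  show "third f x a b (c + c') = third f x a b c + third f x a b c'" by (rule l)
  show "third f x a (b + b') c = third f x a b c + third f x a b' c"
    using l[of x a c b b'] by (simp add: third_commute(2)[OF f, of x a _ c])
  then show "third f x (a + a') b c = third f x a b c + third f x a' b c"
    using l[of x b c a a'] by (simp add: third_commute(1)[OF f, of x _ b c] third_commute(2)[OF f, of x b _ c])
qed

lemma third_scale:
  assumes f: "smooth f"
  shows "third f x (s *\<^sub>R a) (s *\<^sub>R a) (s *\<^sub>R a) = s ^ 3 * third f x a a a"
proof -
  have l: "third f x a b (s *\<^sub>R c) = s * third f x a b c" for a b c
    using linear_cmul[OF third_linear3[OF f]] by simp
  have "third f x (s *\<^sub>R a) (s *\<^sub>R a) (s *\<^sub>R a) = s * third f x (s *\<^sub>R a) (s *\<^sub>R a) a" by (rule l)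
  also have "third f x (s *\<^sub>R a) (s *\<^sub>R a) a = s * third f x (s *\<^sub>R a) a a"
    by (subst third_commute(2)[OF f]) (rule l)
  also have "third f x (s *\<^sub>R a) a a = s * third f x a a a"
    by (subst third_commute(1)[OF f], subst third_commute(2)[OF f]) (rule l)
  finally show ?thesis by (simp add: power3_eq_cube)
qed

text \<open>Terms with two entries X drop out by symmetry. What remains is at least quadratic in w,
  the order required by the Gronwall estimate in \<open>X_on_line\<close>.\<close>

lemma third_cube:
  assumes f: "smooth f" and z: "\<And>e. third f x X X e = 0"
  shows "third f x (X + w) (X + w) (X + w) = 3 * third f x X w w + third f x w w w"
proof -
  have c: "third f x X w X = 0" "third f x w X X = 0" "third f x w X w = third f x X w w" "third f x w w X = third f x X w w"
    using z third_commute[OF f] by metis+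
  show ?thesis by (simp add: third_add[OF f] z c)
qed

lemma third_bound:
  fixes f :: "real^'n \<Rightarrow> real"
  assumes f: "smooth f" and K: "compact K"
  obtains C where "0 \<le> C" "\<And>x a b c. x \<in> K \<Longrightarrow> \<bar>third f x a b c\<bar> \<le> C * norm a * norm b * norm c"
proof -
  define T where "T x i j k = third f x (axis i 1) (axis j 1) (axis k 1)" for x and i j k :: 'n
  have "\<exists>C. \<forall>x\<in>K. \<bar>T x i j k\<bar> \<le> C" for i j k
  proof -
    have "continuous_on K (\<lambda>x. T x i j k)"
      unfolding T_def third_def by (intro smooth_continuous_on smooth_dir f)
    then have "bounded ((\<lambda>x. T x i j k) ` K)" using K by (intro compact_imp_bounded compact_continuous_image)
    then show ?thesis by (auto simp: bounded_iff)
  qed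
  then obtain C0 where C0: "\<And>i j k x. x \<in> K \<Longrightarrow> \<bar>T x i j k\<bar> \<le> C0 i j k" by metis
  define C where "C = (\<Sum>i\<in>UNIV. \<Sum>j\<in>UNIV. \<Sum>k\<in>UNIV. \<bar>C0 i j k\<bar>)"
  have expand: "third f x a b c = (\<Sum>i\<in>UNIV. \<Sum>j\<in>UNIV. \<Sum>k\<in>UNIV. a $ i * (b $ j * (c $ k * T x i j k)))" for x a b c
  proof -
    have e3: "third f x a b c = (\<Sum>k\<in>UNIV. c $ k * third f x a b (axis k 1))" for a b c
      by (rule linear_axis_sum[OF third_linear3[OF f]])
    have e2: "third f x a b c = (\<Sum>j\<in>UNIV. b $ j * third f x a (axis j 1) c)" for a b c
      using e3[of a c b] third_commute(2)[OF f, of x a] by simp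
    have e1: "third f x a b c = (\<Sum>i\<in>UNIV. a $ i * third f x (axis i 1) b c)" for a b c
      using e2[of b a c] third_commute(1)[OF f, of x] by simp
    have "third f x a b c = (\<Sum>i\<in>UNIV. a $ i * (\<Sum>j\<in>UNIV. b $ j * (\<Sum>k\<in>UNIV. c $ k * T x i j k)))"
      unfolding T_def by (subst e1, subst e2, subst e3) simp
    then show ?thesis by (simp add: sum_distrib_left)
  qed
  show thesis
  proof (rule that)
    show "0 \<le> C" by (simp add: C_def sum_nonneg)
    fix x a b c assume x: "x \<in> K"
    have "\<bar>third f x a b c\<bar> \<le> (\<Sum>i\<in>UNIV. \<Sum>j\<in>UNIV. \<Sum>k\<in>UNIV. \<bar>C0 i j k\<bar> * (norm a * (norm b * norm c)))"
      unfolding expand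
    proof (intro order_trans[OF sum_abs] sum_mono)
      fix i j k
      have "\<bar>a $ i * (b $ j * (c $ k * T x i j k))\<bar> = \<bar>T x i j k\<bar> * (\<bar>a $ i\<bar> * (\<bar>b $ j\<bar> * \<bar>c $ k\<bar>))"
        by (simp add: abs_mult)
      also have "\<dots> \<le> \<bar>C0 i j k\<bar> * (norm a * (norm b * norm c))"
        using C0[OF x, of i j k] by (intro mult_mono component_le_norm_cart) (auto simp: norm_mult)
      finally show "\<bar>a $ i * (b $ j * (c $ k * T x i j k))\<bar> \<le> \<bar>C0 i j k\<bar> * (norm a * (norm b * norm c))" .
    qed
    also have "\<dots> = C * norm a * norm b * norm c"
      by (simp add: C_def sum_distrib_right mult.assoc)
    finally show "\<bar>third f x a b c\<bar> \<le> C * norm a * norm b * norm c" .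
  qed
qed

lemma hess_uniformly_coercive:
  fixes f :: "real^'n \<Rightarrow> real"
  assumes f: "smooth f" and K: "compact K" and pd: "\<And>x. x \<in> K \<Longrightarrow> pos_def (hess f x)"
  obtains l where "0 < l" "\<And>x v. x \<in> K \<Longrightarrow> l * (v \<bullet> v) \<le> v \<bullet> (hess f x *v v)"
proof (cases "K = {}")
  case True then show ?thesis using that[of 1] by simp
next
  case False
  let ?q = "\<lambda>(x, v). v \<bullet> (hess f x *v v)"
  have cont: "continuous_on (K \<times> sphere 0 1) ?q"
  proof -
    have eq: "?q = (\<lambda>p. \<Sum>i\<in>UNIV. snd p $ i * (\<Sum>j\<in>UNIV. hess f (fst p) $ i $ j * snd p $ j))"
      by (auto simp: inner_vec_def matrix_vector_mult_def fun_eq_iff)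
    show ?thesis unfolding eq
      by (intro continuous_intros continuous_on_compose2[OF continuous_hess[OF f, of UNIV]]) auto
  qed
  have comp: "compact (K \<times> sphere (0::real^'n) 1)" using K by (intro compact_Times) auto
  have ne: "K \<times> sphere (0::real^'n) 1 \<noteq> {}"
  proof -
    have "axis undefined 1 \<in> sphere (0::real^'n) 1" by (simp add: norm_axis_1)
    then show ?thesis using False by blast
  qed
  obtain p where p: "p \<in> K \<times> sphere 0 1" "\<And>p'. p' \<in> K \<times> sphere 0 1 \<Longrightarrow> ?q p \<le> ?q p'"
    using continuous_attains_inf[OF comp ne cont] by blast
  show ?thesis
  proof (rule that)
    have "snd p \<noteq> 0" using p(1) by auto
    then show "0 < ?q p" using pd[of "fst p"] p(1) by (auto simp: pos_def_def case_prod_beta mem_Times_iff)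
    fix x v assume x: "x \<in> K"
    show "?q p * (v \<bullet> v) \<le> v \<bullet> (hess f x *v v)"
    proof (cases "v = 0")
      case False
      have "?q p \<le> ?q (x, (1 / norm v) *\<^sub>R v)" using x False by (intro p(2)) auto
      then have "?q p \<le> (v \<bullet> (hess f x *v v)) / (norm v)\<^sup>2"
        by (simp add: matrix_vector_mult_scaleR power2_eq_square)
      then show ?thesis using False by (simp add: dot_square_norm pos_le_divide_eq)
    qed auto
  qed
qed

text \<open>Gronwall backwards from the zero at b: the bound on the derivative makes
  \<open>r s * exp (M * s)\<close> nondecreasing, so r a is at most 0.\<close>

lemma gronwall_zero:
  fixes r :: "real \<Rightarrow> real"
  assumes d: "\<And>s. a \<le> s \<Longrightarrow> s \<le> b \<Longrightarrow> (r has_real_derivative r' s) (at s)"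
    and bnd: "\<And>s. a \<le> s \<Longrightarrow> s \<le> b \<Longrightarrow> \<bar>r' s\<bar> \<le> M * r s"
    and r0: "r b = 0" and nn: "0 \<le> r a" and ab: "a \<le> b"
  shows "r a = 0"
proof -
  have "r a * exp (M * a) \<le> r b * exp (M * b)"
  proof (rule DERIV_nonneg_imp_nondecreasing[OF ab])
    fix s assume s: "a \<le> s" "s \<le> b"
    have "((\<lambda>s. r s * exp (M * s)) has_real_derivative r' s * exp (M * s) + (exp (M * s) * M) * r s) (at s)"
      using d[OF s] by (auto intro!: derivative_eq_intros)
    moreover have "0 \<le> (r' s + M * r s) * exp (M * s)"
      using bnd[OF s] by (intro mult_nonneg_nonneg) auto
    ultimately show "\<exists>y. ((\<lambda>s. r s * exp (M * s)) has_real_derivative y) (at s) \<and> 0 \<le> y"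
      by (intro exI conjI) (auto simp: algebra_simps)
  qed
  then have "r a * exp (M * a) \<le> 0" using r0 by simp
  then have "r a \<le> 0" by (simp add: mult_le_0_iff)
  then show ?thesis using nn by simp
qed

text \<open>Under the hypothesis \<open>X \<bullet> grad f = 2 (f - m)\<close> on the Newton direction \<open>X\<close>, the function
  \<open>f - m\<close> turns out to be quadratic along the line through \<open>x\<close> in direction \<open>X x\<close>,
  so that one Newton step leads from every point to the critical point.\<close>

locale newton_field =
  fixes f :: "real^'n \<Rightarrow> real" and X :: "real^'n \<Rightarrow> real^'n" and m :: real
  assumes f: "smooth f" and Hpd: "\<And>x. pos_def (hess f x)"
    and X: "\<And>x. hess f x *v X x = grad f x" and Xm: "\<And>x. X x \<bullet> grad f x = 2 * (f x - m)"
begin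

lemma X_hess: "X x \<bullet> (hess f x *v v) = grad f x \<bullet> v"
  using sym_inner[OF hess_sym[OF f], of "X x" x v] by (simp add: X)

text \<open>Completing the square: the equations for X turn the constant and the linear term into
  pieces of the Hessian form at v - X. For fixed v the left side is smooth in x, although nothing is
  known about the regularity of X.\<close>

lemma theta:
  "2 * (f x - m) - 2 * dir v f x + dir v (dir v f) x = (v - X x) \<bullet> (hess f x *v (v - X x))"
  by (simp add: dir_dir_eq_hess[OF f] dir_eq_grad[OF f] matrix_vector_mult_diff_distrib X X_hess Xm inner_diff
      inner_commute[of v "grad f x"])

lemma theta_nonneg: "0 \<le> (w::real^'n) \<bullet> (hess f x *v w)"
  using Hpd[of x] by (cases "w = 0") (auto simp: pos_def_def intro: less_imp_le)

text \<open>For fixed \<open>v\<close> the expression in \<open>theta\<close> is a nonnegative function of \<open>x\<close>. It vanishes at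
  \<open>x\<close> when \<open>v = X x\<close>, hence so do its first derivatives there.\<close>

lemma third_XX: "third f x (X x) (X x) e = 0"
proof -
  let ?v = "X x"
  define \<theta> where "\<theta> s = 2 * (f (x + s *\<^sub>R e) - m) - 2 * dir ?v f (x + s *\<^sub>R e) + dir ?v (dir ?v f) (x + s *\<^sub>R e)" for s
  have d: "(\<theta> has_real_derivative 2 * (dir e f (x + 0 *\<^sub>R e) - 0) - 2 * dir e (dir ?v f) (x + 0 *\<^sub>R e) + third f (x + 0 *\<^sub>R e) ?v ?v e) (at 0)"
    unfolding \<theta>_def third_def by (intro DERIV_add DERIV_diff DERIV_cmult DERIV_const dir_line smooth_dir f)
  have "\<theta> 0 \<le> \<theta> s" for s
    unfolding \<theta>_def theta using theta_nonneg by simp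
  then have "2 * (dir e f (x + 0 *\<^sub>R e) - 0) - 2 * dir e (dir ?v f) (x + 0 *\<^sub>R e) + third f (x + 0 *\<^sub>R e) ?v ?v e = 0"
    by (intro DERIV_local_min[OF d, of 1]) auto
  moreover have "dir e (dir ?v f) x = dir e f x"
    by (simp add: dir_dir_eq_hess[OF f] X_hess dir_eq_grad[OF f])
  ultimately show ?thesis by simp
qed

text \<open>Along the ray in direction v = X x0 the deviation w of X from t v is measured by r, its
  square in the Hessian norm, which vanishes at the starting point t = 1. In the derivative of r the
  lower order terms cancel and leave t^2 times the third derivative in direction v. Since t v = X +
  w, \<open>third_cube\<close> bounds this by a multiple of r.\<close>

lemma X_on_line:
  assumes s: "0 < s" "s \<le> 1"
  shows "X (x0 - X x0 + s *\<^sub>R X x0) = s *\<^sub>R X x0"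
proof -
  define v where "v = X x0"
  define y where "y = x0 - v"
  define K where "K = (\<lambda>t. y + t *\<^sub>R v) ` {s..1}"
  have K: "compact K" unfolding K_def by (intro compact_continuous_image continuous_intros) auto
  obtain C where C: "0 \<le> C" "\<And>x a b c. x \<in> K \<Longrightarrow> \<bar>third f x a b c\<bar> \<le> C * norm a * norm b * norm c"
    using third_bound[OF f K] by metis
  obtain l where l: "0 < l" "\<And>x v. x \<in> K \<Longrightarrow> l * (v \<bullet> v) \<le> v \<bullet> (hess f x *v v)"
    using hess_uniformly_coercive[OF f K Hpd] by metis
  have "bounded (grad f ` K)" using K by (intro compact_imp_bounded compact_continuous_image continuous_grad f)
  then obtain C1 where C1: "\<And>x. x \<in> K \<Longrightarrow> norm (grad f x) \<le> C1" by (auto simp: bounded_iff)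
  have XB: "norm (X x) \<le> C1 / l" if "x \<in> K" for x
  proof (cases "X x = 0")
    case True
    have "0 \<le> C1" using C1[OF that] norm_ge_zero order_trans by blast
    then show ?thesis using True l by simp
  next
    case False
    have "l * (norm (X x) * norm (X x)) \<le> X x \<bullet> grad f x"
      using l(2)[OF that, of "X x"] by (simp add: X dot_square_norm power2_eq_square)
    also have "\<dots> \<le> norm (X x) * norm (grad f x)" by (rule norm_cauchy_schwarz)
    also have "\<dots> \<le> norm (X x) * C1" using C1[OF that] by (intro mult_left_mono) auto
    finally have "norm (X x) * (l * norm (X x)) \<le> norm (X x) * C1" by (simp add: mult_ac)
    then have "l * norm (X x) \<le> C1" using False by simp
    then show ?thesis using l by (simp add: pos_le_divide_eq mult.commute)
  qed
  define r where "r t = 2 * (f (y + t *\<^sub>R v) - m) - 2 * (t * dir v f (y + t *\<^sub>R v)) + t\<^sup>2 * dir v (dir v f) (y + t *\<^sub>R v)" for t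
  define w where "w t = t *\<^sub>R v - X (y + t *\<^sub>R v)" for t
  have r_eq: "r t = w t \<bullet> (hess f (y + t *\<^sub>R v) *v w t)" for t
  proof -
    have "dir (t *\<^sub>R v) g x = t * dir v g x" if "smooth g" for g x
      using linear_cmul[OF dir_linear[OF that]] by simp
    note lin = this
    have "dir (t *\<^sub>R v) (dir (t *\<^sub>R v) f) x = t\<^sup>2 * dir v (dir v f) x" for x
      by (simp add: dir_dir_eq_hess[OF f] matrix_vector_mult_scaleR power2_eq_square)
    then show ?thesis using theta[of "y + t *\<^sub>R v" "t *\<^sub>R v"] by (simp add: r_def w_def lin[OF f])
  qed
  have der: "(r has_real_derivative t\<^sup>2 * third f (y + t *\<^sub>R v) v v v) (at t)" for t
  proof -
    have "(r has_real_derivative 2 * (dir v f (y + t *\<^sub>R v) - 0) - 2 * (1 * dir v f (y + t *\<^sub>R v) + dir v (dir v f) (y + t *\<^sub>R v) * t)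
       + ((2 * t) * dir v (dir v f) (y + t *\<^sub>R v) + third f (y + t *\<^sub>R v) v v v * t\<^sup>2)) (at t)"
      unfolding r_def third_def
      by (intro DERIV_add DERIV_diff DERIV_cmult DERIV_const DERIV_mult dir_line smooth_dir f DERIV_ident)
        (auto intro!: derivative_eq_intros)
    then show ?thesis by (simp add: algebra_simps)
  qed
  define C2 where "C2 = C1 / l + norm v"
  \<comment> \<open>The division by s compensates for estimating t^3 times the third derivative,
    whereas the derivative of r contains t^2. This is why the segment stops at s > 0.\<close>
  define M where "M = (3 * C * C2 + C * C2) / l / s"
  have bnd: "\<bar>t\<^sup>2 * third f (y + t *\<^sub>R v) v v v\<bar> \<le> M * r t" if t: "s \<le> t" "t \<le> 1" for t
  proof -
    let ?x = "y + t *\<^sub>R v"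
    have xK: "?x \<in> K" using t by (auto simp: K_def)
    have t0: "0 < t" using s t by simp
    have "t ^ 3 * third f ?x v v v = third f ?x (X ?x + w t) (X ?x + w t) (X ?x + w t)"
      by (simp add: third_scale[OF f, symmetric] w_def)
    also have "\<dots> = 3 * third f ?x (X ?x) (w t) (w t) + third f ?x (w t) (w t) (w t)"
      by (rule third_cube[OF f third_XX])
    finally have eq: "t ^ 3 * third f ?x v v v = \<dots>" .
    have nX: "norm (X ?x) \<le> C2" using XB[OF xK] by (simp add: C2_def add_increasing2)
    have nw: "norm (w t) \<le> C2"
    proof -
      have "norm (w t) \<le> norm (t *\<^sub>R v) + norm (X ?x)" unfolding w_def by (rule norm_triangle_ineq4)
      also have "\<dots> \<le> norm v + C1 / l" using XB[OF xK] t t0 by (intro add_mono) (auto simp: mult_left_le_one_le)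
      finally show ?thesis by (simp add: C2_def)
    qed
    have C2: "0 \<le> C2" using nX norm_ge_zero order_trans by blast
    have ww: "norm (w t) * norm (w t) \<le> r t / l"
      using l(2)[OF xK, of "w t"] l(1) by (simp add: r_eq dot_square_norm power2_eq_square pos_le_divide_eq mult.commute)
    have b: "\<bar>third f ?x a (w t) (w t)\<bar> \<le> C * C2 * (r t / l)" if a: "norm a \<le> C2" for a
    proof -
      have "\<bar>third f ?x a (w t) (w t)\<bar> \<le> (C * norm a) * (norm (w t) * norm (w t))"
        using C(2)[OF xK, of a "w t" "w t"] by (simp add: mult.assoc)
      also have "\<dots> \<le> (C * C2) * (r t / l)"
        using a C ww C2 by (intro mult_mono) auto
      finally show ?thesis .
    qed
    have "\<bar>t ^ 3 * third f ?x v v v\<bar> \<le> (3 * C * C2 + C * C2) * (r t / l)"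
    proof -
      define R where "R = C * C2 * (r t / l)"
      have "(3 * C * C2 + C * C2) * (r t / l) = 3 * R + R" by (simp add: R_def algebra_simps)
      then show ?thesis unfolding eq using b[OF nX] b[OF nw] unfolding R_def[symmetric] by linarith
    qed
    moreover have "\<bar>t ^ 3 * third f ?x v v v\<bar> = t * \<bar>t\<^sup>2 * third f ?x v v v\<bar>"
      using t0 by (simp add: abs_mult power3_eq_cube power2_eq_square)
    ultimately have "t * \<bar>t\<^sup>2 * third f ?x v v v\<bar> \<le> (3 * C * C2 + C * C2) * (r t / l)" by simp
    moreover have "s * \<bar>t\<^sup>2 * third f ?x v v v\<bar> \<le> t * \<bar>t\<^sup>2 * third f ?x v v v\<bar>" using t by (intro mult_right_mono) auto
    ultimately have "s * \<bar>t\<^sup>2 * third f ?x v v v\<bar> \<le> (3 * C * C2 + C * C2) * (r t / l)" by linarith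
    then show ?thesis using s l by (simp add: M_def field_simps)
  qed
  have "r s = 0"
  proof (rule gronwall_zero[OF der bnd])
    show "r 1 = 0" by (simp add: r_eq w_def y_def v_def)
    show "0 \<le> r s" unfolding r_eq by (rule theta_nonneg)
  qed (use s in auto)
  then have "w s = 0" using Hpd[of "y + s *\<^sub>R v"] unfolding r_eq pos_def_def by force
  then show ?thesis by (simp add: w_def y_def v_def)
qed

text \<open>By \<open>X_on_line\<close> the gradient on the ray is s times the Hessian applied to X
  x. Letting s tend to 0 reaches the end point excluded there.\<close>

lemma grad_newton_step: "grad f (x - X x) = 0"
proof -
  let ?y = "\<lambda>s. x - X x + s *\<^sub>R X x"
  define g where "g s = grad f (?y s) - s *\<^sub>R (hess f (?y s) *v X x)" for s
  have g0: "g s = 0" if "0 < s" "s \<le> 1" for s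
    using X[of "?y s"] by (simp add: g_def X_on_line[OF that] matrix_vector_mult_scaleR)
  have "continuous_on UNIV g"
    unfolding g_def matrix_vector_mult_def
    by (intro continuous_intros continuous_on_compose2[OF continuous_grad[OF f, of UNIV]]
      continuous_on_compose2[OF continuous_hess[OF f, of UNIV]]) auto
  then have "(g \<longlongrightarrow> g 0) (at_right 0)"
    by (simp add: continuous_on_eq_continuous_at isCont_def filterlim_at_split)
  moreover have "(g \<longlongrightarrow> 0) (at_right 0)"
    using g0 by (intro tendsto_eventually) (auto simp: eventually_at_right[of 0 1] intro!: exI[of _ 1])
  ultimately have "g 0 = 0" using tendsto_unique trivial_limit_at_right_real by blast
  then show ?thesis by (simp add: g_def)
qed

lemma critical_point_unique:
  assumes "grad f a = 0" "grad f b = 0" shows "a = b"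
proof (rule ccontr)
  assume "a \<noteq> b"
  define v where "v = b - a"
  have "\<exists>z. 0 < z \<and> z < 1 \<and> dir v f (a + 1 *\<^sub>R v) - dir v f (a + 0 *\<^sub>R v) = (1 - 0) * dir v (dir v f) (a + z *\<^sub>R v)"
    by (intro MVT2 dir_line smooth_dir f) auto
  then obtain z where "dir v (dir v f) (a + z *\<^sub>R v) = 0"
    using assms by (auto simp: dir_eq_grad[OF f] v_def)
  moreover have "0 < v \<bullet> (hess f (a + z *\<^sub>R v) *v v)"
    using Hpd[of "a + z *\<^sub>R v"] \<open>a \<noteq> b\<close> by (simp add: pos_def_def v_def)
  ultimately show False by (simp add: dir_dir_eq_hess[OF f])
qed

text \<open>All Newton steps lead to the unique critical point a, so X x = x - a. Along a ray from a
  the derivative of f is then proportional to the parameter, with the factor given by the Hessian at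
  a, and \<open>Xm\<close> converts it into the value of f.\<close>

lemma quadratic:
  obtains a where "\<And>x. f x = m + (x - a) \<bullet> (hess f a *v (x - a)) / 2"
proof -
  define a where "a = 0 - X 0"
  have a: "grad f a = 0" unfolding a_def by (rule grad_newton_step)
  have Xa: "X x = x - a" for x
    using critical_point_unique[OF grad_newton_step[of x] a] by (simp add: algebra_simps)
  have "f x = m + (x - a) \<bullet> (hess f a *v (x - a)) / 2" for x
  proof -
    define v where "v = x - a"
    have H: "s * dir v (dir v f) (a + s *\<^sub>R v) = dir v f (a + s *\<^sub>R v)" for s
    proof -
      have "hess f (a + s *\<^sub>R v) *v (s *\<^sub>R v) = grad f (a + s *\<^sub>R v)"
        using X[of "a + s *\<^sub>R v"] unfolding Xa add_diff_cancel_left' .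
      then have "v \<bullet> (hess f (a + s *\<^sub>R v) *v (s *\<^sub>R v)) = v \<bullet> grad f (a + s *\<^sub>R v)"
        by (rule arg_cong)
      also have "\<dots> = grad f (a + s *\<^sub>R v) \<bullet> v" by (rule inner_commute)
      finally have "v \<bullet> (hess f (a + s *\<^sub>R v) *v (s *\<^sub>R v)) = grad f (a + s *\<^sub>R v) \<bullet> v" .
      then show ?thesis by (simp add: dir_dir_eq_hess[OF f] dir_eq_grad[OF f] matrix_vector_mult_scaleR)
    qed
    define g where "g s = dir v f (a + s *\<^sub>R v) / s" for s
    have gd: "(g has_real_derivative 0) (at s)" if "0 < s" for s
    proof -
      have "(g has_real_derivative (dir v (dir v f) (a + s *\<^sub>R v) * s - dir v f (a + s *\<^sub>R v) * 1) / (s * s)) (at s)"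
        unfolding g_def using that by (intro DERIV_divide dir_line smooth_dir f DERIV_ident) auto
      then show ?thesis using H[of s] by (simp add: mult.commute)
    qed
    have gconst: "g s = g 1" if "0 < s" "s < 1" for s
    proof -
      have "\<exists>z. s < z \<and> z < 1 \<and> g 1 - g s = (1 - s) * 0"
        using that by (intro MVT2 gd) auto
      then show ?thesis by auto
    qed
    have "dir v (dir v f) (a + s *\<^sub>R v) = dir v f (a + 1 *\<^sub>R v)" if "0 < s" "s < 1" for s
      using gconst[OF that] H[of s] that by (simp add: g_def field_simps)
    then have "((\<lambda>s. dir v (dir v f) (a + s *\<^sub>R v)) \<longlongrightarrow> dir v f (a + 1 *\<^sub>R v)) (at_right 0)"
      by (intro tendsto_eventually) (auto simp: eventually_at_right[of 0 1] intro!: exI[of _ 1])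
    moreover have "((\<lambda>s. dir v (dir v f) (a + s *\<^sub>R v)) \<longlongrightarrow> dir v (dir v f) (a + 0 *\<^sub>R v)) (at_right 0)"
      by (rule isCont_tendsto_compose[OF smooth_isCont[OF smooth_dir[OF smooth_dir[OF f]]]]) (intro tendsto_intros)
    ultimately have "dir v f (a + 1 *\<^sub>R v) = dir v (dir v f) (a + 0 *\<^sub>R v)"
      using tendsto_unique trivial_limit_at_right_real by blast
    then have "grad f x \<bullet> v = v \<bullet> (hess f a *v v)"
      by (simp add: dir_eq_grad[OF f] dir_dir_eq_hess[OF f] v_def)
    moreover have "v \<bullet> grad f x = 2 * (f x - m)" using Xm[of x] by (simp add: Xa v_def)
    ultimately show ?thesis by (simp add: v_def inner_commute field_simps)
  qed
  then show thesis using that by blast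
qed

end

section \<open>Constant curvature product implies quadratic\<close>

context power_graph
begin

definition "newton x = (SOME X. hess f x *v X = grad f x)"
definition "Q x = newton x \<bullet> grad f x"

lemma newton: "hess f x *v newton x = grad f x"
  unfolding newton_def by (rule someI_ex) (metis pos_def_solve Hpd)

lemma det_B: "det (B k x) = det (hess f x) * (1 - \<beta> / (k + f x) * Q x)"
  unfolding B_def Q_def by (rule det_rank_one_update[OF Hpd newton])

lemma Q_pos: "grad f x \<noteq> 0 \<Longrightarrow> 0 < Q x"
proof -
  assume "grad f x \<noteq> 0"
  then have "newton x \<noteq> 0" using newton[of x] by auto
  then have "0 < newton x \<bullet> (hess f x *v newton x)" using Hpd by (simp add: pos_def_def)
  then show ?thesis by (simp add: newton Q_def)
qed

lemma K_equation:
  assumes S: "is_Sg f \<alpha> S" and K: "condition_K f \<alpha> S" and k: "good k" and x: "x \<in> pdom k" and y: "y \<in> pdom k"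
  shows "(k + f x) powr (2 * \<beta>) * (det (hess f x) * (1 - \<beta> * Q x / (k + f x)))
       = (k + f y) powr (2 * \<beta>) * (det (hess f y) * (1 - \<beta> * Q y / (k + f y)))"
proof -
  obtain c where c: "\<And>x. x \<in> pdom k \<Longrightarrow> (\<delta> k x)\<^sup>2 * det (sgn \<alpha> *\<^sub>R B k x) = c"
    using K k condition_K_iff[OF S] by blast
  have d2: "(\<delta> k x)\<^sup>2 = \<alpha>\<^sup>2 * (k + f x) powr (2 * \<beta>)" for x
    by (simp add: \<delta>_def power_mult_distrib power2_eq_square powr_add[symmetric])
  have "\<alpha>\<^sup>2 * sgn \<alpha> ^ CARD('n) * ((k + f x) powr (2 * \<beta>) * det (B k x))
      = \<alpha>\<^sup>2 * sgn \<alpha> ^ CARD('n) * ((k + f y) powr (2 * \<beta>) * det (B k y))"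
    using c[OF x] c[OF y] by (simp add: d2 det_scaleR mult_ac)
  then have "(k + f x) powr (2 * \<beta>) * det (B k x) = (k + f y) powr (2 * \<beta>) * det (B k y)"
    using a0 by (simp add: sgn_zero_iff)
  then show ?thesis by (simp add: det_B)
qed

text \<open>Suppose \<open>\<alpha> < 0\<close>. As \<open>k\<close> decreases to \<open>- f x\<close>, the
  left side of \<open>K_equation\<close> tends to 0, so the curvature of \<open>M\<^sub>k\<close> with \<open>k = - f x\<close> vanishes at all
  points over \<open>y\<close> with \<open>f y > f x\<close>.\<close>

lemma K_imp_alpha_pos:
  assumes S: "is_Sg f \<alpha> S" and K: "condition_K f \<alpha> S"
  shows "0 < \<alpha>"
proof (rule ccontr)
  assume "\<not> 0 < \<alpha>"
  then have a: "\<alpha> < 0" using a0 by simp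
  \<comment> \<open>In particular \<open>2 * \<beta> - 1\<close> is positive, so even the term
    divided by t tends to 0.\<close>
  have b: "1 < \<beta>" using a by (simp add: \<beta>_def divide_simps)
  obtain k0 where k0: "good k0" using S S_eq[OF S] by (auto simp: is_Sg_def)
  \<comment> \<open>The points are chosen so that the level \<open>- f x\<close> is admissible and
    has y but not x in its domain: x leaves the domains exactly in the limit.\<close>
  obtain x where x: "- k0 < f x" using f_unbounded by blast
  obtain y where y: "f x < f y" using f_unbounded by blast
  define d where "d = f y - f x"
  have d: "0 < d" using y by (simp add: d_def)
  have gk: "good (- f x)" using good_mono_neg[OF a k0] x by simp
  let ?L = "\<lambda>t. t powr (2 * \<beta>) * (det (hess f x) * (1 - \<beta> * Q x / t))"
  let ?R = "\<lambda>t. (t + d) powr (2 * \<beta>) * (det (hess f y) * (1 - \<beta> * Q y / (t + d)))"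
  have eq: "?L t = ?R t" if t: "0 < t" "t < k0 + f x" for t
  proof -
    have "good (t - f x)" using good_mono_neg[OF a k0] t by simp
    moreover have "x \<in> pdom (t - f x)" "y \<in> pdom (t - f x)" using t y by (auto simp: pdom_def)
    ultimately have "((t - f x) + f x) powr (2 * \<beta>) * (det (hess f x) * (1 - \<beta> * Q x / ((t - f x) + f x)))
       = ((t - f x) + f y) powr (2 * \<beta>) * (det (hess f y) * (1 - \<beta> * Q y / ((t - f x) + f y)))"
      by (rule K_equation[OF S K])
    moreover have "(t - f x) + f y = t + d" by (simp add: d_def)
    ultimately show ?thesis by simp
  qed
  have ev: "\<forall>\<^sub>F t in at_right 0. ?L t = ?R t"
    using eventually_at_right_real[of 0 "k0 + f x"] x by (auto elim!: eventually_mono simp: eq)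
  have L: "(?L \<longlongrightarrow> 0) (at_right 0)"
  proof -
    have "((\<lambda>t. det (hess f x) * (t powr (2 * \<beta>) - \<beta> * Q x * t powr (2 * \<beta> - 1))) \<longlongrightarrow> det (hess f x) * (0 - \<beta> * Q x * 0)) (at_right 0)"
      using b by (intro tendsto_intros; real_asymp)
    moreover have "\<forall>\<^sub>F t in at_right 0. det (hess f x) * (t powr (2 * \<beta>) - \<beta> * Q x * t powr (2 * \<beta> - 1)) = ?L t"
      by (auto simp: eventually_at_filter powr_diff field_simps)
    ultimately show ?thesis by (simp add: tendsto_cong)
  qed
  have R: "(?R \<longlongrightarrow> (0 + d) powr (2 * \<beta>) * (det (hess f y) * (1 - \<beta> * Q y / (0 + d)))) (at_right 0)"
    using d by (intro tendsto_intros) auto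
  have "d powr (2 * \<beta>) * (det (hess f y) * (1 - \<beta> * Q y / d)) = 0"
    using tendsto_unique[OF trivial_limit_at_right_real R] tendsto_cong[OF ev] L by force
  then have z: "1 - \<beta> * Q y / d = 0" using d det_pos_def[OF Hpd[of y]] by (simp only: mult_eq_0_iff powr_eq_0_iff) auto
  have e: "\<beta> / (- f x + f y) * Q y = \<beta> * Q y / d" by (simp add: d_def)
  have "det (B (- f x) y) = 0" unfolding det_B e z by simp
  moreover have "y \<in> pdom (- f x)" using y by (simp add: pdom_def)
  then have "0 < det (sgn \<alpha> *\<^sub>R B (- f x) y)" by (intro det_pos_def goodD(7)[OF gk])
  ultimately show False by (simp add: det_scaleR)
qed

text \<open>With t = 1 / k the second limit is the derivative at 0 of
  \<open>((1 + a * t) / (1 + b * t)) powr c\<close>.\<close>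

lemma shifted_power_limits:
  fixes a b c :: real
  shows "((\<lambda>k. ((k + a) / (k + b)) powr c) \<longlongrightarrow> 1) at_top"
    and "((\<lambda>k. k * (((k + a) / (k + b)) powr c - 1)) \<longlongrightarrow> c * (a - b)) at_top"
proof -
  show "((\<lambda>k. ((k + a) / (k + b)) powr c) \<longlongrightarrow> 1) at_top" by real_asymp
  have d: "((\<lambda>t. ((1 + a * t) / (1 + b * t)) powr c) has_real_derivative c * (a - b)) (at 0)"
    by (auto intro!: derivative_eq_intros)
  then have "((\<lambda>t. (((1 + a * t) / (1 + b * t)) powr c - 1) / t) \<longlongrightarrow> c * (a - b)) (at 0)"
    by (simp add: DERIV_def)
  then have "((\<lambda>t. (((1 + a * t) / (1 + b * t)) powr c - 1) / t) \<longlongrightarrow> c * (a - b)) (at_right 0)"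
    by (rule tendsto_within_subset) auto
  from filterlim_compose[OF this filterlim_inverse_at_right_top]
  have "((\<lambda>k. (((1 + a * inverse k) / (1 + b * inverse k)) powr c - 1) / inverse k) \<longlongrightarrow> c * (a - b)) at_top" .
  moreover have "\<forall>\<^sub>F k in at_top. (((1 + a * inverse k) / (1 + b * inverse k)) powr c - 1) / inverse k = k * (((k + a) / (k + b)) powr c - 1)"
    using eventually_gt_at_top[of "0::real"]
  proof eventually_elim
    case (elim k)
    then have "(1 + a * inverse k) / (1 + b * inverse k) = (k * (1 + a * inverse k)) / (k * (1 + b * inverse k))" by simp
    also have "\<dots> = (k + a) / (k + b)" using elim by (simp add: algebra_simps)
    finally show ?case using elim by (simp add: divide_inverse mult.commute)
  qed
  ultimately show "((\<lambda>k. k * (((k + a) / (k + b)) powr c - 1)) \<longlongrightarrow> c * (a - b)) at_top"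
    by (simp add: tendsto_cong)
qed

text \<open>The two leading orders of \<open>K_equation\<close> as \<open>k\<close> tends to infinity.\<close>

lemma K_imp_det_and_newton:
  assumes S: "is_Sg f \<alpha> S" and K: "condition_K f \<alpha> S"
  shows "det (hess f x) = det (hess f y)" and "Q x - Q y = 2 * (f x - f y)"
proof -
  have a: "0 < \<alpha>" by (rule K_imp_alpha_pos[OF S K])
  obtain k0 where k0: "good k0" using S S_eq[OF S] by (auto simp: is_Sg_def)
  let ?g = "\<lambda>k. ((k + f x) / (k + f y)) powr (2 * \<beta>)"
  have lim1: "((\<lambda>k. c / (k + b)) \<longlongrightarrow> 0) at_top" for c b :: real by real_asymp
  have limk: "((\<lambda>k. k * (c / (k + b))) \<longlongrightarrow> c) at_top" for c b :: real by real_asymp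
  have eq: "?g k * (det (hess f x) * (1 - \<beta> * Q x / (k + f x))) = det (hess f y) * (1 - \<beta> * Q y / (k + f y))" if k: "k0 \<le> k" for k
  proof -
    have gk: "good k" by (rule good_mono_pos[OF a k0 k])
    then have U: "x \<in> pdom k" "y \<in> pdom k" using goodD(5)[OF gk, rule_format, OF a] by auto
    then have p: "0 < k + f x" "0 < k + f y" by (auto simp: pdom_def)
    have "(k + f x) powr (2 * \<beta>) * (det (hess f x) * (1 - \<beta> * Q x / (k + f x)))
       = (k + f y) powr (2 * \<beta>) * (det (hess f y) * (1 - \<beta> * Q y / (k + f y)))"
      by (rule K_equation[OF S K gk U])
    moreover have "?g k = (k + f x) powr (2 * \<beta>) / (k + f y) powr (2 * \<beta>)" using p by (simp add: powr_divide)
    moreover have "(k + f y) powr (2 * \<beta>) \<noteq> 0" using p by simp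
    ultimately show ?thesis by (simp only: times_divide_eq_left nonzero_mult_div_cancel_left simp_thms)
  qed
  have ev: "\<forall>\<^sub>F k in at_top. ?g k * (det (hess f x) * (1 - \<beta> * Q x / (k + f x))) = det (hess f y) * (1 - \<beta> * Q y / (k + f y))"
    using eventually_ge_at_top[of k0] by eventually_elim (rule eq)
  have "((\<lambda>k. ?g k * (det (hess f x) * (1 - \<beta> * Q x / (k + f x)))) \<longlongrightarrow> 1 * (det (hess f x) * (1 - 0))) at_top"
    by (intro tendsto_intros shifted_power_limits lim1)
  moreover have "((\<lambda>k. det (hess f y) * (1 - \<beta> * Q y / (k + f y))) \<longlongrightarrow> det (hess f y) * (1 - 0)) at_top"
    by (intro tendsto_intros lim1)
  ultimately show P: "det (hess f x) = det (hess f y)"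
    using tendsto_unique[OF trivial_limit_at_top_linorder] tendsto_cong[OF ev] by force
  \<comment> \<open>With the equal determinants divided out, subtracting 1 and multiplying by k
    exposes the next order.\<close>
  have ev': "\<forall>\<^sub>F k in at_top. k * (?g k - 1) * (1 - \<beta> * Q x / (k + f x)) - k * (\<beta> * Q x / (k + f x)) = - (k * (\<beta> * Q y / (k + f y)))"
    using ev
  proof eventually_elim
    case (elim k)
    have "?g k * (1 - \<beta> * Q x / (k + f x)) = 1 - \<beta> * Q y / (k + f y)"
      using elim det_pos_def[OF Hpd[of y]] by (simp add: P)
    then have "k * (?g k * (1 - \<beta> * Q x / (k + f x)) - 1) = k * (- (\<beta> * Q y / (k + f y)))" by simp
    then show ?case by (simp add: algebra_simps)
  qed
  have "((\<lambda>k. k * (?g k - 1) * (1 - \<beta> * Q x / (k + f x)) - k * (\<beta> * Q x / (k + f x))) \<longlongrightarrow> 2 * \<beta> * (f x - f y) * (1 - 0) - \<beta> * Q x) at_top"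
    by (intro tendsto_intros shifted_power_limits lim1 limk)
  moreover have "((\<lambda>k. - (k * (\<beta> * Q y / (k + f y)))) \<longlongrightarrow> - (\<beta> * Q y)) at_top"
    by (intro tendsto_intros limk)
  ultimately have "2 * \<beta> * (f x - f y) * (1 - 0) - \<beta> * Q x = - (\<beta> * Q y)"
    using tendsto_unique[OF trivial_limit_at_top_linorder] tendsto_cong[OF ev'] by force
  then have "\<beta> * (Q x - Q y) = \<beta> * (2 * (f x - f y))" by (simp add: algebra_simps)
  moreover have "\<beta> \<noteq> 0" using a0 a1 by (simp add: \<beta>_def)
  ultimately show "Q x - Q y = 2 * (f x - f y)" by simp
qed

lemma K_imp_form:
  assumes S: "is_Sg f \<alpha> S" and K: "condition_K f \<alpha> S"
  shows "\<exists>c. hyperboloid_form f \<alpha> c"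
proof -
  have a: "0 < \<alpha>" by (rule K_imp_alpha_pos[OF S K])
  obtain k where k: "good k" using S S_eq[OF S] by (auto simp: is_Sg_def)
  have U: "x \<in> pdom k" for x using goodD(5)[OF k, rule_format, OF a] by simp
  then have w: "0 < k + f x" for x by (auto simp: pdom_def)
  \<comment> \<open>By the second part of \<open>K_imp_det_and_newton\<close>,
    \<open>f x - Q x / 2\<close> has the same value at all points.\<close>
  define m where "m = f 0 - Q 0 / 2"
  have Qm: "Q x = 2 * (f x - m)" for x
    using K_imp_det_and_newton(2)[OF S K, of x 0] by (simp add: m_def)
  interpret newton_field f newton m
    by unfold_locales (use f Hpd newton Qm in \<open>auto simp: Q_def\<close>)
  have "\<alpha> = 2"
  proof -
    obtain x where g: "grad f x \<noteq> 0" using ex_grad_nz by blast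
    define v where "v = grad f x"
    define p where "p = dir v f (x + 0 *\<^sub>R v)"
    have p: "p \<noteq> 0" using g by (simp add: p_def v_def dir_eq_grad[OF f])
    \<comment> \<open>With the determinant constant and Q = 2 (f - m), \<open>K_equation\<close>
      says that h is constant. Its derivative at 0 is a nonzero multiple of 2 \<beta> - 1, whence
      \<beta> = 1 / 2.\<close>
    define h where "h s = (k + f (x + s *\<^sub>R v)) powr (2 * \<beta>) - 2 * \<beta> * ((f (x + s *\<^sub>R v) - m) * (k + f (x + s *\<^sub>R v)) powr (2 * \<beta> - 1))" for s
    have hc: "h s = h 0" for s
    proof -
      have h': "h s = (k + f (x + s *\<^sub>R v)) powr (2 * \<beta>) * (1 - \<beta> * Q (x + s *\<^sub>R v) / (k + f (x + s *\<^sub>R v)))" for s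
        using w[of "x + s *\<^sub>R v"] by (simp add: h_def Qm powr_diff field_simps)
      have "h s * det (hess f (x + s *\<^sub>R v)) = h 0 * det (hess f (x + 0 *\<^sub>R v))"
        unfolding h' using K_equation[OF S K k U U, of "x + s *\<^sub>R v" "x + 0 *\<^sub>R v"] by (simp add: mult_ac)
      moreover have "det (hess f (x + s *\<^sub>R v)) = det (hess f (x + 0 *\<^sub>R v))" by (rule K_imp_det_and_newton(1)[OF S K])
      ultimately show ?thesis using det_pos_def[OF Hpd[of "x + 0 *\<^sub>R v"]] by simp
    qed
    have fd: "((\<lambda>s. f (x + s *\<^sub>R v)) has_real_derivative p) (at 0)"
      unfolding p_def by (rule dir_line[OF f])
    have pw: "((\<lambda>s. (k + f (x + s *\<^sub>R v)) powr c) has_real_derivative c * (k + f x) powr (c - 1) * p) (at 0)" for c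
      using DERIV_fun_powr[OF DERIV_add[OF DERIV_const fd], of k c] w[of x] by simp
    define W where "W = k + f x"
    have "(h has_real_derivative 2 * \<beta> * W powr (2 * \<beta> - 1) * p
       - 2 * \<beta> * ((p - 0) * W powr (2 * \<beta> - 1) + ((2 * \<beta> - 1) * W powr (2 * \<beta> - 1 - 1) * p) * (f x - m))) (at 0)"
      unfolding h_def W_def
      by (rule DERIV_cong[OF DERIV_diff[OF pw DERIV_cmult[OF DERIV_mult[OF DERIV_diff[OF fd DERIV_const] pw]]]]) simp
    moreover have "(h has_real_derivative 0) (at 0)"
      using hc by (metis (no_types, lifting) DERIV_const ext)
    ultimately have "2 * \<beta> * ((2 * \<beta> - 1) * W powr (2 * \<beta> - 1 - 1) * p * (f x - m)) = 0"
      using DERIV_unique by (fastforce simp: algebra_simps)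
    moreover have "0 < f x - m" using Q_pos[OF g] Qm[of x] by simp
    moreover have "0 < W" using w by (simp add: W_def)
    moreover have "\<beta> \<noteq> 0" using a0 a1 by (simp add: \<beta>_def)
    ultimately have "2 * \<beta> - 1 = 0" using p by simp
    then show ?thesis using a by (simp add: \<beta>_def field_simps)
  qed
  obtain a where a: "\<And>x. f x = m + (x - a) \<bullet> (hess f a *v (x - a)) / 2" using quadratic by metis
  obtain R and d :: "real^'n" where R: "orthogonal_matrix R" and d: "\<And>i. 0 < d $ i"
    and Hd: "hess f a = transpose R ** diag (\<chi> i. (d $ i)\<^sup>2) ** R"
    using pos_def_decompose[OF Hpd[of a]] by metis
  define T where "T x = a + transpose R *v x" for x
  \<comment> \<open>The root of 2 accounts for the factor 1 / 2 of the Hessian form.\<close>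
  define b where "b = (\<chi> i. d $ i / sqrt 2)"
  have oR: "orthogonal_transformation ((*v) (transpose R))"
    using R by (simp add: orthogonal_transformation_matrix orthogonal_matrix_transpose)
  have T: "dist (T x) (T y) = dist x y" for x y
    using orthogonal_transformation_isometry[THEN iffD1, OF oR] by (simp add: T_def)
  have fT: "f (T x) = m + (\<Sum>i\<in>UNIV. (b $ i)\<^sup>2 * (x $ i)\<^sup>2)" for x
  proof -
    have RR: "R *v (transpose R *v x) = x" using R by (simp add: matrix_vector_mul_assoc orthogonal_matrix_def)
    have "f (T x) = m + (transpose R *v x) \<bullet> (hess f a *v (transpose R *v x)) / 2"
      using a[of "T x"] by (simp add: T_def)
    also have "hess f a *v (transpose R *v x) = transpose R *v (diag (\<chi> i. (d $ i)\<^sup>2) *v x)"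
      by (simp add: Hd matrix_vector_mul_assoc[symmetric] RR)
    also have "(transpose R *v x) \<bullet> \<dots> = x \<bullet> (diag (\<chi> i. (d $ i)\<^sup>2) *v x)"
      by (simp add: inner_transpose_mult RR)
    also have "\<dots> / 2 = (\<Sum>i\<in>UNIV. (b $ i)\<^sup>2 * (x $ i)\<^sup>2)"
      by (simp add: diag_mult_vec inner_vec_def b_def power_divide sum_divide_distrib power2_eq_square mult_ac)
    finally show ?thesis .
  qed
  have "hyperboloid_form f \<alpha> m"
    unfolding hyperboloid_form_def
  proof (intro exI conjI allI impI)
    show "0 < b $ i" for i using d by (simp add: b_def)
    show "dist (T x) (T y) = dist x y" for x y by (rule T)
    fix x :: "real^'n" and z assume "(x, z) \<in> power_dom \<alpha>"
    then have "0 \<le> z" using \<open>\<alpha> = 2\<close> by (simp add: power_dom_def)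
    then have "z powr \<alpha> = z\<^sup>2" using \<open>\<alpha> = 2\<close> by (cases "z = 0") auto
    then show "gfun f \<alpha> (T x, z) = z\<^sup>2 - (\<Sum>i\<in>UNIV. (b $ i)\<^sup>2 * (x $ i)\<^sup>2) - m"
      by (simp add: gfun_def fT)
  qed
  then show ?thesis by blast
qed

end

section \<open>Caps and sections of the levels\<close>

lemma norm_matrix_vector_mult_le: "norm (M *v v) \<le> norm M * norm (v :: real^'n)"
proof -
  have "norm ((M *v v) $ i) \<le> norm (M $ i) * norm v" for i
    by (simp add: matrix_vector_mul_component Cauchy_Schwarz_ineq2)
  then have "norm (M *v v) \<le> L2_set (\<lambda>i. norm (M $ i) * norm v) UNIV"
    unfolding norm_vec_def[of "M *v v"] by (intro L2_set_mono) auto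
  also have "\<dots> = norm M * norm v" by (simp add: norm_vec_def[of M] L2_set_left_distrib)
  finally show ?thesis .
qed

section \<open>Height of a level above its tangent hyperplane\<close>

context power_graph
begin

text \<open>The tangent hyperplane over x0 is the graph of \<open>l k x0\<close>, and
  \<open>q k x0\<close> is the height of \<open>M\<^sub>k\<close> above it, measured vertically.
  Vertical heights make parallel sections project to sublevel sets of q.\<close>

definition "l k x0 x = u k x0 + \<xi> k x0 \<bullet> (x - x0)"
definition "q k x0 x = u k x - l k x0 x"

lemma q_self [simp]: "q k x x = 0"
  by (simp add: q_def l_def)

lemma l_cont: "continuous_on A (l k x0)"
  unfolding l_def by (intro continuous_intros)

lemma l_line: "((\<lambda>s. l k x0 (x + s *\<^sub>R v)) has_real_derivative \<xi> k x0 \<bullet> v) (at s)"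
proof -
  have "l k x0 (x + s *\<^sub>R v) = l k x0 x + s * (\<xi> k x0 \<bullet> v)" for s
    by (simp add: l_def inner_diff_right inner_add_right algebra_simps)
  then show ?thesis by (auto intro!: derivative_eq_intros)
qed

lemma q_line:
  assumes "x + s *\<^sub>R v \<in> pdom k"
  shows "((\<lambda>s. q k x0 (x + s *\<^sub>R v)) has_real_derivative \<xi> k (x + s *\<^sub>R v) \<bullet> v - \<xi> k x0 \<bullet> v) (at s)"
  unfolding q_def by (intro DERIV_diff u_line l_line assms)

lemma q_slope_line:
  assumes "x + s *\<^sub>R v \<in> pdom k"
  shows "((\<lambda>s. \<xi> k (x + s *\<^sub>R v) \<bullet> v - \<xi> k x0 \<bullet> v) has_real_derivative v \<bullet> (Hu k (x + s *\<^sub>R v) *v v)) (at s)"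
  using DERIV_diff[OF slope_line[OF assms] DERIV_const] by simp

lemma Hu_cont: "continuous_on (pdom k) (Hu k)"
proof -
  have w: "continuous_on (pdom k) (\<lambda>x. k + f x)" by (intro continuous_intros f_cont)
  have "continuous_on (pdom k) (\<lambda>x. 1 / \<delta> k x)"
    unfolding \<delta>_def by (intro continuous_intros w) (use a0 in \<open>auto simp: pdom_def\<close>)
  moreover have "continuous_on (pdom k) (\<lambda>x. outer (grad f x))"
    unfolding outer_def by (intro continuous_intros continuous_grad f)
  then have "continuous_on (pdom k) (B k)"
    unfolding B_def by (intro continuous_intros w continuous_hess f) (auto simp: pdom_def)
  ultimately show ?thesis unfolding Hu_def by (intro continuous_on_scaleR)
qed

lemma q_taylor:
  assumes seg: "\<And>s. 0 \<le> s \<Longrightarrow> s \<le> 1 \<Longrightarrow> x0 + s *\<^sub>R v \<in> pdom k"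
  shows "\<exists>s. 0 < s \<and> s < 1 \<and> q k x0 (x0 + v) = (v \<bullet> (Hu k (x0 + s *\<^sub>R v) *v v)) / 2"
proof -
  define d where "d m s = (if m = 0 then q k x0 (x0 + s *\<^sub>R v)
    else if m = 1 then \<xi> k (x0 + s *\<^sub>R v) \<bullet> v - \<xi> k x0 \<bullet> v else v \<bullet> (Hu k (x0 + s *\<^sub>R v) *v v))" for m :: nat and s
  have "\<exists>t>0. t < 1 \<and> d 0 1 = (\<Sum>m<2. d m 0 / fact m * 1 ^ m) + d 2 t / fact 2 * 1 ^ 2"
  proof (rule Maclaurin)
    show "\<forall>m t. m < 2 \<and> 0 \<le> t \<and> t \<le> 1 \<longrightarrow> (d m has_real_derivative d (Suc m) t) (at t)"
    proof (intro allI impI, elim conjE)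
      fix m :: nat and t :: real assume m: "m < 2" and t: "0 \<le> t" "t \<le> 1"
      then consider "m = 0" | "m = 1" by linarith
      then show "(d m has_real_derivative d (Suc m) t) (at t)"
        by cases (use q_line[OF seg[OF t]] q_slope_line[OF seg[OF t]] in \<open>auto simp: d_def[abs_def]\<close>)
    qed
  qed auto
  then show ?thesis by (simp add: d_def eval_nat_numeral)
qed

lemma q_approx:
  assumes x0: "x0 \<in> pdom k" and e: "0 < e"
  shows "\<exists>r>0. cball x0 r \<subseteq> pdom k \<and>
    (\<forall>v. norm v \<le> r \<longrightarrow> \<bar>q k x0 (x0 + v) - (v \<bullet> (Hu k x0 *v v)) / 2\<bar> \<le> e * (v \<bullet> v))"
proof -
  obtain r1 where r1: "0 < r1" "cball x0 r1 \<subseteq> pdom k" using open_dom x0 open_contains_cball by blast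
  have "isCont (Hu k) x0" using Hu_cont open_dom x0 by (simp add: continuous_on_eq_continuous_at)
  then obtain r2 where r2: "0 < r2" "\<And>y. dist y x0 < r2 \<Longrightarrow> dist (Hu k y) (Hu k x0) < e"
    using e unfolding continuous_at_eps_delta by metis
  define r where "r = min r1 (r2 / 2)"
  have r: "0 < r" "r \<le> r1" "r < r2" using r1(1) r2(1) by (auto simp: r_def)
  show ?thesis
  proof (intro exI[of _ r] conjI allI impI)
    show "0 < r" by (rule r)
    show "cball x0 r \<subseteq> pdom k" using r1(2) r(2) by (auto simp: mem_cball)
    fix v :: "real^'n" assume v: "norm v \<le> r"
    have close: "dist (x0 + s *\<^sub>R v) x0 \<le> r" if "0 \<le> s" "s \<le> 1" for s
      using that v mult_left_le_one_le[of "norm v" s] by (simp add: dist_norm)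
    have "x0 + s *\<^sub>R v \<in> pdom k" if "0 \<le> s" "s \<le> 1" for s
      using close[OF that] r r1(2) by (auto simp: dist_commute)
    then obtain s where s: "0 < s" "s < 1" and eq: "q k x0 (x0 + v) = (v \<bullet> (Hu k (x0 + s *\<^sub>R v) *v v)) / 2"
      using q_taylor by metis
    define M where "M = Hu k (x0 + s *\<^sub>R v) - Hu k x0"
    have M: "norm M < e" using r2(2)[of "x0 + s *\<^sub>R v"] close[of s] s r by (simp add: M_def dist_norm)
    have "q k x0 (x0 + v) - (v \<bullet> (Hu k x0 *v v)) / 2 = (v \<bullet> (M *v v)) / 2"
      by (simp add: eq M_def matrix_vector_mult_diff_rdistrib inner_diff_right diff_divide_distrib)
    moreover have "\<bar>v \<bullet> (M *v v)\<bar> \<le> e * (v \<bullet> v)"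
    proof -
      have "\<bar>v \<bullet> (M *v v)\<bar> \<le> norm v * norm (M *v v)" by (rule Cauchy_Schwarz_ineq2)
      also have "\<dots> \<le> norm v * (e * norm v)"
        using M by (intro mult_left_mono order_trans[OF norm_matrix_vector_mult_le] mult_right_mono) auto
      finally show ?thesis by (simp add: dot_square_norm power2_eq_square mult_ac)
    qed
    moreover have "0 \<le> e * (v \<bullet> v)" using e by simp
    ultimately show "\<bar>q k x0 (x0 + v) - (v \<bullet> (Hu k x0 *v v)) / 2\<bar> \<le> e * (v \<bullet> v)" by linarith
  qed
qed

lemma q_nonneg:
  assumes k: "good k" and x0: "x0 \<in> pdom k" and x: "x \<in> pdom k"
  shows "0 \<le> q k x0 x"
proof -
  define v where "v = x - x0"
  have seg: "x0 + s *\<^sub>R v \<in> pdom k" if "0 \<le> s" "s \<le> 1" for s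
  proof -
    have "(1 - s) *\<^sub>R x0 + s *\<^sub>R x \<in> pdom k" using that x0 x by (intro convexD[OF goodD(3)[OF k]]) auto
    then show ?thesis by (simp add: v_def algebra_simps)
  qed
  obtain s where "0 < s" "s < 1" and eq: "q k x0 (x0 + v) = (v \<bullet> (Hu k (x0 + s *\<^sub>R v) *v v)) / 2"
    using q_taylor[OF seg] by metis
  then have y: "x0 + s *\<^sub>R v \<in> pdom k" by (intro seg) auto
  have "pos_def (Hu k (x0 + s *\<^sub>R v))" by (rule Hu_pos_def[OF y goodD(7)[OF k y]])
  then have "0 \<le> v \<bullet> (Hu k (x0 + s *\<^sub>R v) *v v)" by (cases "v = 0") (auto simp: pos_def_def intro: less_imp_le)
  then show ?thesis using eq by (simp add: v_def)
qed

lemma q_convex: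
  assumes k: "good k" shows "convex_on (pdom k) (q k x0)"
proof (rule convex_onI[OF _ goodD(3)[OF k]])
  fix t :: real and x y assume "0 < t" "t < 1" "x \<in> pdom k" "y \<in> pdom k"
  then have "u k ((1 - t) *\<^sub>R x + t *\<^sub>R y) \<le> (1 - t) * u k x + t * u k y"
    using convex_on_u[OF goodD(3)[OF k] goodD(7)[OF k]] by (intro convex_onD) auto
  moreover have "l k x0 ((1 - t) *\<^sub>R x + t *\<^sub>R y) = (1 - t) * l k x0 x + t * l k x0 y"
    by (simp add: l_def inner_diff_right inner_add_right algebra_simps)
  ultimately show "q k x0 ((1 - t) *\<^sub>R x + t *\<^sub>R y) \<le> (1 - t) * q k x0 x + t * q k x0 y"
    by (simp add: q_def algebra_simps)
qed

text \<open>The Hessian makes q positive on a small sphere, and convexity extends this to linear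
  growth outside. This bounds the sublevel sets and later localizes the points of tangency.\<close>

lemma q_growth:
  assumes k: "good k" and x0: "x0 \<in> pdom k" and \<rho>: "0 < \<rho>"
  shows "\<exists>r m. 0 < r \<and> r < \<rho> \<and> 0 < m \<and> (\<forall>x\<in>pdom k. r \<le> dist x x0 \<longrightarrow> m * (dist x x0 / r) \<le> q k x0 x)"
proof -
  have pd: "pos_def (Hu k x0)" by (rule Hu_pos_def[OF x0 goodD(7)[OF k x0]])
  obtain c where c: "0 < c" "\<And>v. c * (v \<bullet> v) \<le> v \<bullet> (Hu k x0 *v v)"
    using pos_def_coercive[OF pd] by metis
  obtain r1 where r1: "0 < r1" "cball x0 r1 \<subseteq> pdom k"
    "\<And>v. norm v \<le> r1 \<Longrightarrow> \<bar>q k x0 (x0 + v) - (v \<bullet> (Hu k x0 *v v)) / 2\<bar> \<le> (c / 4) * (v \<bullet> v)"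
    using q_approx[OF x0, of "c / 4"] c(1) by auto
  define r where "r = min r1 (\<rho> / 2)"
  have r: "0 < r" "r \<le> r1" "r < \<rho>" using r1(1) \<rho> by (auto simp: r_def)
  have sph: "c * r\<^sup>2 / 4 \<le> q k x0 x" if "dist x x0 = r" for x
  proof -
    define v where "v = x - x0"
    have v: "v \<bullet> v = r\<^sup>2" "norm v \<le> r1" "x0 + v = x"
      using that r by (auto simp: v_def dist_norm dot_square_norm)
    show ?thesis using r1(3)[OF v(2)] c(2)[of v] unfolding v(1,3) by linarith
  qed
  have "c * r\<^sup>2 / 4 * (dist x x0 / r) \<le> q k x0 x" if "x \<in> pdom k" "r \<le> dist x x0" for x
    by (rule convex_growth_outside_ball[OF q_convex[OF k] x0 q_self r(1) _ sph that]) (use r1(2) r(2) in auto)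
  moreover have "0 < c * r\<^sup>2 / 4" using c r by simp
  ultimately show ?thesis using r by blast
qed

lemma q_sublevel_bounded:
  assumes k: "good k" and x0: "x0 \<in> pdom k"
  shows "bounded {x \<in> pdom k. q k x0 x \<le> t}"
proof -
  obtain r m where r: "0 < r" "0 < m" "\<And>x. x \<in> pdom k \<Longrightarrow> r \<le> dist x x0 \<Longrightarrow> m * (dist x x0 / r) \<le> q k x0 x"
    using q_growth[OF k x0, of 1] by auto
  have "dist x0 x \<le> max r (t * r / m)" if "x \<in> pdom k" "q k x0 x \<le> t" for x
  proof (cases "r \<le> dist x x0")
    case True
    then have "m * (dist x x0 / r) \<le> t" using r(3)[of x] that by linarith
    then have "dist x x0 \<le> t * r / m" using r(1,2) by (simp add: field_simps)
    then show ?thesis by (simp add: dist_commute le_max_iff_disj)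
  qed (simp add: dist_commute)
  then show ?thesis unfolding bounded_def by blast
qed

lemma closed_q_epigraph:
  assumes k: "good k" shows "closed {(x, s). x \<in> pdom k \<and> q k x0 x \<le> s}"
proof -
  have "continuous_on UNIV (\<lambda>p. (fst p, snd p + l k x0 (fst p)))"
    by (intro continuous_intros continuous_on_compose2[OF l_cont[of UNIV]]) auto
  from closed_vimage[OF closed_epi[OF goodD(5)[OF k]] this]
  show ?thesis by (rule back_subst[where P = closed]) (auto simp: epi_def q_def)
qed

text \<open>Volume of the projection to the x-space of the section at vertical height s; the area of
  the section itself carries the slope factor of \<open>hyperplane_area_graph\<close>.\<close>

definition "sec k x0 s = measure lebesgue {x \<in> pdom k. q k x0 x \<le> s}"

lemma sec_asymptotics:
  assumes k: "good k" and x0: "x0 \<in> pdom k"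
  shows "((\<lambda>s. sec k x0 s / sqrt s ^ CARD('n)) \<longlongrightarrow>
      unit_ball_vol (CARD('n)) * sqrt 2 ^ CARD('n) / sqrt (det (Hu k x0))) (at_right 0)"
  unfolding sec_def
  by (rule sublevel_measure_asymptotics[OF q_convex[OF k] x0 q_self Hu_pos_def[OF x0 goodD(7)[OF k x0]] q_approx[OF x0]])

lemma tangent_eq:
  assumes y: "y \<in> pdom k"
  shows "tangent_g f \<alpha> (y, u k y) = {(x, z). z = \<xi> k y \<bullet> x + (u k y - \<xi> k y \<bullet> y)}"
proof -
  have "((a, b) - (y, u k y)) \<bullet> grad_g f \<alpha> (y, u k y) = 0 \<longleftrightarrow> b = \<xi> k y \<bullet> a + (u k y - \<xi> k y \<bullet> y)" for a b
    using sh.tangent_iff[of "u k y" "(a, b) - (y, u k y)" y] u_pos[OF y]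
    by (auto simp: delta_eq[OF y] \<xi>_def[symmetric] inner_diff_right)
  note * = this
  have "p \<in> tangent_g f \<alpha> (y, u k y) \<longleftrightarrow> p \<in> {(x, z). z = \<xi> k y \<bullet> x + (u k y - \<xi> k y \<bullet> y)}" for p
    by (cases p) (simp only: tangent_hyperplane_def mem_Collect_eq case_prod_conv *)
  then show ?thesis by blast
qed

lemma parallel_tangent_iff:
  assumes y: "y \<in> pdom k" and y': "y' \<in> pdom k'"
  shows "affine_parallel (tangent_g f \<alpha> (y, u k y)) (tangent_g f \<alpha> (y', u k' y')) \<longleftrightarrow> \<xi> k y = \<xi> k' y'"
proof
  define c c' where "c = u k y - \<xi> k y \<bullet> y" and "c' = u k' y' - \<xi> k' y' \<bullet> y'"
  note te = tangent_eq[OF y, folded c_def] tangent_eq[OF y', folded c'_def]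
  {
    assume "affine_parallel (tangent_g f \<alpha> (y, u k y)) (tangent_g f \<alpha> (y', u k' y'))"
    then obtain a where a: "tangent_g f \<alpha> (y', u k' y') = (\<lambda>p. a + p) ` tangent_g f \<alpha> (y, u k y)"
      unfolding affine_parallel_def by blast
    have eq: "snd a + (\<xi> k y \<bullet> x + c) = \<xi> k' y' \<bullet> (fst a + x) + c'" for x
    proof -
      have "a + (x, \<xi> k y \<bullet> x + c) \<in> tangent_g f \<alpha> (y', u k' y')" unfolding a te by auto
      then show ?thesis unfolding te by (cases a) auto
    qed
    have "(\<xi> k y - \<xi> k' y') \<bullet> x = 0" for x
      using eq[of x] eq[of 0] by (simp add: inner_diff_left inner_add_right)
    then have "\<xi> k y - \<xi> k' y' = 0" by (metis inner_eq_zero_iff)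
    then show "\<xi> k y = \<xi> k' y'" by simp
  next
    assume eq: "\<xi> k y = \<xi> k' y'"
    have "tangent_g f \<alpha> (y', u k' y') = (\<lambda>p. (0, c' - c) + p) ` tangent_g f \<alpha> (y, u k y)"
      unfolding te by (force simp: eq image_iff)
    then show "affine_parallel (tangent_g f \<alpha> (y, u k y)) (tangent_g f \<alpha> (y', u k' y'))"
      unfolding affine_parallel_def by blast
  }
qed

text \<open>The vertical height of the hyperplane tangent to \<open>M\<^sub>j\<close> over \<open>y\<close> above the parallel one
  tangent to \<open>M\<^sub>k\<close> over \<open>x0\<close>.\<close>

definition "gap k x0 j y = u j y - l k x0 y"

context
  fixes k j :: real and x0 y :: "real^'n"
  assumes k: "good k" and j: "good j" and lt: "sgn \<alpha> * k < sgn \<alpha> * j"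
    and x0: "x0 \<in> pdom k" and y: "y \<in> pdom j" and par: "\<xi> j y = \<xi> k x0"
begin

lemma gap_pos: "0 < gap k x0 j y"
proof -
  have yk: "y \<in> pdom k" using pdom_mono[OF k lt] y by auto
  show ?thesis using q_nonneg[OF k x0 yk] u_mono[OF yk lt y] by (simp add: gap_def q_def)
qed

lemma tangent_upper: "tangent_g f \<alpha> (y, u j y) = {(x, z). z - l k x0 x = gap k x0 j y}"
  unfolding tangent_eq[OF y] by (auto simp: par gap_def l_def inner_diff_right algebra_simps)

text \<open>The vertical height above the lower tangent hyperplane is affine, and it is 0 at p. A
  segment from p to a point of height d therefore crosses the height \<open>gap\<close> in its
  interior exactly when d exceeds it.\<close>

lemma cap_eq:
  "cap_of (Mk f \<alpha> k) (x0, u k x0) (tangent_g f \<alpha> (y, u j y))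
    = {(x, z). x \<in> pdom k \<and> q k x0 x \<le> z - l k x0 x \<and> z - l k x0 x \<le> gap k x0 j y}"
proof -
  let ?p = "(x0, u k x0)"
  have "open_segment ?p (x, z) \<inter> tangent_g f \<alpha> (y, u j y) = {} \<longleftrightarrow> z - l k x0 x \<le> gap k x0 j y"
    if x: "x \<in> pdom k" "u k x \<le> z" for x z
  proof -
    define t where "t = gap k x0 j y" define d where "d = z - l k x0 x"
    have t: "0 < t" unfolding t_def by (rule gap_pos)
    have d: "0 \<le> d" using q_nonneg[OF k x0 x(1)] x(2) by (simp add: d_def q_def)
    have lin: "(1 - s) * u k x0 + s * z - l k x0 ((1 - s) *\<^sub>R x0 + s *\<^sub>R x) = s * d" for s
      by (simp add: d_def l_def inner_diff_right inner_add_right algebra_simps)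
    show ?thesis unfolding tangent_upper t_def[symmetric] d_def[symmetric]
    proof
      assume e: "open_segment ?p (x, z) \<inter> {(x, z). z - l k x0 x = t} = {}"
      show "d \<le> t"
      proof (rule ccontr)
        assume "\<not> d \<le> t"
        then obtain s where s: "0 < s" "s < 1" "s * d = t"
          using t by (intro that[of "t / d"]) auto
        have ne: "?p \<noteq> (x, z)" using \<open>\<not> d \<le> t\<close> t by (auto simp: d_def l_def)
        have "(1 - s) *\<^sub>R ?p + s *\<^sub>R (x, z) \<in> open_segment ?p (x, z)"
          unfolding in_segment using s ne by blast
        moreover have "(1 - s) *\<^sub>R ?p + s *\<^sub>R (x, z) \<in> {(x, z). z - l k x0 x = t}"
          using trans[OF lin s(3)] by simp
        ultimately show False using e unfolding disjoint_iff by metis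
      qed
    next
      assume dt: "d \<le> t"
      have "r \<notin> {(x, z). z - l k x0 x = t}" if "r \<in> open_segment ?p (x, z)" for r
      proof -
        obtain s where s: "0 < s" "s < 1" "r = (1 - s) *\<^sub>R ?p + s *\<^sub>R (x, z)"
          using \<open>r \<in> open_segment ?p (x, z)\<close> by (auto simp: in_segment)
        have "s * d < t"
        proof (cases "d = 0")
          case False
          then have "s * d < 1 * d" using s d by (intro mult_strict_right_mono) auto
          then show ?thesis using dt by simp
        qed (use t in simp)
        then show ?thesis using lin[of s] by (auto simp: s(3))
      qed
      then show "open_segment ?p (x, z) \<inter> {(x, z). z - l k x0 x = t} = {}" by blast
    qed
  qed
  then show ?thesis unfolding cap_of_def goodD(1)[OF k] epi_def q_def by auto
qed

lemma section_eq:
  "section_of (Mk f \<alpha> k) (tangent_g f \<alpha> (y, u j y))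
    = (\<lambda>x. (x, \<xi> j y \<bullet> x + (u j y - \<xi> j y \<bullet> y))) ` {x \<in> pdom k. q k x0 x \<le> gap k x0 j y}"
proof -
  have "\<xi> j y \<bullet> x + (u j y - \<xi> j y \<bullet> y) = l k x0 x + gap k x0 j y" for x
    by (simp add: gap_def l_def par inner_diff_right)
  then show ?thesis
    unfolding section_of_def goodD(1)[OF k] tangent_upper epi_def q_def by (auto simp: image_iff algebra_simps)
qed

lemma cap_measure:
  "(sec k x0 has_integral measure lebesgue (cap_of (Mk f \<alpha> k) (x0, u k x0) (tangent_g f \<alpha> (y, u j y)))) {0..gap k x0 j y}"
  unfolding cap_eq sec_def[abs_def]
  by (rule cap_measure_integral(1)[OF closed_q_epigraph[OF k] l_cont q_sublevel_bounded[OF k x0]])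
    (use q_nonneg[OF k x0] gap_pos in \<open>auto intro: less_imp_le\<close>)

lemma sublevel_compact: "compact {x \<in> pdom k. q k x0 x \<le> gap k x0 j y}"
  by (rule cap_measure_integral(2)[OF closed_q_epigraph[OF k] l_cont q_sublevel_bounded[OF k x0], of "gap k x0 j y"])
    (use q_nonneg[OF k x0] gap_pos in \<open>auto intro: less_imp_le\<close>)

text \<open>The slope factor \<open>sqrt (1 + \<xi> k x0 \<bullet> \<xi> k x0)\<close> of the area
  also relates the norm of the gradient to its z-component, and it cancels.\<close>

lemma section_area:
  "hyperplane_area (tangent_g f \<alpha> (y, u j y)) (section_of (Mk f \<alpha> k) (tangent_g f \<alpha> (y, u j y)))
     / norm (grad_g f \<alpha> (x0, u k x0)) = sec k x0 (gap k x0 j y) / \<bar>\<delta> k x0\<bar>"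
proof -
  have a: "hyperplane_area (tangent_g f \<alpha> (y, u j y)) (section_of (Mk f \<alpha> k) (tangent_g f \<alpha> (y, u j y)))
    = sqrt (1 + \<xi> k x0 \<bullet> \<xi> k x0) * sec k x0 (gap k x0 j y)"
    unfolding section_eq unfolding tangent_eq[OF y] sec_def hyperplane_area_graph[OF sublevel_compact] par ..
  have n: "norm (grad_g f \<alpha> (x0, u k x0)) = \<bar>\<delta> k x0\<bar> * sqrt (1 + \<xi> k x0 \<bullet> \<xi> k x0)"
    using sh.norm_gradient_split[of "u k x0" x0] u_pos[OF x0] by (simp add: delta_eq[OF x0] \<xi>_def)
  have "0 < 1 + \<xi> k x0 \<bullet> \<xi> k x0" by (simp add: add_pos_nonneg)
  then show ?thesis unfolding a n by simp
qed

lemma cap_bounded: "bounded (cap_of (Mk f \<alpha> k) (x0, u k x0) (tangent_g f \<alpha> (y, u j y)))"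
proof -
  let ?Z = "{x \<in> pdom k. q k x0 x \<le> gap k x0 j y}"
  have "compact ((\<lambda>p. (fst p, snd p + l k x0 (fst p))) ` (?Z \<times> {0..gap k x0 j y}))"
    by (intro compact_continuous_image continuous_intros compact_Times sublevel_compact
        continuous_on_compose2[OF l_cont[of UNIV]]) auto
  moreover have "cap_of (Mk f \<alpha> k) (x0, u k x0) (tangent_g f \<alpha> (y, u j y))
     \<subseteq> (\<lambda>p. (fst p, snd p + l k x0 (fst p))) ` (?Z \<times> {0..gap k x0 j y})"
  proof
    fix p assume "p \<in> cap_of (Mk f \<alpha> k) (x0, u k x0) (tangent_g f \<alpha> (y, u j y))"
    then obtain x z where p: "p = (x, z)" "x \<in> pdom k" "q k x0 x \<le> z - l k x0 x" "z - l k x0 x \<le> gap k x0 j y"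
      unfolding cap_eq by auto
    then show "p \<in> (\<lambda>p. (fst p, snd p + l k x0 (fst p))) ` (?Z \<times> {0..gap k x0 j y})"
      using q_nonneg[OF k x0 p(2)] by (intro image_eqI[of _ _ "(x, z - l k x0 x)"]) auto
  qed
  ultimately show ?thesis using bounded_subset compact_imp_bounded by blast
qed

lemma section_bounded: "bounded (section_of (Mk f \<alpha> k) (tangent_g f \<alpha> (y, u j y)))"
  unfolding section_eq by (intro compact_imp_bounded compact_continuous_image sublevel_compact continuous_intros)

end

end

section \<open>Parallel tangent hyperplanes at nearby levels and leading terms\<close>

context power_graph
begin

lemma q_sublevel_compact:
  assumes k: "good k" and x0: "x0 \<in> pdom k" and t: "0 \<le> t"
  shows "compact {x \<in> pdom k. q k x0 x \<le> t}"
  by (rule cap_measure_integral(2)[OF closed_q_epigraph[OF k] l_cont q_sublevel_bounded[OF k x0], of t])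
    (use q_nonneg[OF k x0] t in auto)

lemma sec_integrable:
  assumes k: "good k" and x0: "x0 \<in> pdom k" and t: "0 \<le> t"
  shows "(sec k x0 has_integral integral {0..t} (sec k x0)) {0..t}"
proof (rule integrable_integral)
  have "(\<lambda>s. measure lebesgue {x \<in> pdom k. q k x0 x \<le> s}) integrable_on {0..t}"
    by (rule has_integral_integrable[OF cap_measure_integral(1)[OF closed_q_epigraph[OF k] l_cont q_sublevel_bounded[OF k x0], of t]])
      (use q_nonneg[OF k x0] t in auto)
  then show "sec k x0 integrable_on {0..t}" by (simp add: sec_def[abs_def])
qed

text \<open>The point y minimizes the vertical height of \<open>M\<^sub>j\<close> above the tangent
  hyperplane of \<open>M\<^sub>k\<close>; the first order condition is equality of slopes, and
  comparison with x0 bounds the gap.\<close>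

lemma ex_parallel_tangent:
  assumes k: "good k" and j: "good j" and lt: "sgn \<alpha> * k < sgn \<alpha> * j"
    and x0: "x0 \<in> pdom k" and x0j: "x0 \<in> pdom j"
  shows "\<exists>y\<in>pdom j. \<xi> j y = \<xi> k x0 \<and> gap k x0 j y \<le> u j x0 - u k x0"
proof -
  define t where "t = u j x0 - u k x0"
  have t: "0 \<le> t" using u_mono[OF x0 lt x0j] by (simp add: t_def)
  define g where "g = (\<lambda>p :: 'n pt. snd p - l k x0 (fst p))"
  \<comment> \<open>The points not higher than the one over x0. Since \<open>M\<^sub>j\<close> lies
    above \<open>M\<^sub>k\<close>, they project into a compact sublevel set of q.\<close>
  define K where "K = epi j \<inter> {p. g p \<le> t}"
  have gc: "continuous_on A g" for A
    unfolding g_def by (intro continuous_intros continuous_on_compose2[OF l_cont[of UNIV]]) auto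
  have clK: "closed K"
    unfolding K_def by (intro closed_Int closed_epi goodD(5)[OF j] closed_Collect_le gc continuous_intros)
  let ?Z = "{x \<in> pdom k. q k x0 x \<le> t}"
  have "compact ((\<lambda>p. (fst p, snd p + l k x0 (fst p))) ` (?Z \<times> {0..t}))"
    by (intro compact_continuous_image continuous_intros compact_Times q_sublevel_compact[OF k x0 t]
        continuous_on_compose2[OF l_cont[of UNIV]]) auto
  moreover have "K \<subseteq> (\<lambda>p. (fst p, snd p + l k x0 (fst p))) ` (?Z \<times> {0..t})"
  proof
    fix p assume "p \<in> K"
    then obtain x z where p: "p = (x, z)" "x \<in> pdom j" "u j x \<le> z" "z - l k x0 x \<le> t"
      by (auto simp: K_def epi_def g_def)
    have xk: "x \<in> pdom k" using pdom_mono[OF k lt] p by auto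
    have "q k x0 x \<le> z - l k x0 x" using u_mono[OF xk lt p(2)] p(3) by (simp add: q_def)
    then show "p \<in> (\<lambda>p. (fst p, snd p + l k x0 (fst p))) ` (?Z \<times> {0..t})"
      using q_nonneg[OF k x0 xk] p xk by (intro image_eqI[of _ _ "(x, z - l k x0 x)"]) auto
  qed
  ultimately have "compact K"
    using clK by (meson compact_Int_closed inf.absorb_iff2 compact_eq_bounded_closed bounded_subset compact_imp_bounded)
  moreover have x0K: "(x0, u j x0) \<in> K" using x0j by (simp add: K_def epi_def g_def l_def t_def)
  ultimately obtain p where p: "p \<in> K" "\<And>p'. p' \<in> K \<Longrightarrow> g p \<le> g p'"
    using continuous_attains_inf[OF _ _ gc, of K] by blast
  obtain y w where yw: "p = (y, w)" by fastforce
  have y: "y \<in> pdom j" "u j y \<le> w" using p(1) yw by (auto simp: K_def epi_def)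
  have min: "u j y - l k x0 y \<le> u j x - l k x0 x" if x: "x \<in> pdom j" for x
  proof (cases "u j x - l k x0 x \<le> t")
    case True
    then have "(x, u j x) \<in> K" using x by (simp add: K_def epi_def g_def)
    from p(2)[OF this] show ?thesis using y(2) by (simp add: yw g_def)
  next
    case False
    have "w - l k x0 y \<le> t" using p(1) yw by (simp add: K_def g_def)
    then show ?thesis using False y(2) by linarith
  qed
  have "\<xi> j y - \<xi> k x0 = 0"
  proof -
    define v where "v = \<xi> j y - \<xi> k x0"
    have yd: "y + 0 *\<^sub>R v \<in> pdom j" using y(1) by simp
    have der: "((\<lambda>s. u j (y + s *\<^sub>R v) - l k x0 (y + s *\<^sub>R v)) has_real_derivative \<xi> j (y + 0 *\<^sub>R v) \<bullet> v - \<xi> k x0 \<bullet> v) (at 0)"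
      by (intro DERIV_diff u_line l_line yd)
    obtain e where e: "0 < e" "ball y e \<subseteq> pdom j" using open_dom y(1) open_contains_ball by blast
    define d where "d = e / (norm v + 1)"
    have N: "0 < norm v + 1" by (simp add: add_nonneg_pos)
    have d: "0 < d" using e N by (simp add: d_def)
    have "\<xi> j (y + 0 *\<^sub>R v) \<bullet> v - \<xi> k x0 \<bullet> v = 0"
    proof (rule DERIV_local_min[OF der d], intro allI impI)
      fix s assume s: "\<bar>0 - s\<bar> < d"
      have "\<bar>s\<bar> * norm v \<le> \<bar>s\<bar> * (norm v + 1)" by (simp add: algebra_simps)
      also have "\<dots> < e" using s N by (simp add: d_def pos_less_divide_eq)
      finally have "y + s *\<^sub>R v \<in> ball y e" by (simp add: dist_norm)
      then show "u j (y + 0 *\<^sub>R v) - l k x0 (y + 0 *\<^sub>R v) \<le> u j (y + s *\<^sub>R v) - l k x0 (y + s *\<^sub>R v)"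
        using e(2) min[of "y + s *\<^sub>R v"] by auto
    qed
    then have "v \<bullet> v = 0" by (simp add: v_def inner_diff_left)
    then show ?thesis by (simp add: v_def)
  qed
  moreover have "gap k x0 j y \<le> t" using min[OF x0j] by (simp add: gap_def l_def t_def)
  ultimately show ?thesis using y(1) by (auto simp: t_def)
qed

lemma u_level_derivative:
  assumes "x \<in> pdom (k + c * s)"
  shows "((\<lambda>s. u (k + c * s) x) has_real_derivative c / \<delta> (k + c * s) x) (at s)"
proof -
  have w: "0 < k + c * s + f x" using assms by (simp add: pdom_def)
  have "((\<lambda>s. k + c * s + f x) has_real_derivative c) (at s)" by (auto intro!: derivative_eq_intros)
  from DERIV_fun_powr[OF this w, of "1 / \<alpha>"]
  have "((\<lambda>s. u (k + c * s) x) has_real_derivative 1 / \<alpha> * (k + c * s + f x) powr (1 / \<alpha> - 1) * c) (at s)"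
    by (simp add: u_def)
  moreover have "1 / \<alpha> - 1 = - \<beta>" using a0 by (simp add: \<beta>_def field_simps)
  ultimately show ?thesis by (simp add: \<delta>_def powr_minus divide_inverse mult_ac)
qed

text \<open>The gap is at most the rise of u over x0 and at least its rise over Y r, which by the
  mean value theorem in the level is r / |\<delta>| at an intermediate level. Divided by r, both
  bounds have the same limit once Y r tends to x0. This holds because q at Y r is at most the
  gap.\<close>

lemma gap_limit:
  assumes k: "good k" and x0: "x0 \<in> pdom k"
  obtains Y where
    "\<forall>\<^sub>F r in at_right 0. Y r \<in> pdom (k + sgn \<alpha> * r) \<and> \<xi> (k + sgn \<alpha> * r) (Y r) = \<xi> k x0"
    "((\<lambda>r. gap k x0 (k + sgn \<alpha> * r) (Y r) / r) \<longlongrightarrow> 1 / \<bar>\<delta> k x0\<bar>) (at_right 0)"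
proof -
  let ?j = "\<lambda>r. k + sgn \<alpha> * r"
  have ss: "sgn \<alpha> * sgn \<alpha> = 1" using a0 by (simp add: sgn_if)
  have w: "0 < k + f x0" using x0 by (simp add: pdom_def)
  have inv: "sgn \<alpha> / \<delta> j x = 1 / \<bar>\<delta> j x\<bar>" if "x \<in> pdom j" for j x
    using sgn_delta[OF that] delta_nz[OF that] by (auto simp: sgn_if abs_if split: if_splits)
  define \<rho> where "\<rho> = k + f x0"
  have x0j: "x0 \<in> pdom (?j r)" if "0 < r" "r < \<rho>" for r
    using that a0 w by (auto simp: pdom_def \<rho>_def sgn_if)
  have gj: "good (?j r)" if "0 < r" for r
    using good_shift[OF k, of "sgn \<alpha> * r"] that ss by (simp add: mult.assoc[symmetric])
  have lt: "sgn \<alpha> * k < sgn \<alpha> * ?j r" if "0 < r" for r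
    using that ss by (simp add: distrib_left mult.assoc[symmetric])
  \<comment> \<open>One predicate collects all estimates so that Y and the intermediate level can be
    chosen simultaneously.\<close>
  define P where "P r y s \<longleftrightarrow> y \<in> pdom (?j r) \<and> \<xi> (?j r) y = \<xi> k x0 \<and> gap k x0 (?j r) y \<le> u (?j r) x0 - u k x0 \<and>
      0 < s \<and> s < r \<and> 0 < k + sgn \<alpha> * s + f y \<and> r / \<bar>\<delta> (?j s) y\<bar> \<le> gap k x0 (?j r) y \<and> q k x0 y \<le> gap k x0 (?j r) y" for r y s
  have "\<exists>y s. P r y s"
    if r: "0 < r" "r < \<rho>" for r
  proof -
    obtain y where y: "y \<in> pdom (?j r)" "\<xi> (?j r) y = \<xi> k x0" "gap k x0 (?j r) y \<le> u (?j r) x0 - u k x0"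
      using ex_parallel_tangent[OF k gj lt x0 x0j] r by blast
    have yk: "y \<in> pdom k" using pdom_mono[OF k lt] y(1) r by auto
    have ys: "y \<in> pdom (?j s)" if "0 \<le> s" "s \<le> r" for s
      using that yk y(1) by (auto simp: pdom_def sgn_if split: if_splits)
    have "\<exists>s. 0 < s \<and> s < r \<and> u (?j r) y - u (?j 0) y = (r - 0) * (sgn \<alpha> / \<delta> (?j s) y)"
      using r by (intro MVT2 u_level_derivative ys) auto
    then obtain s where s: "0 < s" "s < r" "u (?j r) y - u k y = r * (sgn \<alpha> / \<delta> (?j s) y)" by auto
    have "r / \<bar>\<delta> (?j s) y\<bar> = u (?j r) y - u k y" using s inv[OF ys[of s]] by simp
    moreover have "gap k x0 (?j r) y = (u (?j r) y - u k y) + q k x0 y" by (simp add: gap_def q_def)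
    moreover have "0 \<le> q k x0 y" by (rule q_nonneg[OF k x0 yk])
    moreover have "u k y < u (?j r) y" using u_mono[OF yk lt y(1)] r by simp
    moreover have "0 < k + sgn \<alpha> * s + f y" using ys[of s] s by (simp add: pdom_def)
    ultimately show ?thesis unfolding P_def using y s by (intro exI[of _ y] exI[of _ s]) auto
  qed
  then obtain Y Z where YZ: "\<And>r. 0 < r \<Longrightarrow> r < \<rho> \<Longrightarrow> P r (Y r) (Z r)" by metis
  then have Y: "\<And>r. 0 < r \<Longrightarrow> r < \<rho> \<Longrightarrow> Y r \<in> pdom (?j r) \<and> \<xi> (?j r) (Y r) = \<xi> k x0"
    and up: "\<And>r. 0 < r \<Longrightarrow> r < \<rho> \<Longrightarrow> gap k x0 (?j r) (Y r) \<le> u (?j r) x0 - u k x0"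
    and Z: "\<And>r. 0 < r \<Longrightarrow> r < \<rho> \<Longrightarrow> 0 < Z r \<and> Z r < r \<and> 0 < k + sgn \<alpha> * Z r + f (Y r)"
    and lo: "\<And>r. 0 < r \<Longrightarrow> r < \<rho> \<Longrightarrow> r / \<bar>\<delta> (?j (Z r)) (Y r)\<bar> \<le> gap k x0 (?j r) (Y r)"
    and qY: "\<And>r. 0 < r \<Longrightarrow> r < \<rho> \<Longrightarrow> q k x0 (Y r) \<le> gap k x0 (?j r) (Y r)"
    unfolding P_def by blast+
  have ev: "\<forall>\<^sub>F r in at_right 0. 0 < r \<and> r < \<rho>"
    using eventually_at_right_real[of 0 \<rho>] w by (auto simp: \<rho>_def elim: eventually_mono)
  have "((\<lambda>s. u (?j s) x0) has_real_derivative sgn \<alpha> / \<delta> (?j 0) x0) (at 0)"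
    by (rule u_level_derivative) (simp add: x0)
  then have "((\<lambda>r. (u (?j r) x0 - u k x0) / r) \<longlongrightarrow> sgn \<alpha> / \<delta> k x0) (at 0)"
    by (simp add: DERIV_def)
  then have "((\<lambda>r. (u (?j r) x0 - u k x0) / r) \<longlongrightarrow> sgn \<alpha> / \<delta> k x0) (at_right 0)"
    by (rule tendsto_within_subset) auto
  then have upper: "((\<lambda>r. (u (?j r) x0 - u k x0) / r) \<longlongrightarrow> 1 / \<bar>\<delta> k x0\<bar>) (at_right 0)"
    by (simp add: inv[OF x0])
  have "((\<lambda>r. (u (?j r) x0 - u k x0) / r * r) \<longlongrightarrow> 1 / \<bar>\<delta> k x0\<bar> * 0) (at_right 0)"
    by (intro tendsto_mult upper tendsto_ident_at)
  moreover have "\<forall>\<^sub>F r in at_right 0. (u (?j r) x0 - u k x0) / r * r = u (?j r) x0 - u k x0"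
    using ev by eventually_elim simp
  ultimately have u0: "((\<lambda>r. u (?j r) x0 - u k x0) \<longlongrightarrow> 0) (at_right 0)"
    by (simp add: tendsto_cong)
  have Ylim: "(Y \<longlongrightarrow> x0) (at_right 0)"
  proof (rule tendstoI)
    fix e :: real assume "0 < e"
    then obtain a m where a: "0 < a" "a < e" "0 < m" "\<And>x. x \<in> pdom k \<Longrightarrow> a \<le> dist x x0 \<Longrightarrow> m * (dist x x0 / a) \<le> q k x0 x"
      using q_growth[OF k x0] by metis
    have "\<forall>\<^sub>F r in at_right 0. u (?j r) x0 - u k x0 < m" by (rule order_tendstoD(2)[OF u0 a(3)])
    with ev show "\<forall>\<^sub>F r in at_right 0. dist (Y r) x0 < e"
    proof eventually_elim
      case (elim r)
      have Yk: "Y r \<in> pdom k" using pdom_mono[OF k lt] Y elim by blast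
      have "q k x0 (Y r) < m" using qY[of r] up[of r] elim by linarith
      moreover have "m \<le> m * (dist (Y r) x0 / a)" if "a \<le> dist (Y r) x0"
        using that a by (simp add: field_simps)
      ultimately have "dist (Y r) x0 < a" using a(4)[OF Yk] by force
      then show ?case using a(2) by simp
    qed
  qed
  have Zlim: "(Z \<longlongrightarrow> 0) (at_right 0)"
  proof (rule tendsto_sandwich[of "\<lambda>_. 0" _ _ "\<lambda>r. r"])
    show "\<forall>\<^sub>F r in at_right 0. 0 \<le> Z r" "\<forall>\<^sub>F r in at_right 0. Z r \<le> r"
      using ev by (eventually_elim, use Z in \<open>auto intro: less_imp_le\<close>)+
  qed (auto intro: tendsto_ident_at)
  have "((\<lambda>r. k + sgn \<alpha> * Z r + f (Y r)) \<longlongrightarrow> k + sgn \<alpha> * 0 + f x0) (at_right 0)"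
    by (intro tendsto_intros Zlim isCont_tendsto_compose[OF smooth_isCont[OF f] Ylim])
  then have "((\<lambda>r. \<delta> (?j (Z r)) (Y r)) \<longlongrightarrow> \<delta> k x0) (at_right 0)"
    unfolding \<delta>_def using w by (intro tendsto_mult tendsto_const tendsto_powr) auto
  then have lower: "((\<lambda>r. 1 / \<bar>\<delta> (?j (Z r)) (Y r)\<bar>) \<longlongrightarrow> 1 / \<bar>\<delta> k x0\<bar>) (at_right 0)"
    using delta_nz[OF x0] by (intro tendsto_intros) auto
  have "((\<lambda>r. gap k x0 (?j r) (Y r) / r) \<longlongrightarrow> 1 / \<bar>\<delta> k x0\<bar>) (at_right 0)"
  proof (rule tendsto_sandwich[OF _ _ lower upper])
    show "\<forall>\<^sub>F r in at_right 0. 1 / \<bar>\<delta> (?j (Z r)) (Y r)\<bar> \<le> gap k x0 (?j r) (Y r) / r"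
      using ev
    proof eventually_elim
      case (elim r)
      have "(r / \<bar>\<delta> (?j (Z r)) (Y r)\<bar>) / r \<le> gap k x0 (?j r) (Y r) / r"
        using lo[of r] elim by (intro divide_right_mono) auto
      then show ?case using elim by simp
    qed
    show "\<forall>\<^sub>F r in at_right 0. gap k x0 (?j r) (Y r) / r \<le> (u (?j r) x0 - u k x0) / r"
      using ev by eventually_elim (use up in \<open>auto intro!: divide_right_mono\<close>)
  qed
  moreover have "\<forall>\<^sub>F r in at_right 0. Y r \<in> pdom (?j r) \<and> \<xi> (?j r) (Y r) = \<xi> k x0"
    using ev by eventually_elim (use Y in auto)
  ultimately show thesis using that by blast
qed

text \<open>The limit of \<open>A\<^sup>*\<^sub>p(k, h) / norm (grad g p)\<close>, divided by \<open>h\<close> to the power \<open>n / 2\<close>, as \<open>h\<close> tends to 0.\<close>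

definition "lam k x0 = unit_ball_vol (CARD('n)) * sqrt 2 ^ CARD('n) / sqrt (det (Hu k x0)) * sqrt (1 / \<bar>\<delta> k x0\<bar>) ^ CARD('n) * (1 / \<bar>\<delta> k x0\<bar>)"

text \<open>The factors |\<delta>| of \<open>det (Hu k x0)\<close> cancel those from the root of the
  gap limit. What remains is the curvature product of \<open>condition_K_iff\<close>, so constancy
  of \<open>lam\<close> gives constancy of the product.\<close>

lemma lam_sq:
  assumes k: "good k" and x0: "x0 \<in> pdom k"
  shows "(lam k x0)\<^sup>2 * ((\<delta> k x0)\<^sup>2 * det (sgn \<alpha> *\<^sub>R B k x0)) = (unit_ball_vol (CARD('n)))\<^sup>2 * 2 ^ CARD('n)"
proof -
  have d: "\<delta> k x0 \<noteq> 0" by (rule delta_nz[OF x0])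
  have "Hu k x0 = (1 / \<bar>\<delta> k x0\<bar>) *\<^sub>R (sgn \<alpha> *\<^sub>R B k x0)"
    using sgn_delta[OF x0] d by (auto simp: Hu_def sgn_if abs_if split: if_splits)
  then have H: "det (Hu k x0) = (1 / \<bar>\<delta> k x0\<bar>) ^ CARD('n) * det (sgn \<alpha> *\<^sub>R B k x0)"
    by (simp only: det_scaleR[of "1 / \<bar>\<delta> k x0\<bar>"])
  have p: "0 < det (sgn \<alpha> *\<^sub>R B k x0)" by (rule det_pos_def[OF goodD(7)[OF k x0]])
  have c: "0 < (1 / \<bar>\<delta> k x0\<bar>) ^ CARD('n)" using d by simp
  have Hp: "0 < det (Hu k x0)" unfolding H using p c by simp
  have s2: "(sqrt 2 ^ CARD('n))\<^sup>2 = 2 ^ CARD('n)" by (simp add: power_mult[symmetric] power_mult mult.commute[of _ 2])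
  have sd: "(sqrt (1 / \<bar>\<delta> k x0\<bar>) ^ CARD('n))\<^sup>2 = (1 / \<bar>\<delta> k x0\<bar>) ^ CARD('n)"
    by (simp add: power_mult[symmetric] power_mult mult.commute[of _ 2])
  have "(lam k x0)\<^sup>2 = (unit_ball_vol (CARD('n)))\<^sup>2 * 2 ^ CARD('n) / det (Hu k x0) * (1 / \<bar>\<delta> k x0\<bar>) ^ CARD('n) * (1 / (\<delta> k x0)\<^sup>2)"
    unfolding lam_def power_mult_distrib power_divide s2 sd[unfolded power_divide] using Hp by simp
  then show ?thesis using c p d unfolding H by (simp add: field_simps)
qed

lemma lam_pos: "good k \<Longrightarrow> x0 \<in> pdom k \<Longrightarrow> lam k x0 \<noteq> 0"
  using lam_sq[of k x0] unit_ball_vol_pos[of "CARD('n)"] by (auto simp: less_imp_neq[symmetric])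

lemma condition_K_of_lam:
  assumes S: "is_Sg f \<alpha> S" and c: "\<And>k. good k \<Longrightarrow> \<exists>c. \<forall>x\<in>pdom k. lam k x = c"
  shows "condition_K f \<alpha> S"
  unfolding condition_K_iff[OF S]
proof (intro allI impI)
  fix k assume k: "good k"
  obtain c where c: "\<And>x. x \<in> pdom k \<Longrightarrow> lam k x = c" using c[OF k] by blast
  have "(\<delta> k x)\<^sup>2 * det (sgn \<alpha> *\<^sub>R B k x) = (unit_ball_vol (CARD('n)))\<^sup>2 * 2 ^ CARD('n) / c\<^sup>2" if x: "x \<in> pdom k" for x
    using lam_sq[OF k x] lam_pos[OF k x] c[OF x] by (simp add: field_simps)
  then show "\<exists>c. \<forall>x\<in>pdom k. (\<delta> k x)\<^sup>2 * det (sgn \<alpha> *\<^sub>R B k x) = c" by blast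
qed

text \<open>The gap is substituted for the height in \<open>sec_asymptotics\<close> and in its
  integrated form; the limit of gap / r then trades powers of the gap for powers of r.\<close>

lemma section_limit:
  assumes k: "good k" and x0: "x0 \<in> pdom k"
    and Y: "\<forall>\<^sub>F r in at_right 0. Y r \<in> pdom (k + sgn \<alpha> * r) \<and> \<xi> (k + sgn \<alpha> * r) (Y r) = \<xi> k x0"
    and lim: "((\<lambda>r. gap k x0 (k + sgn \<alpha> * r) (Y r) / r) \<longlongrightarrow> 1 / \<bar>\<delta> k x0\<bar>) (at_right 0)"
  shows "((\<lambda>r. sec k x0 (gap k x0 (k + sgn \<alpha> * r) (Y r)) / \<bar>\<delta> k x0\<bar> / sqrt r ^ CARD('n)) \<longlongrightarrow> lam k x0) (at_right 0)"
    and "((\<lambda>r. integral {0..gap k x0 (k + sgn \<alpha> * r) (Y r)} (sec k x0) / (r * sqrt r ^ CARD('n))) \<longlongrightarrow> lam k x0 / (CARD('n) / 2 + 1)) (at_right 0)"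
proof -
  define g where "g r = gap k x0 (k + sgn \<alpha> * r) (Y r)" for r
  define N where "N = CARD('n)"
  define L where "L = unit_ball_vol (CARD('n)) * sqrt 2 ^ CARD('n) / sqrt (det (Hu k x0))"
  have ss: "sgn \<alpha> * sgn \<alpha> = 1" using a0 by (simp add: sgn_if)
  have r0: "\<forall>\<^sub>F r in at_right (0::real). 0 < r" by (simp add: eventually_at_right_less)
  have gpos: "\<forall>\<^sub>F r in at_right 0. 0 < g r"
    using Y r0
  proof eventually_elim
    case (elim r)
    have "good (k + sgn \<alpha> * r)" using good_shift[OF k, of "sgn \<alpha> * r"] elim ss by (simp add: mult.assoc[symmetric])
    moreover have "sgn \<alpha> * k < sgn \<alpha> * (k + sgn \<alpha> * r)"
      using elim ss by (simp add: distrib_left mult.assoc[symmetric])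
    ultimately show ?case unfolding g_def using gap_pos[OF k _ _ x0] elim by blast
  qed
  have limg: "((\<lambda>r. g r / r) \<longlongrightarrow> 1 / \<bar>\<delta> k x0\<bar>) (at_right 0)" using lim by (simp add: g_def)
  have "((\<lambda>r. g r / r * r) \<longlongrightarrow> 1 / \<bar>\<delta> k x0\<bar> * 0) (at_right 0)"
    by (intro tendsto_mult limg tendsto_ident_at)
  moreover have "\<forall>\<^sub>F r in at_right 0. g r / r * r = g r" using r0 by eventually_elim simp
  ultimately have "(g \<longlongrightarrow> 0) (at_right 0)" by (simp add: tendsto_cong)
  then have gr: "filterlim g (at_right 0) (at_right 0)"
    using gpos by (simp add: filterlim_at eventually_mono)
  note s1 = filterlim_compose[OF sec_asymptotics[OF k x0, folded L_def N_def] gr]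
  have "((\<lambda>r. sec k x0 (g r) / sqrt (g r) ^ N * sqrt (g r / r) ^ N * (1 / \<bar>\<delta> k x0\<bar>)) \<longlongrightarrow> L * sqrt (1 / \<bar>\<delta> k x0\<bar>) ^ N * (1 / \<bar>\<delta> k x0\<bar>)) (at_right 0)"
    by (intro tendsto_intros s1 limg)
  moreover have "\<forall>\<^sub>F r in at_right 0. sec k x0 (g r) / sqrt (g r) ^ N * sqrt (g r / r) ^ N * (1 / \<bar>\<delta> k x0\<bar>) = sec k x0 (g r) / \<bar>\<delta> k x0\<bar> / sqrt r ^ N"
    using gpos r0 by eventually_elim (simp add: real_sqrt_divide power_divide)
  ultimately have "((\<lambda>r. sec k x0 (g r) / \<bar>\<delta> k x0\<bar> / sqrt r ^ N) \<longlongrightarrow> lam k x0) (at_right 0)"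
    by (simp add: tendsto_cong lam_def L_def N_def)
  then show "((\<lambda>r. sec k x0 (gap k x0 (k + sgn \<alpha> * r) (Y r)) / \<bar>\<delta> k x0\<bar> / sqrt r ^ CARD('n)) \<longlongrightarrow> lam k x0) (at_right 0)"
    by (simp add: g_def N_def)
  have "((\<lambda>t. integral {0..t} (sec k x0) / (t * sqrt t ^ N)) \<longlongrightarrow> L / (N / 2 + 1)) (at_right 0)"
    by (rule integral_asymptotics[OF sec_asymptotics[OF k x0, folded L_def N_def]])
      (use r0 in \<open>auto elim!: eventually_mono intro: sec_integrable[OF k x0]\<close>)
  note s2 = filterlim_compose[OF this gr]
  have "((\<lambda>r. integral {0..g r} (sec k x0) / (g r * sqrt (g r) ^ N) * sqrt (g r / r) ^ N * (g r / r)) \<longlongrightarrow> L / (N / 2 + 1) * sqrt (1 / \<bar>\<delta> k x0\<bar>) ^ N * (1 / \<bar>\<delta> k x0\<bar>)) (at_right 0)"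
    by (intro tendsto_mult s2 tendsto_power tendsto_real_sqrt limg)
  moreover have "\<forall>\<^sub>F r in at_right 0. integral {0..g r} (sec k x0) / (g r * sqrt (g r) ^ N) * sqrt (g r / r) ^ N * (g r / r) = integral {0..g r} (sec k x0) / (r * sqrt r ^ N)"
    using gpos r0 by eventually_elim (simp add: real_sqrt_divide power_divide)
  ultimately have "((\<lambda>r. integral {0..g r} (sec k x0) / (r * sqrt r ^ N)) \<longlongrightarrow> lam k x0 / (N / 2 + 1)) (at_right 0)"
    by (simp add: tendsto_cong lam_def L_def N_def mult_ac)
  then show "((\<lambda>r. integral {0..gap k x0 (k + sgn \<alpha> * r) (Y r)} (sec k x0) / (r * sqrt r ^ CARD('n))) \<longlongrightarrow> lam k x0 / (CARD('n) / 2 + 1)) (at_right 0)"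
    by (simp add: g_def N_def)
qed

context
  fixes S :: "real set" and I :: "real \<Rightarrow> real set" and \<epsilon> :: "real \<Rightarrow> 'n pt \<Rightarrow> ereal"
  assumes S: "is_Sg f \<alpha> S" and I: "\<forall>k\<in>S. is_Ik f \<alpha> S k (I k)" and \<epsilon>: "\<forall>k p. 0 < \<epsilon> k p"
begin

lemma in_I:
  assumes k: "good k" shows "k + h \<in> I k \<longleftrightarrow> good (k + h) \<and> 0 < sgn \<alpha> * h"
proof -
  have "k \<in> S" using k S_eq[OF S] by simp
  then show ?thesis using I_eq[OF S _ , of k "I k"] I by (simp add: distrib_left)
qed

lemma eventually_admissible:
  assumes k: "good k"
  shows "\<forall>\<^sub>F r in at_right 0. 0 < r \<and> k + sgn \<alpha> * r \<in> I k \<and> ereal \<bar>sgn \<alpha> * r\<bar> < \<epsilon> k p"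
proof -
  have ss: "sgn \<alpha> * sgn \<alpha> = 1" using a0 by (simp add: sgn_if)
  have "0 < \<epsilon> k p" using \<epsilon> by blast
  then obtain e where e: "0 < ereal e" "ereal e < \<epsilon> k p" using ereal_dense2 by blast
  then have "0 < e" by simp
  then have "\<forall>\<^sub>F r in at_right 0. r \<in> {0<..<e}" by (rule eventually_at_right_real)
  then show ?thesis
  proof eventually_elim
    case (elim r)
    have "0 < sgn \<alpha> * (sgn \<alpha> * r)" using elim ss by (simp add: mult.assoc[symmetric])
    moreover have "good (k + sgn \<alpha> * r)" using good_shift[OF k, of "sgn \<alpha> * r"] calculation by simp
    moreover have "ereal \<bar>sgn \<alpha> * r\<bar> < \<epsilon> k p"
      by (rule less_trans[OF _ e(2)]) (use elim a0 in \<open>simp add: abs_mult\<close>)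
    ultimately show ?case using in_I[OF k] elim by auto
  qed
qed

text \<open>The function \<psi> is common to all points of the level, while its leading coefficient
  as h tends to 0 is \<open>lam k x\<close> for every x.\<close>

lemma A_imp_K:
  assumes A: "condition_A f \<alpha> S I \<epsilon>" shows "condition_K f \<alpha> S"
proof (rule condition_K_of_lam[OF S])
  fix k assume k: "good k"
  then have "k \<in> S" using S_eq[OF S] by simp
  then obtain \<psi> :: "real \<Rightarrow> real" where \<psi>: "\<And>h p v. k + h \<in> I k \<Longrightarrow> p \<in> Mk f \<alpha> k \<Longrightarrow> v \<in> Mk f \<alpha> (k + h) \<Longrightarrow>
     ereal \<bar>h\<bar> < \<epsilon> k p \<Longrightarrow> affine_parallel (tangent_g f \<alpha> p) (tangent_g f \<alpha> v) \<Longrightarrow>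
     bounded (section_of (Mk f \<alpha> k) (tangent_g f \<alpha> v)) \<Longrightarrow>
     hyperplane_area (tangent_g f \<alpha> v) (section_of (Mk f \<alpha> k) (tangent_g f \<alpha> v)) / norm (grad_g f \<alpha> p) = \<psi> h"
    using A unfolding condition_A_def by metis
  have lim: "((\<lambda>r. \<psi> (sgn \<alpha> * r) / sqrt r ^ CARD('n)) \<longlongrightarrow> lam k x) (at_right 0)" if x: "x \<in> pdom k" for x
  proof -
    obtain Y where Y: "\<forall>\<^sub>F r in at_right 0. Y r \<in> pdom (k + sgn \<alpha> * r) \<and> \<xi> (k + sgn \<alpha> * r) (Y r) = \<xi> k x"
      "((\<lambda>r. gap k x (k + sgn \<alpha> * r) (Y r) / r) \<longlongrightarrow> 1 / \<bar>\<delta> k x\<bar>) (at_right 0)"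
      by (rule gap_limit[OF k x])
    have "\<forall>\<^sub>F r in at_right 0. sec k x (gap k x (k + sgn \<alpha> * r) (Y r)) / \<bar>\<delta> k x\<bar> / sqrt r ^ CARD('n) = \<psi> (sgn \<alpha> * r) / sqrt r ^ CARD('n)"
      using Y(1) eventually_admissible[OF k, of "(x, u k x)"]
    proof eventually_elim
      case (elim r)
      let ?j = "k + sgn \<alpha> * r" let ?v = "(Y r, u ?j (Y r))"
      have j: "good ?j" "sgn \<alpha> * k < sgn \<alpha> * ?j" using elim in_I[OF k] by (auto simp: distrib_left)
      have y: "Y r \<in> pdom ?j" "\<xi> ?j (Y r) = \<xi> k x" using elim by auto
      note area = section_area[OF k j x y] and bd = section_bounded[OF k j x y]
      have "affine_parallel (tangent_g f \<alpha> (x, u k x)) (tangent_g f \<alpha> ?v)"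
        using parallel_tangent_iff[OF x y(1)] y(2) by simp
      from \<psi>[OF _ in_Mk[OF x] in_Mk[OF y(1)] _ this bd] area elim
      show ?case by simp
    qed
    from tendsto_cong[OF this] section_limit(1)[OF k x Y] show ?thesis by simp
  qed
  then show "\<exists>c. \<forall>x\<in>pdom k. lam k x = c"
    using tendsto_unique[OF trivial_limit_at_right_real] goodD(4)[OF k] by (metis ex_in_conv)
qed

text \<open>The argument of \<open>A_imp_K\<close> applied to the leading coefficient of the
  integrated sections.\<close>

lemma V_imp_K:
  assumes V: "condition_V f \<alpha> S I \<epsilon>" shows "condition_K f \<alpha> S"
proof (rule condition_K_of_lam[OF S])
  fix k assume k: "good k"
  then have "k \<in> S" using S_eq[OF S] by simp
  then obtain \<phi> :: "real \<Rightarrow> real" where \<phi>: "\<And>h p v. k + h \<in> I k \<Longrightarrow> p \<in> Mk f \<alpha> k \<Longrightarrow> v \<in> Mk f \<alpha> (k + h) \<Longrightarrow>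
     ereal \<bar>h\<bar> < \<epsilon> k p \<Longrightarrow> affine_parallel (tangent_g f \<alpha> p) (tangent_g f \<alpha> v) \<Longrightarrow>
     bounded (cap_of (Mk f \<alpha> k) p (tangent_g f \<alpha> v)) \<Longrightarrow>
     measure lebesgue (cap_of (Mk f \<alpha> k) p (tangent_g f \<alpha> v)) = \<phi> h"
    using V unfolding condition_V_def by metis
  have lim: "((\<lambda>r. \<phi> (sgn \<alpha> * r) / (r * sqrt r ^ CARD('n))) \<longlongrightarrow> lam k x / (CARD('n) / 2 + 1)) (at_right 0)" if x: "x \<in> pdom k" for x
  proof -
    obtain Y where Y: "\<forall>\<^sub>F r in at_right 0. Y r \<in> pdom (k + sgn \<alpha> * r) \<and> \<xi> (k + sgn \<alpha> * r) (Y r) = \<xi> k x"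
      "((\<lambda>r. gap k x (k + sgn \<alpha> * r) (Y r) / r) \<longlongrightarrow> 1 / \<bar>\<delta> k x\<bar>) (at_right 0)"
      by (rule gap_limit[OF k x])
    have "\<forall>\<^sub>F r in at_right 0. integral {0..gap k x (k + sgn \<alpha> * r) (Y r)} (sec k x) / (r * sqrt r ^ CARD('n)) = \<phi> (sgn \<alpha> * r) / (r * sqrt r ^ CARD('n))"
      using Y(1) eventually_admissible[OF k, of "(x, u k x)"]
    proof eventually_elim
      case (elim r)
      let ?j = "k + sgn \<alpha> * r" let ?v = "(Y r, u ?j (Y r))"
      have j: "good ?j" "sgn \<alpha> * k < sgn \<alpha> * ?j" using elim in_I[OF k] by (auto simp: distrib_left)
      have y: "Y r \<in> pdom ?j" "\<xi> ?j (Y r) = \<xi> k x" using elim by auto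
      note vol = integral_unique[OF cap_measure[OF k j x y]] and bd = cap_bounded[OF k j x y]
      have "affine_parallel (tangent_g f \<alpha> (x, u k x)) (tangent_g f \<alpha> ?v)"
        using parallel_tangent_iff[OF x y(1)] y(2) by simp
      from \<phi>[OF _ in_Mk[OF x] in_Mk[OF y(1)] _ this bd] vol elim
      show ?case by simp
    qed
    from tendsto_cong[OF this] section_limit(2)[OF k x Y] show ?thesis by simp
  qed
  have "lam k x = lam k y" if "x \<in> pdom k" "y \<in> pdom k" for x y
  proof -
    have "lam k x / (CARD('n) / 2 + 1) = lam k y / (CARD('n) / 2 + 1)"
      using tendsto_unique[OF trivial_limit_at_right_real lim[OF that(1)] lim[OF that(2)]] .
    moreover have "CARD('n) / 2 + 1 \<noteq> (0::real)" by (simp add: add_nonneg_pos less_imp_neq[symmetric])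
    ultimately show ?thesis by simp
  qed
  then show "\<exists>c. \<forall>x\<in>pdom k. lam k x = c" using goodD(4)[OF k] by (metis ex_in_conv)
qed

end

end

section \<open>Hyperboloids\<close>

lemma pos_def_Cauchy_Schwarz:
  fixes G :: "real^'n^'n"
  assumes "pos_def G" shows "(x \<bullet> (G *v y))\<^sup>2 \<le> (x \<bullet> (G *v x)) * (y \<bullet> (G *v y))"
proof -
  obtain B C :: "real^'n^'n" where GB: "G = transpose B ** B" using pos_def_factor[OF assms] by metis
  have "v \<bullet> (G *v w) = (B *v v) \<bullet> (B *v w)" for v w
    by (simp add: GB matrix_vector_mul_assoc[symmetric] inner_transpose_mult)
  then show ?thesis using Cauchy_Schwarz_ineq[of "B *v x" "B *v y"] by simp
qed

lemma pos_def_inj: "pos_def G \<Longrightarrow> G *v x = G *v y \<Longrightarrow> x = y"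
proof (rule ccontr)
  assume "pos_def G" "G *v x = G *v y" "x \<noteq> y"
  then have "0 < (x - y) \<bullet> (G *v (x - y))" by (simp add: pos_def_def)
  then show False using \<open>G *v x = G *v y\<close> by (simp add: matrix_vector_mult_diff_distrib)
qed

context power_graph
begin

lemma hyperboloid_form_quadratic:
  assumes "hyperboloid_form f \<alpha> c"
  obtains G b where "\<alpha> = 2" "pos_def G" "\<And>x. f x = c + (x - b) \<bullet> (G *v (x - b))"
proof -
  obtain a :: "real^'n" and T where a: "\<And>i. 0 < a $ i" and T: "\<And>x y. dist (T x) (T y) = dist x y"
    and g: "\<And>x z. (x, z) \<in> power_dom \<alpha> \<Longrightarrow> gfun f \<alpha> (T x, z) = z\<^sup>2 - (\<Sum>i\<in>UNIV. (a $ i)\<^sup>2 * (x $ i)\<^sup>2) - c"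
    using assms unfolding hyperboloid_form_def by blast
  have eq: "z powr \<alpha> - f (T x) = z\<^sup>2 - (\<Sum>i\<in>UNIV. (a $ i)\<^sup>2 * (x $ i)\<^sup>2) - c" if "0 < z" for x z
    using g[of x z] that by (simp add: power_dom_def gfun_def)
  \<comment> \<open>Comparing z = 1 with z = 2 over the same x eliminates f.\<close>
  have "2 powr \<alpha> = (2::real) powr 2" using eq[of 1 0] eq[of 2 0] by simp
  then have al: "\<alpha> = 2" by (rule powr_inj[THEN iffD1, rotated 2]) auto
  have fT: "f (T x) = c + (\<Sum>i\<in>UNIV. (a $ i)\<^sup>2 * (x $ i)\<^sup>2)" for x using eq[of 1 x] by simp
  define b where "b = T 0"
  have oT: "orthogonal_transformation (\<lambda>x. T x - b)"
    unfolding orthogonal_transformation_isometry using T by (simp add: b_def dist_norm)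
  define M where "M = matrix (\<lambda>x. T x - b)"
  have M: "orthogonal_matrix M" "\<And>x. T x = b + M *v x"
    using oT by (auto simp: M_def orthogonal_transformation_matrix matrix_works algebra_simps)
  have MM: "M *v (transpose M *v x) = x" "transpose M *v (M *v x) = x" for x
    using M(1) by (simp_all add: matrix_vector_mul_assoc orthogonal_matrix_def)
  define G where "G = M ** diag (\<chi> i. (a $ i)\<^sup>2) ** transpose M"
  have Gform: "v \<bullet> (G *v v) = (\<Sum>i\<in>UNIV. (a $ i)\<^sup>2 * ((transpose M *v v) $ i)\<^sup>2)" for v
  proof -
    have "v \<bullet> (G *v v) = (transpose M *v v) \<bullet> (diag (\<chi> i. (a $ i)\<^sup>2) *v (transpose M *v v))"
      using inner_transpose_mult[of v "transpose M"] by (simp add: G_def matrix_vector_mul_assoc[symmetric])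
    then show ?thesis by (simp add: diag_mult_vec inner_vec_def power2_eq_square mult_ac)
  qed
  have "pos_def G" unfolding pos_def_def
  proof (intro conjI allI impI)
    show "transpose G = G" by (simp add: G_def matrix_transpose_mul matrix_mul_assoc)
    fix v :: "real^'n" assume "v \<noteq> 0"
    then have "transpose M *v v \<noteq> 0" using MM(1)[of v] by auto
    then obtain i where i: "(transpose M *v v) $ i \<noteq> 0" by (auto simp: vec_eq_iff)
    show "0 < v \<bullet> (G *v v)" unfolding Gform
      by (rule sum_pos2[of _ i]) (use i less_imp_neq[OF a[of i]] in \<open>auto simp: zero_less_mult_iff\<close>)
  qed
  moreover have "f x = c + (x - b) \<bullet> (G *v (x - b))" for x
    using fT[of "transpose M *v (x - b)"] by (simp add: M(2) MM Gform)
  ultimately show thesis using that al by blast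
qed

end

locale hyperboloid = power_graph f \<alpha> for f :: "real^'n \<Rightarrow> real" and \<alpha> +
  fixes G :: "real^'n^'n" and b :: "real^'n" and c :: real
  assumes al: "\<alpha> = 2" and Gpd: "pos_def G" and f_quadratic: "\<And>x. f x = c + (x - b) \<bullet> (G *v (x - b))"
begin

lemma grad_quadratic: "grad f x = 2 *\<^sub>R (G *v (x - b))"
proof -
  have sym: "transpose G = G" using Gpd by (simp add: pos_def_def)
  have mv: "((\<lambda>x. G *v (x - b)) has_derivative (\<lambda>v. G *v v)) (at x)"
    by (rule has_derivative_compose[OF _ bounded_linear.has_derivative[OF matrix_vector_mul_bounded_linear has_derivative_ident], of "\<lambda>x. x - b" "\<lambda>v. v", simplified])
      (auto intro!: derivative_eq_intros)
  have "((\<lambda>x. c + (x - b) \<bullet> (G *v (x - b))) has_derivative (\<lambda>v. (x - b) \<bullet> (G *v v) + v \<bullet> (G *v (x - b)))) (at x)"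
  proof -
    have "((\<lambda>x. x - b) has_derivative (\<lambda>v. v)) (at x)" by (auto intro!: derivative_eq_intros)
    from has_derivative_add[OF has_derivative_const has_derivative_inner[OF this mv]] show ?thesis by simp
  qed
  moreover have "(\<lambda>x. c + (x - b) \<bullet> (G *v (x - b))) = f" using f_quadratic by auto
  ultimately have "(f has_derivative (\<lambda>v. (2 *\<^sub>R (G *v (x - b))) \<bullet> v)) (at x)"
    by (simp add: sym_inner[OF sym, of "x - b"] inner_commute[of _ "G *v (x - b)"])
  from has_derivative_unique[OF this grad_has_derivative_real[OF f]]
  have "(2 *\<^sub>R (G *v (x - b))) \<bullet> v = grad f x \<bullet> v" for v by metis
  then show ?thesis by (metis vector_eq_rdot)
qed

lemma hess_quadratic: "hess f x = 2 *\<^sub>R G"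
proof -
  have "hess f x *v v = (2 *\<^sub>R G) *v v" for v
  proof -
    have "(grad f has_derivative (\<lambda>v. (2 *\<^sub>R G) *v v)) (at x)"
    proof -
      have "((\<lambda>x. (2 *\<^sub>R G) *v (x - b)) has_derivative (\<lambda>v. (2 *\<^sub>R G) *v v)) (at x)"
        by (rule has_derivative_compose[OF _ bounded_linear.has_derivative[OF matrix_vector_mul_bounded_linear has_derivative_ident], of "\<lambda>x. x - b" "\<lambda>v. v", simplified])
          (auto intro!: derivative_eq_intros)
      moreover have "(\<lambda>x. (2 *\<^sub>R G) *v (x - b)) = grad f"
        by (simp add: fun_eq_iff grad_quadratic scaleR_matrix_vector_assoc)
      ultimately show ?thesis by simp
    qed
    from has_derivative_unique[OF this grad_has_derivative[OF f]] show ?thesis by metis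
  qed
  then show ?thesis by (simp add: matrix_eq)
qed

lemma alpha_pos: "0 < \<alpha>" and sgn_alpha: "sgn \<alpha> = 1"
  by (simp_all add: al)

lemma beta_half: "\<beta> = 1 / 2"
  unfolding \<beta>_def by (simp add: al)

lemma u_sqrt: "u k x = sqrt (k + f x)" if "x \<in> pdom k"
  using that unfolding u_def pdom_def by (simp add: al powr_half_sqrt)

lemma delta_sqrt: "\<delta> k x = 2 * u k x"
  unfolding \<delta>_def u_def beta_half by (simp add: al)

lemma xi_eq: "\<xi> k x = (1 / u k x) *\<^sub>R (G *v (x - b))"
proof -
  have "\<xi> k x = (inverse (2 * u k x) * 2) *\<^sub>R (G *v (x - b))"
    by (simp only: \<xi>_def delta_sqrt grad_quadratic scaleR_scaleR)
  also have "inverse (2 * u k x) * 2 = 1 / u k x" by (simp add: divide_simps)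
  finally show ?thesis .
qed

text \<open>For k > - c the Cauchy-Schwarz inequality bounds the correction by the Hessian form
  times (f - c) / (k + f), a ratio less than 1. Conversely k + f must be positive at the centre b,
  where f = c.\<close>

lemma good_iff: "good k \<longleftrightarrow> - c < k"
proof
  assume "good k"
  then have "b \<in> pdom k" using goodD(5) alpha_pos by simp
  then show "- c < k" by (simp add: pdom_def f_quadratic)
next
  assume k: "- c < k"
  have Gnn: "0 \<le> v \<bullet> (G *v v)" for v
    using Gpd by (cases "v = 0") (auto simp: pos_def_def intro: less_imp_le)
  have w: "0 < k + f x" for x using k Gnn[of "x - b"] by (simp add: f_quadratic)
  then have U: "pdom k = UNIV" by (simp add: pdom_def)
  show "good k"
  proof (rule goodI)
    fix x
    have "0 < v \<bullet> (B k x *v v)" if v: "v \<noteq> 0" for v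
    proof -
      define X where "X = x - b"
      have vG: "0 < v \<bullet> (G *v v)" using Gpd v by (simp add: pos_def_def)
      have "(grad f x \<bullet> v)\<^sup>2 = 4 * (v \<bullet> (G *v X))\<^sup>2"
        by (simp add: grad_quadratic X_def power_mult_distrib inner_commute)
      also have "\<dots> \<le> 4 * ((v \<bullet> (G *v v)) * (f x - c))"
        using pos_def_Cauchy_Schwarz[OF Gpd, of v X] by (simp add: f_quadratic X_def)
      finally have "1 / 2 / (k + f x) * (grad f x \<bullet> v)\<^sup>2 \<le> 1 / 2 / (k + f x) * (4 * ((v \<bullet> (G *v v)) * (f x - c)))"
        using w[of x] by (intro mult_left_mono) auto
      also have "\<dots> = 2 * (v \<bullet> (G *v v)) * ((f x - c) / (k + f x))"
        using w[of x] by (simp add: field_simps)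
      also have "\<dots> < 2 * (v \<bullet> (G *v v)) * 1"
        using vG w[of x] k by (intro mult_strict_left_mono) (auto simp: divide_less_eq)
      finally show ?thesis unfolding B_form beta_half by (simp add: hess_quadratic scaleR_matrix_vector_assoc[symmetric])
    qed
    then show "pos_def (sgn \<alpha> *\<^sub>R B k x)" unfolding pos_def_sgn_iff by (simp add: sgn_alpha)
  qed (auto simp: U)
qed

lemma S_hyperboloid: "is_Sg f \<alpha> S \<Longrightarrow> S = {- c<..}"
  using S_eq good_iff by auto

lemma I_hyperboloid: "is_Sg f \<alpha> S \<Longrightarrow> k \<in> S \<Longrightarrow> is_Ik f \<alpha> S k J \<Longrightarrow> J = {k<..}"
  using I_eq[of S k J] S_hyperboloid[of S] by (auto simp: good_iff sgn_alpha)

text \<open>On the closed half-space \<open>z powr 2\<close> is the square of z, so the gradient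
  formula extends to height 0. It vanishes only at the apex \<open>(b, 0)\<close>, which lies on the
  level - c.\<close>

lemma Rg_hyperboloid: "Rg f \<alpha> = UNIV - {- c}"
proof -
  have gb: "grad f x = 0 \<longleftrightarrow> x = b" for x
    using pos_def_inj[OF Gpd, of "x - b" 0] by (auto simp: grad_quadratic)
  have fb: "f b = c" by (simp add: f_quadratic)
  have "- c \<notin> Rg f \<alpha>"
  proof
    assume R: "- c \<in> Rg f \<alpha>"
    have "(b, 0) \<in> Mk f \<alpha> (- c)" using fb al by (simp add: level_set_def power_dom_def gfun_def)
    then obtain v where "v \<noteq> 0" "(gfun f \<alpha> has_derivative (\<lambda>w. v \<bullet> w)) (at (b, 0) within power_dom \<alpha>)"
      using R by (auto simp: regular_values_def)
    then show False using critical_at_zero[of b v] gb al by auto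
  qed
  moreover have "k \<in> Rg f \<alpha>" if k: "k \<noteq> - c" for k
  proof -
    have "\<exists>v. v \<noteq> 0 \<and> (gfun f \<alpha> has_derivative (\<lambda>w. v \<bullet> w)) (at (x, z) within power_dom \<alpha>)"
      if xz: "(x, z) \<in> Mk f \<alpha> k" for x z
    proof (intro exI conjI)
      have d: "(x, z) \<in> power_dom \<alpha>" and e: "z powr 2 - f x = k" using xz by (auto simp: level_set_def gfun_def al)
      show "(- grad f x, 2 * z) \<noteq> 0"
      proof
        assume "(- grad f x, 2 * z) = 0"
        then have "x = b" "z = 0" by (auto simp: zero_prod_def gb)
        then show False using e k fb by simp
      qed
      have f1: "((\<lambda>p. f (fst p)) has_derivative (\<lambda>w. grad f x \<bullet> fst w)) (at (x, z) within power_dom \<alpha>)"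
        by (rule has_derivative_compose[where f = fst, OF has_derivative_fst[OF has_derivative_ident]])
           (simp add: grad_has_derivative_real[OF f])
      have "((\<lambda>p. (snd p)\<^sup>2 - f (fst p)) has_derivative (\<lambda>w. 2 * z * snd w - grad f x \<bullet> fst w)) (at (x, z) within power_dom \<alpha>)"
        by (intro has_derivative_diff f1) (auto intro!: derivative_eq_intros)
      then have "(gfun f \<alpha> has_derivative (\<lambda>w. 2 * z * snd w - grad f x \<bullet> fst w)) (at (x, z) within power_dom \<alpha>)"
      proof (rule has_derivative_transform[OF d, rotated])
        fix p :: "'n pt" assume "p \<in> power_dom \<alpha>"
        then have "0 \<le> snd p" by (auto simp: power_dom_def al)
        then show "gfun f \<alpha> p = (snd p)\<^sup>2 - f (fst p)"
          by (cases "snd p = 0") (auto simp: gfun_def al case_prod_beta)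
      qed
      moreover have "(\<lambda>w. 2 * z * snd w - grad f x \<bullet> fst w) = (\<lambda>w. (- grad f x, 2 * z) \<bullet> w)"
        by (auto simp: inner_prod_def)
      ultimately show "(gfun f \<alpha> has_derivative (\<lambda>w. (- grad f x, 2 * z) \<bullet> w)) (at (x, z) within power_dom \<alpha>)" by simp
    qed
    then show ?thesis by (auto simp: regular_values_def)
  qed
  ultimately show ?thesis by blast
qed

text \<open>By \<open>sec_eq\<close> the volume of a section depends on x0, apart from a factor,
  only through t = \<open>u k x0 * s\<close>; \<kappa> stands for k + c.\<close>

definition "sec_model \<kappa> t = unit_ball_vol (CARD('n)) * sqrt (\<kappa> * ((1 + t / \<kappa>)\<^sup>2 - 1)) ^ CARD('n) / sqrt (det G * \<kappa>)"

text \<open>Squaring the inequality that defines the sublevel set yields an ellipsoid centred at b +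
  la (x0 - b). Its matrix is a rank-one update of G whose determinant is det G times \<kappa> /
  z0^2, which produces the factor \<open>u k x0\<close>.\<close>

lemma sec_eq:
  assumes k: "good k" and s: "0 \<le> s"
  shows "sec k x0 s = u k x0 * sec_model (k + c) (u k x0 * s)"
proof -
  define \<kappa> z0 X0 p Q0 where "\<kappa> = k + c" and "z0 = u k x0" and "X0 = x0 - b" and "p = G *v X0" and "Q0 = X0 \<bullet> p"
  have \<kappa>: "0 < \<kappa>" using k by (simp add: \<kappa>_def good_iff)
  have Gnn: "0 \<le> v \<bullet> (G *v v)" for v
    using Gpd by (cases "v = 0") (auto simp: pos_def_def intro: less_imp_le)
  have dom: "x \<in> pdom k" for x using goodD(5)[OF k] alpha_pos by simp
  have u2: "(u k x)\<^sup>2 = \<kappa> + (x - b) \<bullet> (G *v (x - b))" for x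
    using dom[of x] by (simp add: u_sqrt[OF dom] pdom_def \<kappa>_def f_quadratic less_imp_le)
  have z0: "0 < z0" unfolding z0_def by (rule u_pos[OF dom])
  have z02: "z0\<^sup>2 = \<kappa> + Q0" using u2[of x0] by (simp add: z0_def Q0_def p_def X0_def)
  have \<xi>: "\<xi> k x0 = (1 / z0) *\<^sub>R p"
    by (simp only: xi_eq p_def X0_def z0_def)
  \<comment> \<open>In coordinates centred at \<open>(b, 0)\<close> the tangent hyperplane is
    \<open>z0 * z - p \<bullet> X = \<kappa>\<close>. Its vertical shift by s passes through la
    times the point of tangency, which is the centre of the section.\<close>
  define la where "la = 1 + z0 * s / \<kappa>"
  have la: "1 \<le> la" "la * \<kappa> = \<kappa> + z0 * s" using \<kappa> z0 s by (auto simp: la_def field_simps)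
  define G' where "G' = G - (1 / z0\<^sup>2) *\<^sub>R outer p"
  have Q0: "0 \<le> Q0" using Gnn[of X0] by (simp add: Q0_def p_def)
  have CS: "(p \<bullet> v)\<^sup>2 \<le> Q0 * (v \<bullet> (G *v v))" for v
    using pos_def_Cauchy_Schwarz[OF Gpd, of v X0] by (simp add: p_def Q0_def inner_commute mult.commute)
  have G'form: "v \<bullet> (G' *v v) = v \<bullet> (G *v v) - (p \<bullet> v)\<^sup>2 / z0\<^sup>2" for v
    by (simp add: G'_def matrix_vector_mult_diff_rdistrib scaleR_matrix_vector_assoc[symmetric] inner_diff_right
      power2_eq_square inner_commute[of v p])
  have G'pd: "pos_def G'" unfolding pos_def_def
  proof (intro conjI allI impI)
    show "transpose G' = G'" using Gpd unfolding pos_def_def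
      by (simp add: G'_def transpose_def vec_eq_iff outer_def mult.commute)
    fix v :: "real^'n" assume v: "v \<noteq> 0"
    have vG: "0 < v \<bullet> (G *v v)" using Gpd v by (simp add: pos_def_def)
    have "(p \<bullet> v)\<^sup>2 < z0\<^sup>2 * (v \<bullet> (G *v v))"
      using CS[of v] mult_strict_right_mono[OF _ vG, of Q0 "z0\<^sup>2"] z02 \<kappa> by linarith
    then show "0 < v \<bullet> (G' *v v)" using z0 by (simp add: G'form field_simps)
  qed
  have det': "det G' = det G * (\<kappa> / z0\<^sup>2)"
  proof -
    have "det G' = det G * (1 - 1 / z0\<^sup>2 * (X0 \<bullet> p))"
      unfolding G'_def by (rule det_rank_one_update[OF Gpd]) (simp add: p_def)
    also have "1 - 1 / z0\<^sup>2 * (X0 \<bullet> p) = (z0\<^sup>2 - Q0) / z0\<^sup>2" using z0 by (simp add: Q0_def diff_divide_distrib)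
    also have "z0\<^sup>2 - Q0 = \<kappa>" by (simp add: z02)
    finally show ?thesis .
  qed
  define e where "e = b + la *\<^sub>R X0"
  define \<rho> where "\<rho> = \<kappa> * (la\<^sup>2 - 1)"
  have \<rho>: "0 \<le> \<rho>" using \<kappa> la(1) by (simp add: \<rho>_def)
  have iff: "q k x0 x \<le> s \<longleftrightarrow> (x - e) \<bullet> (G' *v (x - e)) \<le> \<rho>" for x
  proof -
    define X Y where "X = x - b" and "Y = x - e"
    have XY: "X = la *\<^sub>R X0 + Y" by (simp add: X_def Y_def e_def)
    have pX: "p \<bullet> X = la * Q0 + p \<bullet> Y" by (simp add: XY Q0_def inner_add_right inner_commute)
    have sym: "X0 \<bullet> (G *v Y) = p \<bullet> Y"
      using sym_inner[of G X0 Y] Gpd by (simp add: p_def pos_def_def)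
    have XX: "X \<bullet> (G *v X) = la\<^sup>2 * Q0 + 2 * la * (p \<bullet> Y) + Y \<bullet> (G *v Y)"
      by (simp add: XY matrix_vector_right_distrib matrix_vector_mult_scaleR inner_add sym p_def[symmetric]
        Q0_def power2_eq_square inner_commute[of Y p] algebra_simps)
    have ux: "0 < u k x" by (rule u_pos[OF dom])
    have "q k x0 x \<le> s \<longleftrightarrow> u k x \<le> z0 + s + (p \<bullet> (X - X0)) / z0"
      by (simp add: q_def l_def \<xi> X_def X0_def z0_def[symmetric]) (simp add: algebra_simps)
    also have "\<dots> \<longleftrightarrow> z0 * u k x \<le> z0\<^sup>2 + z0 * s + p \<bullet> (X - X0)"
    proof -
      have "z0 * (z0 + s + (p \<bullet> (X - X0)) / z0) = z0\<^sup>2 + z0 * s + p \<bullet> (X - X0)"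
      proof -
        have "z0 * ((p \<bullet> (X - X0)) / z0) = p \<bullet> (X - X0)" using z0 by simp
        then show ?thesis by (simp only: distrib_left power2_eq_square)
      qed
      then show ?thesis using mult_le_cancel_left_pos[OF z0, of "u k x" "z0 + s + (p \<bullet> (X - X0)) / z0"] by simp
    qed
    also have "z0\<^sup>2 + z0 * s + p \<bullet> (X - X0) = la * \<kappa> + p \<bullet> X"
      by (simp add: z02 la(2) inner_diff_right Q0_def inner_commute)
    \<comment> \<open>Squaring is reversible because Cauchy-Schwarz bounds
      \<open>\<bar>p \<bullet> X\<bar>\<close> by \<open>z0 * u k x\<close>, so the right side
      exceeds \<open>- (z0 * u k x)\<close>.\<close>
    also have "z0 * u k x \<le> la * \<kappa> + p \<bullet> X \<longleftrightarrow> (z0 * u k x)\<^sup>2 \<le> (la * \<kappa> + p \<bullet> X)\<^sup>2"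
    proof -
      have "(p \<bullet> X)\<^sup>2 \<le> Q0 * (X \<bullet> (G *v X))" by (rule CS)
      also have "\<dots> \<le> z0\<^sup>2 * (u k x)\<^sup>2"
        unfolding z02 u2 using Q0 \<kappa> Gnn[of X] by (intro mult_mono) (auto simp: X_def)
      finally have "\<bar>p \<bullet> X\<bar> \<le> \<bar>z0 * u k x\<bar>" unfolding abs_le_square_iff power_mult_distrib .
      then have "\<bar>p \<bullet> X\<bar> \<le> z0 * u k x" using z0 ux by simp
      then have "- (z0 * u k x) < la * \<kappa> + p \<bullet> X" using \<kappa> la(1) mult_pos_pos[of la \<kappa>] by linarith
      moreover have "0 < z0 * u k x" using z0 ux by simp
      ultimately show ?thesis unfolding abs_le_square_iff[symmetric] by linarith
    qed
    also have "\<dots> \<longleftrightarrow> z0\<^sup>2 * (Y \<bullet> (G *v Y)) - (p \<bullet> Y)\<^sup>2 \<le> z0\<^sup>2 * \<rho>"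
    proof -
      have "(z0 * u k x)\<^sup>2 = z0\<^sup>2 * (\<kappa> + (la\<^sup>2 * Q0 + 2 * la * (p \<bullet> Y) + Y \<bullet> (G *v Y)))"
        by (simp add: power_mult_distrib u2 X_def[symmetric] XX)
      moreover have "la * \<kappa> + p \<bullet> X = la * z0\<^sup>2 + p \<bullet> Y" by (simp add: pX z02 algebra_simps)
      then have "(la * \<kappa> + p \<bullet> X)\<^sup>2 = la\<^sup>2 * z0\<^sup>2 * z0\<^sup>2 + 2 * la * z0\<^sup>2 * (p \<bullet> Y) + (p \<bullet> Y)\<^sup>2"
        by (simp add: power2_eq_square algebra_simps)
      moreover have "la\<^sup>2 * z0\<^sup>2 * z0\<^sup>2 = z0\<^sup>2 * (la\<^sup>2 * \<kappa> + la\<^sup>2 * Q0)"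
        unfolding z02 by (simp add: algebra_simps)
      ultimately show ?thesis by (simp add: \<rho>_def algebra_simps)
    qed
    also have "\<dots> \<longleftrightarrow> Y \<bullet> (G' *v Y) \<le> \<rho>"
      using z0 by (simp add: G'form field_simps)
    finally show ?thesis by (simp add: Y_def)
  qed
  have "sec k x0 s = measure lebesgue {x. (x - e) \<bullet> (G' *v (x - e)) \<le> \<rho>}"
    by (simp add: sec_def iff dom)
  also have "\<dots> = unit_ball_vol (CARD('n)) * sqrt \<rho> ^ CARD('n) / sqrt (det G * (\<kappa> / z0\<^sup>2))"
    using measure_ellipsoid(2)[OF G'pd \<rho>] by (simp add: det')
  also have "sqrt (det G * (\<kappa> / z0\<^sup>2)) = sqrt (det G * \<kappa>) / z0"
    using z0 by (simp add: real_sqrt_divide real_sqrt_mult)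
  finally show ?thesis
    using z0 by (simp add: sec_model_def \<rho>_def la_def \<kappa>_def z0_def[symmetric])
qed

text \<open>Equal slopes put the two points of tangency on one ray from the centre
  \<open>(b, 0)\<close>, in the ratio la with la^2 = (\<kappa> + h) / \<kappa>, which does not
  depend on x0.\<close>

lemma gap_eq:
  assumes k: "good k" and h: "0 < h" and par: "\<xi> (k + h) y = \<xi> k x0"
  shows "u k x0 * gap k x0 (k + h) y = (sqrt ((k + c + h) / (k + c)) - 1) * (k + c)"
proof -
  define \<kappa> z0 w0 X0 where "\<kappa> = k + c" and "z0 = u k x0" and "w0 = u (k + h) y" and "X0 = x0 - b"
  have \<kappa>: "0 < \<kappa>" using k by (simp add: \<kappa>_def good_iff)
  have j: "good (k + h)" using k h by (simp add: good_iff)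
  have dom: "x \<in> pdom k" "x \<in> pdom (k + h)" for x using goodD(5)[OF k] goodD(5)[OF j] alpha_pos by auto
  have z0: "0 < z0" "0 < w0" unfolding z0_def w0_def by (auto intro: u_pos dom)
  have z02: "z0\<^sup>2 = \<kappa> + X0 \<bullet> (G *v X0)"
    using dom(1)[of x0] by (simp add: z0_def X0_def u_sqrt[OF dom(1)] pdom_def \<kappa>_def f_quadratic less_imp_le)
  have w02: "w0\<^sup>2 = \<kappa> + h + (y - b) \<bullet> (G *v (y - b))"
    using dom(2)[of y] by (simp add: w0_def u_sqrt[OF dom(2)] pdom_def \<kappa>_def f_quadratic less_imp_le)
  define la where "la = w0 / z0"
  have la: "0 < la" "w0 = la * z0" using z0 by (auto simp: la_def)
  have "(1 / w0) *\<^sub>R (G *v (y - b)) = (1 / z0) *\<^sub>R (G *v X0)"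
    using par by (simp only: xi_eq X0_def z0_def w0_def)
  then have "w0 *\<^sub>R ((1 / w0) *\<^sub>R (G *v (y - b))) = w0 *\<^sub>R ((1 / z0) *\<^sub>R (G *v X0))" by (rule arg_cong)
  then have "G *v (y - b) = G *v (la *\<^sub>R X0)"
    using z0 by (simp add: la_def matrix_vector_mult_scaleR)
  then have y: "y - b = la *\<^sub>R X0" by (rule pos_def_inj[OF Gpd])
  have "la\<^sup>2 * \<kappa> = \<kappa> + h"
    using w02 z02 by (simp add: y la(2) power_mult_distrib matrix_vector_mult_scaleR power2_eq_square algebra_simps)
  then have "la\<^sup>2 = (\<kappa> + h) / \<kappa>" using \<kappa> by (simp add: field_simps)
  then have la_sqrt: "la = sqrt ((\<kappa> + h) / \<kappa>)" using la(1) by (metis less_imp_le real_sqrt_unique)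
  have "y - x0 = (la - 1) *\<^sub>R X0" using y by (simp add: X0_def algebra_simps)
  then have "gap k x0 (k + h) y = w0 - z0 - (la - 1) * (X0 \<bullet> (G *v X0)) / z0"
    by (simp add: gap_def l_def xi_eq z0_def[symmetric] w0_def[symmetric] X0_def[symmetric] inner_commute)
  then have "z0 * gap k x0 (k + h) y = (la - 1) * (z0\<^sup>2 - X0 \<bullet> (G *v X0))"
    using z0 by (simp add: la(2) field_simps power2_eq_square)
  moreover have "z0\<^sup>2 - X0 \<bullet> (G *v X0) = \<kappa>" by (simp add: z02)
  ultimately have "z0 * gap k x0 (k + h) y = (la - 1) * \<kappa>" by (simp only:)
  then show ?thesis unfolding la_sqrt by (simp only: \<kappa>_def z0_def)
qed

lemma sec_model_nonneg: "0 \<le> \<kappa> \<Longrightarrow> 0 \<le> t \<Longrightarrow> 0 \<le> sec_model \<kappa> t"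
  using det_pos_def[OF Gpd] by (simp add: sec_model_def)

context
  fixes S :: "real set" and I :: "real \<Rightarrow> real set" and \<epsilon> :: "real \<Rightarrow> 'n pt \<Rightarrow> ereal"
  assumes S: "is_Sg f \<alpha> S" and I: "\<forall>k\<in>S. is_Ik f \<alpha> S k (I k)"
begin

lemma parallel_pair:
  assumes k: "k \<in> S" and h: "k + h \<in> I k" and p: "p \<in> Mk f \<alpha> k" and v: "v \<in> Mk f \<alpha> (k + h)"
    and par: "affine_parallel (tangent_g f \<alpha> p) (tangent_g f \<alpha> v)"
  obtains x y where "p = (x, u k x)" "v = (y, u (k + h) y)" "good k" "good (k + h)" "0 < h"
    "x \<in> pdom k" "y \<in> pdom (k + h)" "\<xi> (k + h) y = \<xi> k x" "sgn \<alpha> * k < sgn \<alpha> * (k + h)"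
proof -
  have gk: "good k" using k S_eq[OF S] by simp
  have "I k = {k<..}" using I_hyperboloid[OF S k] I k by blast
  then have h0: "0 < h" using h by simp
  then have gj: "good (k + h)" using gk by (simp add: good_iff)
  obtain x where x: "p = (x, u k x)" "x \<in> pdom k" using p goodD(8)[OF gk] by auto
  obtain y where y: "v = (y, u (k + h) y)" "y \<in> pdom (k + h)" using v goodD(8)[OF gj] by auto
  have "\<xi> (k + h) y = \<xi> k x" using par parallel_tangent_iff[OF x(2) y(2)] x(1) y(1) by simp
  then show thesis using that[OF x(1) y(1) gk gj h0 x(2) y(2)] h0 by (simp add: sgn_alpha)
qed

lemma top_nonneg: "k \<in> S \<Longrightarrow> k + h \<in> I k \<Longrightarrow> 0 \<le> (sqrt ((k + c + h) / (k + c)) - 1) * (k + c)"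
proof -
  assume k: "k \<in> S" and h: "k + h \<in> I k"
  have "0 < k + c" using k S_hyperboloid[OF S] by simp
  moreover have "I k = {k<..}" using I_hyperboloid[OF S k] I k by blast
  then have "0 < h" using h by simp
  ultimately show ?thesis by simp
qed

text \<open>The factor \<open>u k x\<close> in \<open>sec_eq\<close> cancels against
  \<open>\<delta> k x = 2 * u k x\<close>, and by \<open>gap_eq\<close> the remaining argument is
  independent of the point.\<close>

lemma form_imp_A: "condition_A f \<alpha> S I \<epsilon>"
  unfolding condition_A_def
proof (intro ballI, rule exI, intro allI impI conjI ballI)
  fix k h assume k: "k \<in> S" and h: "k + h \<in> I k"
  let ?t = "(sqrt ((k + c + h) / (k + c)) - 1) * (k + c)"
  have \<kappa>: "0 \<le> k + c" using k S_hyperboloid[OF S] by simp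
  show "0 \<le> sec_model (k + c) ?t / 2"
    using sec_model_nonneg[OF \<kappa> top_nonneg[OF k h]] by simp
  fix p v assume p: "p \<in> Mk f \<alpha> k" and v: "v \<in> Mk f \<alpha> (k + h)" and
    a: "ereal \<bar>h\<bar> < \<epsilon> k p \<and> affine_parallel (tangent_g f \<alpha> p) (tangent_g f \<alpha> v) \<and> bounded (section_of (Mk f \<alpha> k) (tangent_g f \<alpha> v))"
  then obtain x y where xy: "p = (x, u k x)" "v = (y, u (k + h) y)" "good k" "good (k + h)" "0 < h"
    "x \<in> pdom k" "y \<in> pdom (k + h)" "\<xi> (k + h) y = \<xi> k x" "sgn \<alpha> * k < sgn \<alpha> * (k + h)"
    using parallel_pair[OF k h p v] by blast
  note g = gap_pos[OF xy(3,4,9,6,7,8)]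
  have "hyperplane_area (tangent_g f \<alpha> v) (section_of (Mk f \<alpha> k) (tangent_g f \<alpha> v)) / norm (grad_g f \<alpha> p)
      = sec k x (gap k x (k + h) y) / \<bar>\<delta> k x\<bar>"
    unfolding xy(1,2) by (rule section_area[OF xy(3,4,9,6,7,8)])
  also have "\<dots> = sec_model (k + c) ?t / 2"
    unfolding sec_eq[OF xy(3) less_imp_le[OF g]] gap_eq[OF xy(3,5,8)] delta_sqrt
    using u_pos[OF xy(6)] by simp
  finally show "hyperplane_area (tangent_g f \<alpha> v) (section_of (Mk f \<alpha> k) (tangent_g f \<alpha> v)) / norm (grad_g f \<alpha> p)
      = sec_model (k + c) ?t / 2" .
qed

text \<open>The substitution t = \<open>u k x * s\<close> absorbs the factor \<open>u k x\<close> of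
  \<open>sec_eq\<close> and maps the range of integration to one that \<open>gap_eq\<close> shows to
  be the same for all points.\<close>

lemma form_imp_V: "condition_V f \<alpha> S I \<epsilon>"
  unfolding condition_V_def
proof (intro ballI, rule exI, intro allI impI conjI ballI)
  fix k h assume k: "k \<in> S" and h: "k + h \<in> I k"
  let ?t = "(sqrt ((k + c + h) / (k + c)) - 1) * (k + c)"
  have \<kappa>: "0 < k + c" using k S_hyperboloid[OF S] by simp
  have cont: "continuous_on {0..?t} (sec_model (k + c))"
    unfolding sec_model_def using \<kappa> det_pos_def[OF Gpd] by (intro continuous_intros) auto
  then have int: "(sec_model (k + c) has_integral integral {0..?t} (sec_model (k + c))) {0..?t}"
    by (intro integrable_integral integrable_continuous_real)
  show "0 \<le> integral {0..?t} (sec_model (k + c))"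
    using sec_model_nonneg \<kappa> by (intro integral_nonneg integrable_continuous_real cont) auto
  fix p v assume p: "p \<in> Mk f \<alpha> k" and v: "v \<in> Mk f \<alpha> (k + h)" and
    a: "ereal \<bar>h\<bar> < \<epsilon> k p \<and> affine_parallel (tangent_g f \<alpha> p) (tangent_g f \<alpha> v) \<and> bounded (cap_of (Mk f \<alpha> k) p (tangent_g f \<alpha> v))"
  then obtain x y where xy: "p = (x, u k x)" "v = (y, u (k + h) y)" "good k" "good (k + h)" "0 < h"
    "x \<in> pdom k" "y \<in> pdom (k + h)" "\<xi> (k + h) y = \<xi> k x" "sgn \<alpha> * k < sgn \<alpha> * (k + h)"
    using parallel_pair[OF k h p v] by blast
  define z g where "z = u k x" and "g = gap k x (k + h) y"
  have z: "0 < z" unfolding z_def by (rule u_pos[OF xy(6)])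
  have zg: "z * g = ?t" unfolding z_def g_def by (rule gap_eq[OF xy(3,5,8)])
  have "((\<lambda>s. sec_model (k + c) (z * s)) has_integral (1 / \<bar>z\<bar>) *\<^sub>R integral {0..?t} (sec_model (k + c))) ((\<lambda>s. s / z) ` {0..?t})"
    using has_integral_stretch_real[of "sec_model (k + c)" _ 0 ?t z] int z by simp
  moreover have "(\<lambda>s. s / z) ` {0..?t} = {0..g}"
  proof -
    have "(\<lambda>s. s / z) ` {0..z * g} = {0 / z..(z * g) / z}"
      using z by (force simp: image_iff field_simps)
    also have "\<dots> = {0..g}" using z by simp
    finally show ?thesis unfolding zg .
  qed
  ultimately have "((\<lambda>s. z * sec_model (k + c) (z * s)) has_integral z * ((1 / \<bar>z\<bar>) *\<^sub>R integral {0..?t} (sec_model (k + c)))) {0..g}"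
    by (intro has_integral_mult_right) simp
  then have "(sec k x has_integral integral {0..?t} (sec_model (k + c))) {0..g}"
    by (rule has_integral_eq[rotated, where f = "\<lambda>s. z * sec_model (k + c) (z * s)", THEN has_integral_eq_rhs])
      (use z sec_eq[OF xy(3)] in \<open>auto simp: z_def\<close>)
  from has_integral_unique[OF cap_measure[OF xy(3,4,9,6,7,8)] this[unfolded g_def]]
  show "measure lebesgue (cap_of (Mk f \<alpha> k) p (tangent_g f \<alpha> v)) = integral {0..?t} (sec_model (k + c))"
    unfolding xy(1,2) .
qed

end
end

theorem theorem2:
  fixes f :: "real^'n \<Rightarrow> real" and \<alpha> :: real
    and S :: "real set" and I :: "real \<Rightarrow> real set"
    and \<epsilon> :: "real \<Rightarrow> (real^'n) \<times> real \<Rightarrow> ereal"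
  assumes "smooth f"
    and "\<forall>x. 0 \<le> f x"
    and "strictly_convex_function f"
    and "\<alpha> \<noteq> 0" and "\<alpha> \<noteq> 1"
    and "is_Sg f \<alpha> S"
    and "\<forall>k\<in>S. is_Ik f \<alpha> S k (I k)"
    and "\<forall>k p. 0 < \<epsilon> k p"
  shows "(condition_V f \<alpha> S I \<epsilon> \<longleftrightarrow> condition_A f \<alpha> S I \<epsilon>)
       \<and> (condition_A f \<alpha> S I \<epsilon> \<longleftrightarrow> condition_K f \<alpha> S)
       \<and> (condition_K f \<alpha> S \<longleftrightarrow> (\<exists>c. hyperboloid_form f \<alpha> c))
       \<and> (\<forall>c. hyperboloid_form f \<alpha> c \<longrightarrow>
             Rg f \<alpha> = UNIV - {- c} \<and> S = {- c<..} \<and> (\<forall>k\<in>S. I k = {k<..}))"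
proof -
  interpret power_graph f \<alpha>
    using assms hess_pos_def[OF assms(1,3)] by unfold_locales auto
  have form: "condition_V f \<alpha> S I \<epsilon> \<and> condition_A f \<alpha> S I \<epsilon> \<and>
      Rg f \<alpha> = UNIV - {- c} \<and> S = {- c<..} \<and> (\<forall>k\<in>S. I k = {k<..})" if c: "hyperboloid_form f \<alpha> c" for c
  proof -
    obtain G b where G: "\<alpha> = 2" "pos_def G" "\<And>x. f x = c + (x - b) \<bullet> (G *v (x - b))"
      using hyperboloid_form_quadratic[OF c] by metis
    interpret hyperboloid f \<alpha> G b c by unfold_locales (rule G)+
    show ?thesis
      using form_imp_V[OF assms(6,7)] form_imp_A[OF assms(6,7)] Rg_hyperboloid S_hyperboloid[OF assms(6)]
        I_hyperboloid[OF assms(6)] assms(7) by blast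
  qed
  \<comment> \<open>The implications close up: V and A each give K, K gives the form, and the form
    gives back both V and A.\<close>
  show ?thesis
    using form V_imp_K[OF assms(6,7,8)] A_imp_K[OF assms(6,7,8)] K_imp_form[OF assms(6)] by blast
qed

end
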